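(* Let $\alpha\in(0,1)\cup(1,\infty)$, and let $\xi_0,\xi_1,\ldots$ be nondegenerate i.i.d. complex-valued random variables with $\mathbb{E}\log(1+|\xi_0|)<\infty$. For $n\in\mathbb{N}$ let $$\mathbf{H}_n(z)=\begin{cases}\displaystyle\sum_{k=0}^\infty\xi_ke^{n^{1-\alpha}k^\alpha}z^k & \text{if }\alpha<1,\ z\in\mathbb{D},\\[2mm] \displaystyle\sum_{k=0}^\infty\xi_ke^{-n^{1-\alpha}k^\alpha}z^k & \text{if }\alpha>1,\ z\in\mathbb{C}.\end{cases}$$ Then, as $n\to\infty$, the sequence of random measures $\frac1n\mu_{\mathbf{H}_n}$ (on $\mathbb{D}$ if $\alpha<1$, on $\mathbb{C}$ if $\alpha>1$) converges in probability to the deterministic measure having the density $$z\mapsto\frac{1}{2\pi\alpha|1-\alpha|}\,\frac1{|z|^2}\,\Bigl|\frac{\log|z|}{\alpha}\Bigr|^{(2-\alpha)/(\alpha-1)}$$ with respect to Lebesgue measure, where the density is restricted to $\mathbb{D}$ in the case $\alpha<1$ and to $\mathbb{C}\setminus\mathbb{D}$ in the case $\alpha>1$.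
   Context: $\mathbb{D}=\{z\in\mathbb{C}:|z|<1\}$. "Nondegenerate" means not a.s. constant. The series defining $\mathbf{H}_n$ converge a.s. on the indicated domains. "Restricted to" a set means that the limiting measure has density zero outside that set. For a function $G$ analytic in a domain $D$ and not identically zero, $\mu_G=\sum_{z\in D: G(z)=0}n_G(z)\,\delta(z)$, where $n_G(z)$ is the multiplicity of the zero $z$ and $\delta(z)$ is the unit mass at $z$; if $G\equiv 0$, then $\mu_G=0$. Locally finite measures on a locally compact metric space $X$ are endowed with the vague topology (convergence of integrals of continuous compactly supported functions). Random measures $\nu_n$ converge to $\nu$ in probability if $\int_X\varphi\,d\nu_n\to\int_X\varphi\,d\nu$ in probability for every continuous compactly supported $\varphi:X\to\mathbb{R}$. *)

theory Defs
  imports "HOL-Probability.Probability" "HOL-Complex_Analysis.Complex_Analysis"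
begin

(* A continuous compactly supported function on the subspace X. Its values off X play no role. *)
definition compactly_supported_on :: "'a::topological_space set \<Rightarrow> ('a \<Rightarrow> real) \<Rightarrow> bool" where
  "compactly_supported_on X \<phi> \<longleftrightarrow>
     continuous_on X \<phi> \<and> (\<exists>K. compact K \<and> K \<subseteq> X \<and> (\<forall>z\<in>X - K. \<phi> z = 0))"

(* The completion of M is used because the variables below may be determined only almost surely.
   Requiring measurability ensures that the events in the second clause have a genuine
   probability: "measure" returns 0 on non-measurable sets. *)
definition tendsto_in_probability ::
    "'w measure \<Rightarrow> (nat \<Rightarrow> 'w \<Rightarrow> real) \<Rightarrow> ('w \<Rightarrow> real) \<Rightarrow> bool" where
  "tendsto_in_probability M X Y \<longleftrightarrow>
     (\<forall>n. X n \<in> borel_measurable (completion M)) \<and> Y \<in> borel_measurable (completion M) \<and>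
     (\<forall>\<epsilon>>0. (\<lambda>n. measure (completion M) {\<omega> \<in> space M. \<bar>X n \<omega> - Y \<omega>\<bar> > \<epsilon>}) \<longlonglongrightarrow> 0)"

definition random_measures_tendsto_in_probability ::
    "'w measure \<Rightarrow> 'a::topological_space set \<Rightarrow> (nat \<Rightarrow> 'w \<Rightarrow> 'a measure) \<Rightarrow> ('w \<Rightarrow> 'a measure) \<Rightarrow> bool" where
  "random_measures_tendsto_in_probability M X \<nu> \<nu>' \<longleftrightarrow>
     (\<forall>\<phi>. compactly_supported_on X \<phi> \<longrightarrow>
        tendsto_in_probability M (\<lambda>n \<omega>. \<integral>z. \<phi> z \<partial>\<nu> n \<omega>) (\<lambda>\<omega>. \<integral>z. \<phi> z \<partial>\<nu>' \<omega>))"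

(* The Borel measure on D that charges each zero with its multiplicity, written as the image of
   the weighted counting measure on the zero set under the inclusion into D. *)
definition zero_measure :: "complex set \<Rightarrow> (complex \<Rightarrow> complex) \<Rightarrow> complex measure" where
  "zero_measure D G =
     (if \<forall>z\<in>D. G z = 0 then null_measure (restrict_space borel D)
      else distr (density (count_space {z\<in>D. G z = 0}) (\<lambda>z. of_nat (nat (zorder G z))))
             (restrict_space borel D) (\<lambda>z. z))"

definition H_domain :: "real \<Rightarrow> complex set" where
  "H_domain \<alpha> = (if \<alpha> < 1 then ball 0 1 else UNIV)"

definition H :: "real \<Rightarrow> (nat \<Rightarrow> complex) \<Rightarrow> nat \<Rightarrow> complex \<Rightarrow> complex" where
  "H \<alpha> a n z =
     (if \<alpha> < 1
      then \<Sum>k. a k * of_real (exp (real n powr (1 - \<alpha>) * real k powr \<alpha>)) * z ^ k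
      else \<Sum>k. a k * of_real (exp (- (real n powr (1 - \<alpha>) * real k powr \<alpha>))) * z ^ k)"

definition limit_density :: "real \<Rightarrow> complex \<Rightarrow> real" where
  "limit_density \<alpha> z =
     1 / (2 * pi * \<alpha> * \<bar>1 - \<alpha>\<bar>) * (1 / (norm z)\<^sup>2)
       * \<bar>ln (norm z) / \<alpha>\<bar> powr ((2 - \<alpha>) / (\<alpha> - 1))
       * indicator (if \<alpha> < 1 then ball 0 1 else - ball 0 1) z"

definition limit_measure :: "real \<Rightarrow> complex measure" where
  "limit_measure \<alpha> = density (restrict_space lborel (H_domain \<alpha>)) (\<lambda>z. ennreal (limit_density \<alpha> z))"

end

theory Submission
  imports Defs
begin

text \<open>
  Write \<open>u\<^sub>n = ln \<bar>H\<^sub>n\<bar> / n\<close>. Almost surely \<open>\<bar>\<xi>\<^sub>k\<bar> \<le> C exp (\<epsilon> k)\<close>, so a geometric series bounds \<open>u\<^sub>n\<close> from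
  above by the Legendre transform \<open>U(z)\<close> of the exponent, locally uniformly. For a fixed point \<open>c \<noteq> 0\<close>
  many coefficients with exponentially separated weights are close to the maximal one; a small value
  of \<open>H\<^sub>n(c)\<close> would confine each of them to a small ball, which has small probability, so
  \<open>u\<^sub>n(c) \<ge> U(c) - \<epsilon>\<close> with high probability. Since \<open>ln \<bar>H\<^sub>n\<bar>\<close> is subharmonic, lower bounds at the
  finitely many points of a grid suffice for \<open>u\<^sub>n \<rightarrow> U\<close> in \<open>L\<^sup>1\<close> on compact sets.

  Passing from \<open>u\<^sub>n\<close> to its Riesz measure needs no derivatives: the difference of the means of
  \<open>ln \<bar>z - a\<bar>\<close> over two concentric circles is a continuous compactly supported tent around \<open>a\<close>. Hence
  the convolution of a test function with a tent integrates against the zero measure as an integral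
  of \<open>ln \<bar>H\<^sub>n\<bar>\<close> against a continuous kernel, and such convolutions approximate the test function
  uniformly. The same identity for \<open>U\<close> and the limit measure follows by rotation averaging.
\<close>

subsection \<open>Lebesgue measure on the complex plane\<close>

text \<open>Near the zeros no pointwise lower bound for ln |H_n| can hold, which is why only
  finitely many points are tested and the topology is L^1. The small ball estimate at a point yields
  q^m plus tails, with m chosen before n; it carries no rate in n, so it gives convergence in
  probability and nothing summable. The logarithmic moment enters through the subexponential growth
  of the coefficients, nondegeneracy through a ball probability q < 1 that is uniform in the centre.
  The origin cannot be a test point, because H_n(0) = xi_0 may vanish with positive probability.
  Replacing a test function by its tent convolution costs the approximation error times the
  normalised number of zeros; that number must itself be bounded with high probability, and a second
  tent convolution, of a cutoff, does this. The series is controlled only almost surely, so the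
  random integrals are measurable with respect to the completion.\<close>

lemma lborel_complex_eq:
  "(lborel :: complex measure) = distr (lborel \<Otimes>\<^sub>M lborel) borel (\<lambda>p. Complex (fst p) (snd p))"
proof (rule lborel_eqI)
  have m [measurable]: "(\<lambda>p. Complex (fst p) (snd p)) \<in> borel_measurable (lborel \<Otimes>\<^sub>M lborel)"
    unfolding Complex_eq by simp
  fix l u :: complex
  assume le: "\<And>b. b \<in> Basis \<Longrightarrow> l \<bullet> b \<le> u \<bullet> b"
  have le': "Re l \<le> Re u" "Im l \<le> Im u"
    using le[of 1] le[of \<i>] by (auto simp: Basis_complex_def)
  have "(\<lambda>p. Complex (fst p) (snd p)) -` box l u \<inter> space (lborel \<Otimes>\<^sub>M lborel) = {Re l<..<Re u} \<times> {Im l<..<Im u}"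
    by (auto simp: box_def Basis_complex_def space_pair_measure)
  then show "emeasure (distr (lborel \<Otimes>\<^sub>M lborel) borel (\<lambda>p. Complex (fst p) (snd p))) (box l u)
     = (\<Prod>b\<in>Basis. (u - l) \<bullet> b)"
    using le' by (simp add: emeasure_distr lborel.emeasure_pair_measure_Times Basis_complex_def prod_ennreal ennreal_mult)
qed simp

text \<open>Both orders of integration are recorded because each of the two kinds of shear needs the
  coordinate that it moves to be innermost.\<close>

lemma nn_integral_complex:
  assumes [measurable]: "f \<in> borel_measurable (borel :: complex measure)"
  shows "(\<integral>\<^sup>+z. f z \<partial>lborel) = (\<integral>\<^sup>+x. \<integral>\<^sup>+y. f (Complex x y) \<partial>lborel \<partial>lborel)"
    and "(\<integral>\<^sup>+z. f z \<partial>lborel) = (\<integral>\<^sup>+y. \<integral>\<^sup>+x. f (Complex x y) \<partial>lborel \<partial>lborel)"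
proof -
  have m [measurable]: "(\<lambda>p. Complex (fst p) (snd p)) \<in> borel_measurable (lborel \<Otimes>\<^sub>M lborel)"
    unfolding Complex_eq by simp
  have eq: "(\<integral>\<^sup>+z. f z \<partial>lborel) = (\<integral>\<^sup>+p. f (Complex (fst p) (snd p)) \<partial>(lborel \<Otimes>\<^sub>M lborel))"
    by (subst lborel_complex_eq) (simp add: nn_integral_distr)
  show "(\<integral>\<^sup>+z. f z \<partial>lborel) = (\<integral>\<^sup>+x. \<integral>\<^sup>+y. f (Complex x y) \<partial>lborel \<partial>lborel)"
    by (subst eq, subst lborel.nn_integral_fst [symmetric]) (simp_all add: measurable_compose)
  show "(\<integral>\<^sup>+z. f z \<partial>lborel) = (\<integral>\<^sup>+y. \<integral>\<^sup>+x. f (Complex x y) \<partial>lborel \<partial>lborel)"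
    by (subst eq, subst lborel_pair.nn_integral_snd [symmetric]) (simp_all add: measurable_compose)
qed

lemma measurable_Complex [measurable]:
  "f \<in> borel_measurable M \<Longrightarrow> g \<in> borel_measurable M \<Longrightarrow> (\<lambda>x. Complex (f x) (g x)) \<in> borel_measurable M"
  unfolding Complex_eq by simp

text \<open>On every line parallel to the moved axis a shear is a translation, so Tonelli reduces
  the claim to translation invariance in one dimension.\<close>

lemma nn_integral_shear:
  assumes [measurable]: "f \<in> borel_measurable (borel :: complex measure)"
  shows "(\<integral>\<^sup>+z. f (Complex (Re z + a * Im z) (Im z)) \<partial>lborel) = (\<integral>\<^sup>+z. f z \<partial>lborel)"
    and "(\<integral>\<^sup>+z. f (Complex (Re z) (Im z + a * Re z)) \<partial>lborel) = (\<integral>\<^sup>+z. f z \<partial>lborel)"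
proof -
  have "(\<integral>\<^sup>+x. f (Complex (x + a * y) y) \<partial>lborel) = (\<integral>\<^sup>+x. f (Complex x y) \<partial>lborel)" for y
    using nn_integral_real_affine[of "\<lambda>x. f (Complex x y)" 1 "a * y"] by (simp add: add.commute)
  then show "(\<integral>\<^sup>+z. f (Complex (Re z + a * Im z) (Im z)) \<partial>lborel) = (\<integral>\<^sup>+z. f z \<partial>lborel)"
    by (simp add: nn_integral_complex(2))
  have "(\<integral>\<^sup>+y. f (Complex x (y + a * x)) \<partial>lborel) = (\<integral>\<^sup>+y. f (Complex x y) \<partial>lborel)" for x
    using nn_integral_real_affine[of "\<lambda>y. f (Complex x y)" 1 "a * x"] by (simp add: add.commute)
  then show "(\<integral>\<^sup>+z. f (Complex (Re z) (Im z + a * Re z)) \<partial>lborel) = (\<integral>\<^sup>+z. f z \<partial>lborel)"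
    by (simp add: nn_integral_complex(1))
qed

text \<open>A rotation other than \<open>-1\<close> is a product of three shears.\<close>

lemma nn_integral_rotate:
  fixes \<zeta> :: complex
  assumes [measurable]: "f \<in> borel_measurable borel" and \<zeta>: "norm \<zeta> = 1"
  shows "(\<integral>\<^sup>+z. f (\<zeta> * z) \<partial>lborel) = (\<integral>\<^sup>+z. f z \<partial>lborel)"
proof -
  have main: "(\<integral>\<^sup>+z. g (\<zeta> * z) \<partial>lborel) = (\<integral>\<^sup>+z. g z \<partial>lborel)"
    if \<zeta>: "norm \<zeta> = 1" "Re \<zeta> \<noteq> -1" and [measurable]: "g \<in> borel_measurable borel"
    for \<zeta> and g :: "complex \<Rightarrow> ennreal"
  proof -
    define c s where "c = Re \<zeta>" and "s = Im \<zeta>"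
    have cs: "c\<^sup>2 + s\<^sup>2 = 1" using \<zeta>(1) by (simp add: c_def s_def cmod_def)
    have c1: "1 + c \<noteq> 0" using \<zeta>(2) by (simp add: c_def)
    \<comment> \<open>For a rotation by the angle theta this is -tan(theta/2), the coefficient of
      the outer two shears; the middle one has coefficient sin(theta).\<close>
    define a where "a = - s / (1 + c)"
    have as: "a * s = c - 1"
    proof -
      have "- (s * s) = (c - 1) * (1 + c)" using cs by (simp add: power2_eq_square algebra_simps)
      then show ?thesis using c1 by (simp add: a_def field_simps)
    qed
    have ac: "a * (1 + c) = - s" using c1 by (simp add: a_def)
    define S1 where "S1 = (\<lambda>z. Complex (Re z + a * Im z) (Im z))"
    define S2 where "S2 = (\<lambda>z. Complex (Re z) (Im z + s * Re z))"
    have "S1 (S2 (S1 z)) = \<zeta> * z" for z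
    proof (rule complex_eqI)
      have "Re (S1 (S2 (S1 z))) = (1 + a * s) * Re z + a * (1 + (1 + a * s)) * Im z"
        by (simp add: S1_def S2_def algebra_simps)
      also have "\<dots> = c * Re z - s * Im z"
        using as ac by simp
      finally show "Re (S1 (S2 (S1 z))) = Re (\<zeta> * z)" by (simp add: c_def s_def)
      have "Im (S1 (S2 (S1 z))) = (1 + a * s) * Im z + s * Re z"
        by (simp add: S1_def S2_def algebra_simps)
      also have "\<dots> = c * Im z + s * Re z" using as by simp
      finally show "Im (S1 (S2 (S1 z))) = Im (\<zeta> * z)" by (simp add: c_def s_def)
    qed
    then have "(\<integral>\<^sup>+z. g (\<zeta> * z) \<partial>lborel) = (\<integral>\<^sup>+z. g (S1 (S2 (S1 z))) \<partial>lborel)" by simp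
    also have "\<dots> = (\<integral>\<^sup>+z. g (S1 (S2 z)) \<partial>lborel)"
      using nn_integral_shear(1)[of "\<lambda>z. g (S1 (S2 z))" a] by (simp add: S1_def S2_def)
    also have "\<dots> = (\<integral>\<^sup>+z. g (S1 z) \<partial>lborel)"
      using nn_integral_shear(2)[of "\<lambda>z. g (S1 z)" s] by (simp add: S1_def S2_def)
    also have "\<dots> = (\<integral>\<^sup>+z. g z \<partial>lborel)"
      using nn_integral_shear(1)[of g a] by (simp add: S1_def)
    finally show ?thesis .
  qed
  show ?thesis
  proof (cases "Re \<zeta> = -1")
    case True
    then have "\<zeta> = -1" using \<zeta> by (auto simp: complex_eq_iff cmod_def)
    then have "(\<integral>\<^sup>+z. f (\<zeta> * z) \<partial>lborel) = (\<integral>\<^sup>+z. f (\<i> * (\<i> * z)) \<partial>lborel)"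
      by (simp flip: mult.assoc)
    also have "\<dots> = (\<integral>\<^sup>+z. f (\<i> * z) \<partial>lborel)"
      using main[of \<i> "\<lambda>z. f (\<i> * z)"] by simp
    finally show ?thesis using main[of \<i> f] by simp
  qed (use main \<zeta> in auto)
qed

lemma emeasure_cball_complex:
  "0 \<le> r \<Longrightarrow> emeasure lborel (cball (c::complex) r) = ennreal (pi * r\<^sup>2)"
  using emeasure_cball[of r c] unit_ball_vol_even[of 1] by simp

lemma emeasure_ball_complex:
  "0 \<le> r \<Longrightarrow> emeasure lborel (ball (c::complex) r) = ennreal (pi * r\<^sup>2)"
  using emeasure_ball[of r c] unit_ball_vol_even[of 1] by simp

text \<open>The area pi * x^2 of a disc has derivative 2 * pi * x, so both measures agree on
  half-lines, which form an intersection-stable generator.\<close>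

lemma distr_norm_complex:
  "distr lborel borel (norm :: complex \<Rightarrow> real)
   = density lborel (\<lambda>r. ennreal (2 * pi * r) * indicator {0..} r)" (is "?L = ?R")
proof (rule measure_eqI_generator_eq[where E = "range atMost" and \<Omega> = UNIV and A = "\<lambda>n. {..real n}"])
  show "Int_stable (range atMost :: real set set)"
  proof (rule Int_stableI)
    fix a b :: "real set" assume "a \<in> range atMost" "b \<in> range atMost"
    then obtain x y where "a = {..x}" "b = {..y}" by auto
    then have "a \<inter> b = {..min x y}" by auto
    then show "a \<inter> b \<in> range atMost" by blast
  qed
  have L: "emeasure ?L {..x} = (if x < 0 then 0 else ennreal (pi * x\<^sup>2))" for x
  proof -
    have "norm -` {..x} \<inter> space lborel = cball (0::complex) x" by auto
    then show ?thesis by (simp add: emeasure_distr emeasure_cball_complex)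
  qed
  have R: "emeasure ?R {..x} = (if x < 0 then 0 else ennreal (pi * x\<^sup>2))" for x
  proof (cases "x < 0")
    case True
    then have "emeasure ?R {..x} = (\<integral>\<^sup>+r. 0 \<partial>(lborel::real measure))"
      by (subst emeasure_density, simp_all del: nn_integral_const nn_integral_0_iff_AE add: mult.assoc)
        (intro nn_integral_cong, auto simp: indicator_def)
    then show ?thesis using True by simp
  next
    case False
    then have "emeasure ?R {..x} = (\<integral>\<^sup>+r. ennreal (2 * pi * r) * indicator {0..x} r \<partial>lborel)"
      by (subst emeasure_density) (auto intro!: nn_integral_cong simp: indicator_def)
    also have "\<dots> = ennreal (pi * x\<^sup>2 - pi * 0\<^sup>2)"
      by (rule nn_integral_FTC_Icc) (use False in \<open>auto intro!: derivative_eq_intros\<close>)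
    finally show ?thesis using False by simp
  qed
  show "\<And>X. X \<in> range atMost \<Longrightarrow> emeasure ?L X = emeasure ?R X" using L R by auto
  show "sets ?L = sigma_sets UNIV (range atMost)" "sets ?R = sigma_sets UNIV (range atMost)"
    by (simp_all add: borel_eq_atMost)
  show "(\<Union>i. {..real i}) = UNIV" using real_arch_simple by auto
  show "\<And>i. emeasure ?L {..real i} \<noteq> \<infinity>" using L by auto
qed auto

lemma nn_integral_radial:
  assumes [measurable]: "f \<in> borel_measurable (borel :: real measure)"
  shows "(\<integral>\<^sup>+z. f (norm (z::complex)) \<partial>lborel) = (\<integral>\<^sup>+r. ennreal (2 * pi * r) * indicator {0..} r * f r \<partial>lborel)"
proof -
  have "(\<integral>\<^sup>+z. f (norm (z::complex)) \<partial>lborel) = (\<integral>\<^sup>+r. f r \<partial>distr lborel borel (norm :: complex \<Rightarrow> real))"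
    by (simp add: nn_integral_distr)
  then show ?thesis by (simp add: distr_norm_complex nn_integral_density)
qed

text \<open>Under an area integral this removes the case of equal moduli, which the circle mean
  formula for \<open>ln (norm (\<zeta> * w - b))\<close> excludes.\<close>

lemma AE_norm_neq: "AE z in lborel. norm (z - c) \<noteq> (r::real)" for c :: complex
proof -
  have "negligible (sphere c r)" by (rule negligible_sphere)
  then have "sphere c r \<in> null_sets lborel"
    by (simp add: null_sets_completion_iff negligible_iff_null_sets)
  then have "AE z in lborel. z \<notin> sphere c r" by (rule AE_not_in)
  then show ?thesis by eventually_elim (auto simp: dist_norm norm_minus_commute)
qed

subsection \<open>Circle means\<close>

text \<open>The uniform distribution on the unit circle, kept as a Borel measure on the whole plane
  so that it combines with \<open>lborel\<close> in products; that it lives on the circle is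
  recorded almost everywhere in \<open>AE_circ\<close>.\<close>

definition circ :: "complex measure" where
  "circ = distr (restrict_space lborel {0..1}) borel (\<lambda>t. cis (2 * pi * t))"

lemma cis_borel [measurable]: "cis \<in> borel_measurable borel"
  by (intro borel_measurable_continuous_onI continuous_intros)

lemma measurable_cis01 [measurable]:
  "(\<lambda>t. cis (2 * pi * t)) \<in> borel_measurable (restrict_space lborel {0..1})"
  by (intro measurable_restrict_space1) measurable

lemma sets_circ [measurable_cong, simp]: "sets circ = sets borel"
  and space_circ [simp]: "space circ = UNIV"
  by (auto simp: circ_def)

lemma prob_space_circ: "prob_space circ"
proof -
  have "prob_space (restrict_space lborel {0..1::real})"
    by standard (simp add: emeasure_restrict_space)
  then show ?thesis unfolding circ_def
    by (rule prob_space.prob_space_distr[OF _ measurable_cis01])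
qed

interpretation circ: prob_space circ by (rule prob_space_circ)

lemma AE_circ: "AE \<zeta> in circ. norm \<zeta> = 1"
  unfolding circ_def by (subst AE_distr_iff) (auto intro: measurable_cis01)

text \<open>Cauchy's integral formula at the centre. The Borel function \<open>f\<close> is kept
  apart from \<open>h\<close> because \<open>h\<close> is controlled only on a ball and may fail to
  be measurable on the plane.\<close>

lemma circ_mean_holomorphic:
  assumes h: "h holomorphic_on ball 0 R" and R: "1 < R"
    and f [measurable]: "f \<in> borel_measurable borel" and fh: "\<And>z. norm z \<le> 1 \<Longrightarrow> f z = Re (h z)"
  shows "integrable circ f" "(\<integral>\<zeta>. f \<zeta> \<partial>circ) = Re (h 0)"
proof -
  have sub: "cball 0 1 \<subseteq> ball (0::complex) R" using R by auto
  have hc: "continuous_on (cball 0 1) h"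
    using h sub holomorphic_on_imp_continuous_on continuous_on_subset by blast
  have "((\<lambda>u. h u / (u - 0)) has_contour_integral (2 * of_real pi * \<i> * h 0)) (circlepath 0 1)"
    by (rule Cauchy_integral_circlepath[OF hc]) (use R in \<open>auto intro!: holomorphic_on_subset[OF h]\<close>)
  then have 0: "((\<lambda>t. h (circlepath 0 1 t) / (circlepath 0 1 t - 0) * vector_derivative (circlepath 0 1) (at t within {0..1}))
     has_integral (2 * of_real pi * \<i> * h 0)) {0..1}"
    unfolding has_contour_integral_def .
  have 1: "((\<lambda>t. h (cis (2*pi*t)) * (2 * of_real pi * \<i>)) has_integral (2 * of_real pi * \<i> * h 0)) {0..1}"
  proof (rule has_integral_eq[OF _ 0])
    fix t :: real assume t: "t \<in> {0..1}"
    have "vector_derivative (circlepath 0 1) (at t within {0..1}) = 2 * pi * \<i> * exp(2 * of_real pi * \<i> * t)"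
      using t by (subst vector_derivative_circlepath01) auto
    moreover have "circlepath 0 1 t = cis (2 * pi * t)"
      unfolding circlepath cis_conv_exp by (simp add: mult_ac)
    moreover have "exp(2 * of_real pi * \<i> * t) = cis (2*pi*t)"
      unfolding cis_conv_exp by (simp add: mult_ac)
    ultimately show "h (circlepath 0 1 t) / (circlepath 0 1 t - 0) * vector_derivative (circlepath 0 1) (at t within {0..1})
      = h (cis (2*pi*t)) * (2 * of_real pi * \<i>)"
      by simp
  qed
  have "((\<lambda>t. h (cis (2*pi*t)) * (2 * of_real pi * \<i>) / (2 * of_real pi * \<i>)) has_integral (2 * of_real pi * \<i> * h 0 / (2 * of_real pi * \<i>))) {0..1}"
    using has_integral_divide[OF 1] by blast
  then have "((\<lambda>t. h (cis (2*pi*t))) has_integral h 0) {0..1}" by simp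
  then have 2: "((\<lambda>t. Re (h (cis (2*pi*t)))) has_integral Re (h 0)) {0..1}"
    by (rule has_integral_Re)
  have c: "continuous_on {0..1} (\<lambda>t::real. Re (h (cis (2*pi*t))))"
    by (intro continuous_intros continuous_on_compose2[OF hc]) auto
  have 3: "integral\<^sup>L (restrict_space lborel {0..1}) (\<lambda>t. Re (h (cis (2*pi*t)))) = Re (h 0)"
  proof -
    have si: "set_integrable lborel {0..1} (\<lambda>t. Re (h (cis (2*pi*t))))"
      by (rule borel_integrable_atLeastAtMost'[OF c])
    have "integral\<^sup>L (restrict_space lborel {0..1}) (\<lambda>t. Re (h (cis (2*pi*t)))) = (LINT t:{0..1}|lborel. Re (h (cis (2*pi*t))))"
      by (simp add: integral_restrict_space set_lebesgue_integral_def)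
    also have "\<dots> = integral {0..1} (\<lambda>t. Re (h (cis (2*pi*t))))"
      by (rule set_borel_integral_eq_integral(2)[OF si])
    finally show ?thesis using 2 by (simp add: integral_unique)
  qed
  have "(\<integral>\<zeta>. f \<zeta> \<partial>circ) = (\<integral>t. f (cis (2*pi*t)) \<partial>restrict_space lborel {0..1})"
    unfolding circ_def by (rule integral_distr) measurable
  also have "\<dots> = (\<integral>t. Re (h (cis (2*pi*t))) \<partial>restrict_space lborel {0..1})"
    by (simp add: fh)
  finally show "(\<integral>\<zeta>. f \<zeta> \<partial>circ) = Re (h 0)" using 3 by simp
  have "compact (h ` cball 0 1)"
    using hc by (intro compact_continuous_image) auto
  then obtain B where B: "\<And>\<zeta>. norm \<zeta> \<le> 1 \<Longrightarrow> norm (h \<zeta>) \<le> B"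
    by (force dest!: compact_imp_bounded simp: bounded_iff)
  have "AE \<zeta> in circ. norm (f \<zeta>) \<le> B"
    using AE_circ
  proof eventually_elim
    case (elim \<zeta>)
    then show ?case using B[of \<zeta>] abs_Re_le_cmod[of "h \<zeta>"] fh[of \<zeta>] by simp
  qed
  then show "integrable circ f"
    by (intro circ.integrable_const_bound[where B = B]) auto
qed

text \<open>A zero-free function on a ball has a holomorphic logarithm \<open>L\<close>, and
  \<open>ln (norm (g z)) = Re (L z)\<close> has the mean value property.\<close>

lemma circ_mean_ln_norm:
  assumes g: "g holomorphic_on ball c R" "\<And>z. z \<in> ball c R \<Longrightarrow> g z \<noteq> 0"
    and m [measurable]: "g \<in> borel_measurable borel" and w: "norm w < R"
  shows "integrable circ (\<lambda>\<zeta>. ln (norm (g (c + \<zeta> * w))))"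
    and "(\<integral>\<zeta>. ln (norm (g (c + \<zeta> * w))) \<partial>circ) = ln (norm (g c))"
proof -
  have R0: "0 < R" using w norm_ge_zero[of w] by linarith
  obtain L where L: "L holomorphic_on ball c R" "\<And>z. z \<in> ball c R \<Longrightarrow> exp (L z) = g z"
    using holomorphic_logarithm_exists[OF convex_ball open_ball g(1) g(2), of c] R0 by (metis centre_in_ball)
  have lnL: "ln (norm (g z)) = Re (L z)" if "z \<in> ball c R" for z
    using L(2)[OF that] by (metis ln_exp norm_exp_eq_Re)
  \<comment> \<open>After rescaling the circle to radius 1, Cauchy's formula needs holomorphy on a
    ball of some radius larger than 1.\<close>
  obtain S where S: "1 < S" "S * norm w < R"
  proof (cases "w = 0")
    case True
    then show ?thesis using that[of 2] R0 by simp
  next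
    case False
    then have "1 < R / norm w" using w by (simp add: field_simps)
    then obtain S where "1 < S" "S < R / norm w" using dense by blast
    then show ?thesis using that False by (simp add: field_simps)
  qed
  have in_ball: "c + z * w \<in> ball c R" if "norm z < S" for z
  proof -
    have "norm z * norm w \<le> S * norm w" using that by (intro mult_right_mono) auto
    then show ?thesis using S(2) by (simp add: dist_norm norm_mult)
  qed
  have hol: "(\<lambda>z. L (c + z * w)) holomorphic_on ball 0 S"
    by (rule holomorphic_on_compose_gen[OF _ L(1), unfolded o_def])
       (use in_ball in \<open>auto intro!: holomorphic_intros\<close>)
  have meas: "(\<lambda>\<zeta>. ln (norm (g (c + \<zeta> * w)))) \<in> borel_measurable borel" by measurable
  have eq: "ln (norm (g (c + z * w))) = Re (L (c + z * w))" if "norm z \<le> 1" for z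
    using that S(1) by (intro lnL in_ball) auto
  from circ_mean_holomorphic[OF hol S(1) meas eq]
  show "integrable circ (\<lambda>\<zeta>. ln (norm (g (c + \<zeta> * w))))"
    and "(\<integral>\<zeta>. ln (norm (g (c + \<zeta> * w))) \<partial>circ) = ln (norm (g c))"
    using lnL[of c] R0 by auto
qed

text \<open>Jensen's formula for a single zero. If the zero lies outside the circle, the function is
  zero-free inside and the mean is its central value; the other case is reduced to this one by
  reflection in the circle.\<close>

lemma circ_mean_ln_norm_diff:
  assumes "norm w \<noteq> norm b"
  shows "integrable circ (\<lambda>\<zeta>. ln (norm (\<zeta> * w - b)))"
    and "(\<integral>\<zeta>. ln (norm (\<zeta> * w - b)) \<partial>circ) = ln (max (norm w) (norm b))"
proof -
  have main: "integrable circ (\<lambda>\<zeta>. ln (norm (\<zeta> * w - b))) \<and>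
    (\<integral>\<zeta>. ln (norm (\<zeta> * w - b)) \<partial>circ) = ln (norm b)" if "norm w < norm b" for w b :: complex
  proof -
    have "(\<lambda>z. z - b) holomorphic_on ball 0 (norm b)" by (intro holomorphic_intros)
    from circ_mean_ln_norm[OF this, of w] that show ?thesis by (auto simp: norm_minus_commute)
  qed
  have "integrable circ (\<lambda>\<zeta>. ln (norm (\<zeta> * w - b))) \<and>
    (\<integral>\<zeta>. ln (norm (\<zeta> * w - b)) \<partial>circ) = ln (max (norm w) (norm b))"
  proof (cases "norm w < norm b")
    case True
    then show ?thesis using main[of w b] by simp
  next
    case False
    \<comment> \<open>On the unit circle \<open>cnj \<zeta>\<close> is the inverse of
      \<open>\<zeta>\<close>, so the modulus is unchanged when \<open>w\<close> becomes
      \<open>cnj b\<close> and \<open>b\<close> becomes \<open>cnj w\<close>. This exchanges the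
      inside and the outside.\<close>
    have *: "norm (\<zeta> * cnj b - cnj w) = norm (\<zeta> * w - b)" if "norm \<zeta> = 1" for \<zeta>
    proof -
      have "\<zeta> * cnj \<zeta> = 1" using that by (simp add: complex_norm_square[symmetric])
      then have "\<zeta> * cnj (\<zeta> * w - b) = - (\<zeta> * cnj b - cnj w)"
        by (simp add: algebra_simps)
      then have "norm (\<zeta> * cnj b - cnj w) = norm (\<zeta> * cnj (\<zeta> * w - b))" by (metis norm_minus_cancel)
      also have "\<dots> = norm (\<zeta> * w - b)" using that by (simp add: norm_mult del: complex_cnj_diff complex_cnj_mult)
      finally show ?thesis .
    qed
    have ae: "AE \<zeta> in circ. ln (norm (\<zeta> * cnj b - cnj w)) = ln (norm (\<zeta> * w - b))"
      using AE_circ by eventually_elim (simp add: *)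
    have "norm (cnj b) < norm (cnj w)" using False assms by simp
    from main[OF this] show ?thesis
      using False integrable_cong_AE[OF _ _ ae] integral_cong_AE[OF _ _ ae] by simp
  qed
  then show "integrable circ (\<lambda>\<zeta>. ln (norm (\<zeta> * w - b)))"
    and "(\<integral>\<zeta>. ln (norm (\<zeta> * w - b)) \<partial>circ) = ln (max (norm w) (norm b))" by auto
qed

subsection \<open>Local integrability and disc averages\<close>

text \<open>In polar coordinates about \<open>a\<close> the factor r tames the logarithm: r * |ln r|
  is at most 1 for r \<le> 1 and at most S^2 for 1 < r \<le> S.\<close>

lemma nn_integral_abs_ln_norm_le:
  fixes a :: complex
  assumes S: "0 \<le> S"
  shows "(\<integral>\<^sup>+z. ennreal (\<bar>ln (norm (z - a))\<bar> * indicator (cball a S) z) \<partial>lborel) \<le> ennreal (2 * pi * (1 + S\<^sup>2) * S)"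
proof -
  have "(\<integral>\<^sup>+z. ennreal (\<bar>ln (norm (z - a))\<bar> * indicator (cball a S) z) \<partial>lborel)
      = (\<integral>\<^sup>+z. ennreal (\<bar>ln (norm z)\<bar> * indicator {..S} (norm z)) \<partial>distr lborel borel (\<lambda>z. -a + z))"
    by (subst nn_integral_distr)
       (auto intro!: nn_integral_cong simp: indicator_def dist_norm norm_minus_commute)
  also have "\<dots> = (\<integral>\<^sup>+z. ennreal (\<bar>ln (norm (z::complex))\<bar> * indicator {..S} (norm z)) \<partial>lborel)"
    by (simp only: lborel_distr_plus)
  also have "\<dots> = (\<integral>\<^sup>+r. ennreal (2 * pi * r) * indicator {0..} r * ennreal (\<bar>ln r\<bar> * indicator {..S} r) \<partial>lborel)"
    by (rule nn_integral_radial) measurable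
  also have "\<dots> \<le> (\<integral>\<^sup>+r. ennreal (2 * pi * (1 + S\<^sup>2)) * indicator {0..S} r \<partial>lborel)"
  proof (rule nn_integral_mono)
    fix r :: real
    show "ennreal (2 * pi * r) * indicator {0..} r * ennreal (\<bar>ln r\<bar> * indicator {..S} r)
       \<le> ennreal (2 * pi * (1 + S\<^sup>2)) * indicator {0..S} r"
    proof (cases "0 < r \<and> r \<le> S")
      case True
      have "r * \<bar>ln r\<bar> \<le> 1 + S\<^sup>2"
      proof (cases "r \<le> 1")
        case True
        have "ln (1/r) \<le> 1/r - 1" using \<open>0 < r \<and> r \<le> S\<close> by (intro ln_le_minus_one) auto
        then have "- ln r \<le> 1/r" using \<open>0 < r \<and> r \<le> S\<close> by (simp add: ln_div)
        then have "r * (- ln r) \<le> r * (1/r)" using \<open>0 < r \<and> r \<le> S\<close> by (intro mult_left_mono) auto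
        moreover have "\<bar>ln r\<bar> = - ln r" using True \<open>0 < r \<and> r \<le> S\<close> by (simp add: ln_le_zero_iff)
        ultimately show ?thesis using \<open>0 < r \<and> r \<le> S\<close> by (simp add: add_increasing2)
      next
        case False
        have "ln r \<le> S" using \<open>0 < r \<and> r \<le> S\<close> ln_le_minus_one[of r] by linarith
        then have "r * ln r \<le> S * S" using False \<open>0 < r \<and> r \<le> S\<close> by (intro mult_mono) auto
        then show ?thesis using False by (simp add: power2_eq_square)
      qed
      then have "ennreal (2 * pi * (r * \<bar>ln r\<bar>)) \<le> ennreal (2 * pi * (1 + S\<^sup>2))"
        by (intro ennreal_leI mult_left_mono) auto
      then show ?thesis using True by (simp add: ennreal_mult' [symmetric] mult_ac)
    qed (auto simp: indicator_def)
  qed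
  also have "\<dots> = ennreal (2 * pi * (1 + S\<^sup>2) * S)"
    using S by (simp add: nn_integral_cmult ennreal_mult'')
  finally show ?thesis .
qed

lemma set_integrable_ln_norm:
  fixes a :: complex
  assumes "bounded K" "K \<in> sets borel"
  shows "set_integrable lborel K (\<lambda>z. ln (norm (z - a)))"
proof -
  obtain S where S: "K \<subseteq> cball a S" "0 \<le> S"
  proof -
    obtain S where "\<forall>x\<in>K. dist a x \<le> S" using assms(1) bounded_any_center[of K a] by auto
    then show ?thesis using that[of "max 0 S"] by (auto simp: subset_iff le_max_iff_disj)
  qed
  have [measurable]: "cball a S \<in> sets borel" by simp
  have "set_integrable lborel (cball a S) (\<lambda>z. ln (norm (z - a)))"
    unfolding set_integrable_def
  proof (rule integrableI_bounded)
    have "(\<integral>\<^sup>+ z. ennreal (norm (indicator (cball a S) z *\<^sub>R ln (norm (z - a)))) \<partial>lborel)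
      = (\<integral>\<^sup>+z. ennreal (\<bar>ln (norm (z - a))\<bar> * indicator (cball a S) z) \<partial>lborel)"
      by (intro nn_integral_cong) (simp add: abs_mult mult.commute)
    also have "\<dots> < \<infinity>"
      using nn_integral_abs_ln_norm_le[OF S(2), of a] by (auto simp: le_less_trans ennreal_less_top)
    finally show "(\<integral>\<^sup>+ z. ennreal (norm (indicator (cball a S) z *\<^sub>R ln (norm (z - a)))) \<partial>lborel) < \<infinity>" .
    show "(\<lambda>z. indicator (cball a S) z *\<^sub>R ln (norm (z - a))) \<in> borel_measurable lborel"
      unfolding measurable_lborel1 by measurable
  qed
  then show ?thesis
    by (rule set_integrable_subset) (use assms S in auto)
qed

lemma distr_rotate:
  "norm \<zeta> = 1 \<Longrightarrow> distr lborel borel (\<lambda>z. \<zeta> * z) = (lborel :: complex measure)"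
proof (rule measure_eqI)
  fix A assume \<zeta>: "norm \<zeta> = 1" and "A \<in> sets (distr lborel borel (\<lambda>z. \<zeta> * z))"
  then have [measurable]: "A \<in> sets borel" by simp
  have "emeasure (distr lborel borel (\<lambda>z. \<zeta> * z)) A = (\<integral>\<^sup>+z. indicator A z \<partial>distr lborel borel (\<lambda>z. \<zeta> * z))"
    by simp
  also have "\<dots> = (\<integral>\<^sup>+z. indicator A (\<zeta> * z) \<partial>lborel)"
    by (rule nn_integral_distr) auto
  also have "\<dots> = (\<integral>\<^sup>+z. indicator A z \<partial>lborel)"
    by (rule nn_integral_rotate) (use \<zeta> in auto)
  also have "\<dots> = emeasure lborel A" by simp
  finally show "emeasure (distr lborel borel (\<lambda>z. \<zeta> * z)) A = emeasure lborel A" .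
qed simp

interpretation lborel_circ: pair_sigma_finite "lborel :: complex measure" circ
  by (intro pair_sigma_finite.intro lborel.sigma_finite_measure_axioms circ.sigma_finite_measure_axioms)

text \<open>Fubini puts the area integral inside, where rotation invariance removes
  \<open>\<zeta>\<close>. This replaces polar coordinates below: angular dependence is averaged out
  while the integral stays over the plane.\<close>

lemma integral_rotation_average:
  fixes f :: "complex \<Rightarrow> real"
  assumes f: "integrable lborel f"
  shows "integrable lborel (\<lambda>z. \<integral>\<zeta>. f (\<zeta> * z) \<partial>circ)"
    and "(\<integral>z. (\<integral>\<zeta>. f (\<zeta> * z) \<partial>circ) \<partial>lborel) = (\<integral>z. f z \<partial>lborel)"
proof -
  have [measurable]: "f \<in> borel_measurable borel" using f by auto
  have int: "integrable (lborel \<Otimes>\<^sub>M circ) (\<lambda>(z, \<zeta>). f (\<zeta> * z))"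
  proof (rule integrableI_bounded)
    have "(\<integral>\<^sup>+p. ennreal (norm (case p of (z, \<zeta>) \<Rightarrow> f (\<zeta> * z))) \<partial>(lborel \<Otimes>\<^sub>M circ))
      = (\<integral>\<^sup>+\<zeta>. \<integral>\<^sup>+z. ennreal (norm (f (\<zeta> * z))) \<partial>lborel \<partial>circ)"
      by (subst lborel_circ.nn_integral_snd[symmetric]) (auto simp: case_prod_beta)
    also have "\<dots> = (\<integral>\<^sup>+\<zeta>. \<integral>\<^sup>+z. ennreal (norm (f z)) \<partial>lborel \<partial>circ)"
      using AE_circ
      by (intro nn_integral_cong_AE) (auto elim!: eventually_mono intro!: nn_integral_rotate[where f = "\<lambda>z. ennreal \<bar>f z\<bar>"])
    also have "\<dots> < \<infinity>" using f by (simp add: integrable_iff_bounded circ.emeasure_space_1[simplified])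
    finally show "(\<integral>\<^sup>+p. ennreal (norm (case p of (z, \<zeta>) \<Rightarrow> f (\<zeta> * z))) \<partial>(lborel \<Otimes>\<^sub>M circ)) < \<infinity>" .
  qed measurable
  then show "integrable lborel (\<lambda>z. \<integral>\<zeta>. f (\<zeta> * z) \<partial>circ)"
    using lborel_circ.integrable_fst'[OF int] by simp
  have "(\<integral>z. (\<integral>\<zeta>. f (\<zeta> * z) \<partial>circ) \<partial>lborel) = (\<integral>\<zeta>. (\<integral>z. f (\<zeta> * z) \<partial>lborel) \<partial>circ)"
    using lborel_circ.Fubini_integral[OF int] by simp
  also have "\<dots> = (\<integral>\<zeta>. (\<integral>z. f z \<partial>lborel) \<partial>circ)"
  proof (rule integral_cong_AE)
    show "AE \<zeta> in circ. (\<integral>z. f (\<zeta> * z) \<partial>lborel) = (\<integral>z. f z \<partial>lborel)"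
      using AE_circ
    proof eventually_elim
      case (elim \<zeta>)
      have "(\<integral>z. f z \<partial>distr lborel borel (\<lambda>z. \<zeta> * z)) = (\<integral>z. f (\<zeta> * z) \<partial>lborel)"
        by (rule integral_distr) auto
      then show ?case by (simp add: distr_rotate elim)
    qed
  qed measurable
  finally show "(\<integral>z. (\<integral>\<zeta>. f (\<zeta> * z) \<partial>circ) \<partial>lborel) = (\<integral>z. f z \<partial>lborel)"
    by (simp add: circ.prob_space[simplified])
qed

text \<open>The version for nonnegative functions serves the potential of the limit density, whose
  finiteness is an outcome of the computation.\<close>

lemma nn_integral_rotation_average:
  assumes [measurable]: "f \<in> borel_measurable (borel :: complex measure)"
  shows "(\<integral>\<^sup>+z. f z \<partial>lborel) = (\<integral>\<^sup>+z. (\<integral>\<^sup>+\<zeta>. f (\<zeta> * z) \<partial>circ) \<partial>lborel)"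
proof -
  have "(\<integral>\<^sup>+z. (\<integral>\<^sup>+\<zeta>. f (\<zeta> * z) \<partial>circ) \<partial>lborel) = (\<integral>\<^sup>+\<zeta>. (\<integral>\<^sup>+z. f (\<zeta> * z) \<partial>lborel) \<partial>circ)"
    by (rule lborel_circ.Fubini'[symmetric]) measurable
  also have "\<dots> = (\<integral>\<^sup>+\<zeta>. (\<integral>\<^sup>+z. f z \<partial>lborel) \<partial>circ)"
  proof (rule nn_integral_cong_AE)
    show "AE \<zeta> in circ. (\<integral>\<^sup>+z. f (\<zeta> * z) \<partial>lborel) = (\<integral>\<^sup>+z. f z \<partial>lborel)"
      using AE_circ by eventually_elim (rule nn_integral_rotate, auto)
  qed
  also have "\<dots> = (\<integral>\<^sup>+z. f z \<partial>lborel)" using circ.emeasure_space_1 by simp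
  finally show ?thesis by simp
qed

lemma set_integral_translate:
  fixes f :: "complex \<Rightarrow> real"
  assumes [measurable]: "f \<in> borel_measurable borel"
  shows "(LINT z:ball c \<delta>|lborel. f z) = (LINT z:ball 0 \<delta>|lborel. f (c + z))"
proof -
  have [measurable]: "ball c \<delta> \<in> sets borel" by simp
  have "(LINT z:ball c \<delta>|lborel. f z) = (\<integral>z. indicator (ball c \<delta>) z * f z \<partial>distr lborel borel (\<lambda>z. c + z))"
    by (simp only: set_lebesgue_integral_def lborel_distr_plus real_scaleR_def)
  also have "\<dots> = (\<integral>z. indicator (ball c \<delta>) (c + z) * f (c + z) \<partial>lborel)"
    by (rule integral_distr) measurable
  also have "\<dots> = (LINT z:ball 0 \<delta>|lborel. f (c + z))"
    by (auto simp: set_lebesgue_integral_def dist_norm indicator_def intro!: Bochner_Integration.integral_cong)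
  finally show ?thesis .
qed

text \<open>Each circle mean is \<open>ln (max (norm z) (norm b))\<close>, which is at least
  \<open>ln (norm b)\<close>. The point 0 has to be excluded for \<open>b\<close>: by the convention
  ln 0 = 0 the left side would be 0, while the right side is negative for small
  \<open>\<delta>\<close>.\<close>

lemma disc_average_ln_norm_diff:
  fixes b :: complex
  assumes \<delta>: "0 < \<delta>" and b: "b \<noteq> 0"
  shows "pi * \<delta>\<^sup>2 * ln (norm b) \<le> (LINT z:ball 0 \<delta>|lborel. ln (norm (z - b)))"
proof -
  let ?f = "\<lambda>z. indicator (ball 0 \<delta>) z * ln (norm (z - b))"
  have int: "integrable lborel ?f"
    using set_integrable_ln_norm[of "ball 0 \<delta>" b] by (simp add: set_integrable_def)
  have "pi * \<delta>\<^sup>2 * ln (norm b) = (\<integral>z. indicator (ball (0::complex) \<delta>) z * ln (norm b) \<partial>lborel)"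
    using \<delta> by (simp add: measure_def emeasure_ball_complex)
  also have "\<dots> \<le> (\<integral>z. (\<integral>\<zeta>. ?f (\<zeta> * z) \<partial>circ) \<partial>lborel)"
  proof (rule integral_mono_AE)
    show "integrable lborel (\<lambda>z. \<integral>\<zeta>. ?f (\<zeta> * z) \<partial>circ)"
      by (rule integral_rotation_average[OF int])
    show "integrable lborel (\<lambda>z. indicator (ball (0::complex) \<delta>) z * ln (norm b))"
      using \<delta> by (intro integrable_mult_left) (auto simp: emeasure_ball_complex)
    show "AE z in lborel. indicator (ball 0 \<delta>) z * ln (norm b) \<le> (\<integral>\<zeta>. ?f (\<zeta> * z) \<partial>circ)"
      using AE_norm_neq[of 0 "norm b"]
    proof eventually_elim
      case (elim z)
      have "(\<integral>\<zeta>. ?f (\<zeta> * z) \<partial>circ) = (\<integral>\<zeta>. indicator (ball 0 \<delta>) z * ln (norm (\<zeta> * z - b)) \<partial>circ)"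
        using AE_circ by (intro integral_cong_AE) (auto elim!: eventually_mono simp: indicator_def norm_mult)
      also have "\<dots> = indicator (ball 0 \<delta>) z * ln (max (norm z) (norm b))"
        using elim by (simp add: circ_mean_ln_norm_diff)
      also have "\<dots> \<ge> indicator (ball 0 \<delta>) z * ln (norm b)"
        using b by (intro mult_left_mono ln_mono) (auto simp: indicator_def)
      finally show ?case .
    qed
  qed
  also have "\<dots> = (LINT z:ball 0 \<delta>|lborel. ln (norm (z - b)))"
    by (simp add: integral_rotation_average(2)[OF int] set_lebesgue_integral_def)
  finally show ?thesis .
qed

lemma set_integrable_ln_norm_nonvanishing:
  assumes "continuous_on K g" "compact K" "\<And>z. z \<in> K \<Longrightarrow> g z \<noteq> (0::complex)"
  shows "set_integrable lborel K (\<lambda>z::complex. ln (norm (g z)))"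
  unfolding set_integrable_def using assms
  by (intro borel_integrable_compact continuous_intros) auto

text \<open>The circle means about \<open>c\<close> do not depend on the radius, so rotation
  averaging turns the integrand into a constant on the disc.\<close>

lemma disc_average_ln_norm_nonvanishing:
  assumes g: "g holomorphic_on ball c R" "\<And>z. z \<in> ball c R \<Longrightarrow> g z \<noteq> 0"
    and m [measurable]: "g \<in> borel_measurable borel" and \<delta>: "0 < \<delta>" "\<delta> < R"
  shows "(LINT z:ball c \<delta>|lborel. ln (norm (g z))) = pi * \<delta>\<^sup>2 * ln (norm (g c))"
proof -
  let ?f = "\<lambda>z. indicator (ball 0 \<delta>) z * ln (norm (g (c + z)))"
  have "set_integrable lborel (cball 0 \<delta>) (\<lambda>z. ln (norm (g (c + z))))"
  proof (rule set_integrable_ln_norm_nonvanishing)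
    show "continuous_on (cball 0 \<delta>) (\<lambda>z. g (c + z))"
      by (rule continuous_on_compose2[OF holomorphic_on_imp_continuous_on[OF g(1)]])
         (use \<delta> in \<open>auto intro!: continuous_intros simp: dist_norm\<close>)
  qed (use g(2) \<delta> in \<open>auto simp: dist_norm\<close>)
  then have "set_integrable lborel (ball 0 \<delta>) (\<lambda>z. ln (norm (g (c + z))))"
    by (rule set_integrable_subset) auto
  then have int: "integrable lborel ?f" by (simp add: set_integrable_def)
  have "(\<integral>\<zeta>. ?f (\<zeta> * z) \<partial>circ) = indicator (ball 0 \<delta>) z * ln (norm (g c))" for z
  proof -
    have "(\<integral>\<zeta>. ?f (\<zeta> * z) \<partial>circ) = (\<integral>\<zeta>. indicator (ball 0 \<delta>) z * ln (norm (g (c + \<zeta> * z))) \<partial>circ)"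
      using AE_circ by (intro integral_cong_AE) (auto elim!: eventually_mono simp: indicator_def norm_mult)
    also have "\<dots> = indicator (ball 0 \<delta>) z * ln (norm (g c))"
      using circ_mean_ln_norm(2)[OF g m, of z] \<delta> by (auto simp: indicator_def)
    finally show ?thesis .
  qed
  with integral_rotation_average(2)[OF int]
  have "(\<integral>z. ?f z \<partial>lborel) = (\<integral>z. indicator (ball (0::complex) \<delta>) z * ln (norm (g c)) \<partial>lborel)" by simp
  also have "\<dots> = pi * \<delta>\<^sup>2 * ln (norm (g c))"
    using \<delta> by (simp add: measure_def emeasure_ball_complex)
  finally show ?thesis by (subst set_integral_translate) (auto simp: set_lebesgue_integral_def)
qed

subsection \<open>Factoring out the zeros in a compact set\<close>

text \<open>Setting the cofactor to zero outside the domain makes it Borel measurable.\<close>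

lemma holomorphic_factorization:
  assumes G: "G holomorphic_on D" and D: "open D" "connected D" and nz: "\<exists>z\<in>D. G z \<noteq> 0"
    and K: "compact K" "K \<subseteq> D"
  obtains g where "finite {z\<in>K. G z = 0}" "g holomorphic_on D" "g \<in> borel_measurable borel"
    "\<And>z. z \<in> K \<Longrightarrow> g z \<noteq> 0"
    "\<And>z. z \<in> D \<Longrightarrow> G z = (\<Prod>a\<in>{z\<in>K. G z = 0}. (z - a) ^ nat (zorder G a)) * g z"
proof -
  have fin: "finite {z\<in>K. G z = 0}"
  proof (rule ccontr)
    assume inf: "infinite {z\<in>K. G z = 0}"
    then obtain x where x: "x \<in> K" "x islimpt {z\<in>K. G z = 0}"
      using K(1) by (metis (no_types, lifting) compact_eq_Bolzano_Weierstrass mem_Collect_eq subsetI)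
    have "G z = 0" if "z \<in> D" for z
      by (rule analytic_continuation[OF G D _ _ x(2)]) (use K x that in auto)
    then show False using nz by auto
  qed
  have main: "\<exists>g. g holomorphic_on D \<and> (\<forall>a\<in>Z. g a \<noteq> 0) \<and>
      (\<forall>z\<in>D. G z = (\<Prod>a\<in>Z. (z - a) ^ nat (zorder G a)) * g z)"
    if "finite Z" "Z \<subseteq> {z\<in>K. G z = 0}" for Z
    using that
  proof (induction Z rule: finite_induct)
    case empty
    then show ?case using G by auto
  next
    case (insert a Z)
    then obtain g where g: "g holomorphic_on D" "\<forall>a\<in>Z. g a \<noteq> 0"
      "\<forall>z\<in>D. G z = (\<Prod>a\<in>Z. (z - a) ^ nat (zorder G a)) * g z" by auto
    define P where "P z = (\<Prod>a\<in>Z. (z - a) ^ nat (zorder G a))" for z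
    have a: "a \<in> D" "G a = 0" using insert K by auto
    have Pa: "P a \<noteq> 0" using insert by (auto simp: P_def)
    have Phol: "P holomorphic_on UNIV" unfolding P_def by (intro holomorphic_intros)
    define n where "n = nat (zorder g a)"
    define h where "h = zor_poly g a"
    have "\<exists>w\<in>D. g w \<noteq> 0" using nz g(3) by fastforce
    from zorder_exist_zero[OF g(1) D a(1) this]
    obtain r where r: "r > 0" "cball a r \<subseteq> D" "h holomorphic_on cball a r"
      "\<And>w. w \<in> cball a r \<Longrightarrow> g w = h w * (w - a) ^ n \<and> h w \<noteq> 0"
      unfolding n_def h_def by metis
    \<comment> \<open>The factors split off so far do not vanish at \<open>a\<close>, so
      \<open>G\<close> and the current cofactor have the same order there.\<close>
    have "zorder G a = int n"
    proof (rule zorder_eqI)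
      show "(\<lambda>w. P w * h w) holomorphic_on ball a r"
        using Phol r(3) by (auto intro!: holomorphic_intros intro: holomorphic_on_subset)
      show "P a * h a \<noteq> 0" using Pa r(1) r(4)[of a] by auto
      show "G w = P w * h w * (w - a) powi int n" if "w \<in> ball a r" for w
      proof -
        have "w \<in> D" "w \<in> cball a r" using that r(2) by auto
        then show ?thesis using r(4)[of w] g(3) by (simp add: P_def)
      qed
    qed (use r in auto)
    then have n: "nat (zorder G a) = n" by simp
    \<comment> \<open>The quotient with its removable singularity filled in; holomorphy is glued
      from the punctured domain and a disc about \<open>a\<close>.\<close>
    define k where "k z = (if z = a then h a else g z / (z - a) ^ n)" for z
    have kh: "k z = h z" if "z \<in> cball a r" for z
      using r(4)[OF that] by (auto simp: k_def)
    have "k holomorphic_on (D - {a}) \<union> ball a r"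
    proof (rule holomorphic_on_Un)
      have "(\<lambda>z. g z / (z - a) ^ n) holomorphic_on D - {a}"
        using g(1) by (auto intro!: holomorphic_intros intro: holomorphic_on_subset)
      then show "k holomorphic_on D - {a}"
        by (rule holomorphic_transform) (auto simp: k_def)
      have "h holomorphic_on ball a r" using r(3) by (rule holomorphic_on_subset) auto
      then show "k holomorphic_on ball a r"
        by (rule holomorphic_transform) (use kh in auto)
    qed (use D in auto)
    then have "k holomorphic_on D"
      by (rule holomorphic_on_subset) (use r in auto)
    moreover have "k b \<noteq> 0" if "b \<in> insert a Z" for b
      using that g(2) r(1) r(4)[of a] by (auto simp: k_def)
    moreover have "g z = (z - a) ^ n * k z" if "z \<in> D" for z
    proof (cases "z = a")
      case True
      then show ?thesis using r(1) r(4)[of a] by (simp add: k_def)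
    qed (simp add: k_def)
    moreover have "G z = (\<Prod>a\<in>insert a Z. (z - a) ^ nat (zorder G a)) * k z"
      if "z \<in> D" "g z = (z - a) ^ n * k z" for z
    proof -
      have "G z = P z * ((z - a) ^ n * k z)" using g(3) that by (simp add: P_def)
      then show ?thesis unfolding prod.insert[OF insert.hyps(1,2)] n P_def[symmetric]
        by (simp only: mult_ac)
    qed
    ultimately show ?case by blast
  qed
  from main[OF fin] obtain g0 where g0: "g0 holomorphic_on D" "\<forall>a\<in>{z\<in>K. G z = 0}. g0 a \<noteq> 0"
      "\<forall>z\<in>D. G z = (\<Prod>a\<in>{z\<in>K. G z = 0}. (z - a) ^ nat (zorder G a)) * g0 z" by auto
  define g where "g z = (if z \<in> D then g0 z else 0)" for z
  show ?thesis
  proof (rule that[OF fin])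
    show "g holomorphic_on D" by (rule holomorphic_transform[OF g0(1)]) (auto simp: g_def)
    show "g \<in> borel_measurable borel" unfolding g_def
      by (rule borel_measurable_continuous_on_if[OF _ holomorphic_on_imp_continuous_on[OF g0(1)]]) (use D in auto)
    show "g z \<noteq> 0" if "z \<in> K" for z
    proof (cases "G z = 0")
      case False
      then show ?thesis using g0(3) that K by (auto simp: g_def)
    qed (use g0(2) that K in \<open>auto simp: g_def\<close>)
    show "G z = (\<Prod>a\<in>{z\<in>K. G z = 0}. (z - a) ^ nat (zorder G a)) * g z" if "z \<in> D" for z
      using g0(3) that by (simp add: g_def)
  qed
qed

lemma AE_not_in_finite: "finite A \<Longrightarrow> AE z in lborel. z \<notin> (A :: complex set)"
  by (intro AE_not_in countable_imp_null_set_lborel countable_finite)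

text \<open>The points of \<open>Z\<close> must be avoided because ln 0 = 0 stands where the
  logarithm is minus infinity. As \<open>Z\<close> is finite, the identity holds almost everywhere,
  which is what the integrals use.\<close>

lemma ln_norm_factorization:
  assumes "G z = (\<Prod>a\<in>Z. (z - a) ^ m a) * (g z :: complex)" "finite Z" "z \<notin> Z" "g z \<noteq> 0"
  shows "ln (norm (G z)) = (\<Sum>a\<in>Z. real (m a) * ln (norm (z - a))) + ln (norm (g z))"
proof -
  have "ln (norm (\<Prod>a\<in>Z. (z - a) ^ m a)) = (\<Sum>a\<in>Z. real (m a) * ln (norm (z - a)))"
    using assms(2,3)
    by (subst prod_norm[symmetric], subst ln_prod) (auto simp: norm_power ln_realpow intro!: sum.cong)
  moreover have "(\<Prod>a\<in>Z. (z - a) ^ m a) \<noteq> 0" using assms(2,3) by auto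
  ultimately show ?thesis using assms(1,4) by (simp add: norm_mult ln_mult)
qed

lemma set_integrable_ln_norm_holomorphic:
  assumes G: "G holomorphic_on D" and D: "open D" "connected D" and nz: "\<exists>z\<in>D. G z \<noteq> 0"
    and K: "compact K" "K \<subseteq> D" and m: "G \<in> borel_measurable borel"
  shows "set_integrable lborel K (\<lambda>z. ln (norm (G z)))"
proof -
  define Z where "Z = {z\<in>K. G z = 0}"
  obtain g where g: "finite Z" "g holomorphic_on D" "g \<in> borel_measurable borel"
    "\<And>z. z \<in> K \<Longrightarrow> g z \<noteq> 0"
    "\<And>z. z \<in> D \<Longrightarrow> G z = (\<Prod>a\<in>Z. (z - a) ^ nat (zorder G a)) * g z"
    by (rule holomorphic_factorization[OF G D nz K, folded Z_def]) (rule that; assumption)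
  have [measurable]: "G \<in> borel_measurable borel" "K \<in> sets borel" "g \<in> borel_measurable borel"
    using m K g(3) by (auto intro: borel_compact)
  have "set_integrable lborel K (\<lambda>z. (\<Sum>a\<in>Z. real (nat (zorder G a)) * ln (norm (z - a))) + ln (norm (g z)))"
  proof (intro set_integral_add set_integrable_mult_right)
    show "set_integrable lborel K (\<lambda>z. ln (norm (g z)))"
      by (rule set_integrable_ln_norm_nonvanishing)
         (use K g holomorphic_on_imp_continuous_on holomorphic_on_subset in \<open>blast+\<close>)
    show "set_integrable lborel K (\<lambda>z. \<Sum>a\<in>Z. real (nat (zorder G a)) * ln (norm (z - a)))"
      unfolding set_integrable_def scaleR_sum_right
      by (intro Bochner_Integration.integrable_sum)
         (use set_integrable_mult_right[OF set_integrable_ln_norm[OF compact_imp_bounded[OF K(1)]]] in \<open>auto simp: set_integrable_def\<close>)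
  qed
  moreover have "AE z in lborel. indicator K z *\<^sub>R ((\<Sum>a\<in>Z. real (nat (zorder G a)) * ln (norm (z - a))) + ln (norm (g z)))
      = indicator K z *\<^sub>R ln (norm (G z))"
    using AE_not_in_finite[OF g(1)]
  proof eventually_elim
    case (elim z)
    show ?case
    proof (cases "z \<in> K")
      case True
      then show ?thesis
        using ln_norm_factorization[where G = G and g = g and m = "\<lambda>a. nat (zorder G a)", OF g(5) g(1) elim g(4)] K by auto
    qed simp
  qed
  ultimately show ?thesis
    unfolding set_integrable_def by (subst (asm) integrable_cong_AE) auto
qed

text \<open>Subharmonicity of \<open>ln (norm (G z))\<close>: every linear factor satisfies the
  submean inequality and the zero-free cofactor satisfies equality. The radius
  \<open>\<delta>'\<close> leaves room, so that the cofactor is zero-free beyond the disc of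
  averaging.\<close>

lemma ln_norm_le_disc_average:
  assumes G: "G holomorphic_on D" and D: "open D" "connected D"
    and m [measurable]: "G \<in> borel_measurable borel" and \<delta>: "0 < \<delta>" and \<delta>': "\<delta> < \<delta>'" "cball c \<delta>' \<subseteq> D" and nz: "G c \<noteq> 0"
  shows "pi * \<delta>\<^sup>2 * ln (norm (G c)) \<le> (LINT z:ball c \<delta>|lborel. ln (norm (G z)))"
proof -
  define K Z where "K = cball c \<delta>'" and "Z = {z\<in>K. G z = 0}"
  have K: "compact K" "K \<subseteq> D" and cK: "c \<in> K" "c \<in> D" using \<delta> \<delta>' by (auto simp: K_def)
  have nz': "\<exists>z\<in>D. G z \<noteq> 0" using nz cK by auto
  obtain g where g: "finite Z" "g holomorphic_on D" "g \<in> borel_measurable borel"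
    "\<And>z. z \<in> K \<Longrightarrow> g z \<noteq> 0"
    "\<And>z. z \<in> D \<Longrightarrow> G z = (\<Prod>a\<in>Z. (z - a) ^ nat (zorder G a)) * g z"
    by (rule holomorphic_factorization[OF G D nz' K, folded Z_def]) (rule that; assumption)
  have [measurable]: "g \<in> borel_measurable borel" "ball c \<delta> \<in> sets borel" using g by auto
  have cZ: "c \<notin> Z" using nz by (simp add: Z_def)
  let ?n = "\<lambda>a. real (nat (zorder G a))"
  have int1: "set_integrable lborel (ball c \<delta>) (\<lambda>z. ln (norm (z - a)))" for a
    by (rule set_integrable_ln_norm) auto
  have "set_integrable lborel K (\<lambda>z. ln (norm (g z)))"
    by (rule set_integrable_ln_norm_nonvanishing)
       (use K g holomorphic_on_imp_continuous_on holomorphic_on_subset in \<open>blast+\<close>)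
  then have int2: "set_integrable lborel (ball c \<delta>) (\<lambda>z. ln (norm (g z)))"
    by (rule set_integrable_subset) (use \<delta>' in \<open>auto simp: K_def\<close>)
  have one: "pi * \<delta>\<^sup>2 * ln (norm (c - a)) \<le> (LINT z:ball c \<delta>|lborel. ln (norm (z - a)))" if "a \<in> Z" for a
  proof -
    have "(LINT z:ball c \<delta>|lborel. ln (norm (z - a))) = (LINT z:ball 0 \<delta>|lborel. ln (norm (z - (a - c))))"
      by (subst set_integral_translate) (auto simp: algebra_simps)
    then show ?thesis using disc_average_ln_norm_diff[OF \<delta>(1), of "a - c"] that cZ
      by (auto simp: norm_minus_commute)
  qed
  have two: "(LINT z:ball c \<delta>|lborel. ln (norm (g z))) = pi * \<delta>\<^sup>2 * ln (norm (g c))"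
    by (rule disc_average_ln_norm_nonvanishing[where R = \<delta>'])
       (use g \<delta> \<delta>' K ball_subset_cball in \<open>auto simp: K_def intro!: holomorphic_on_subset[OF g(2)]\<close>)
  have "pi * \<delta>\<^sup>2 * ln (norm (G c)) = (\<Sum>a\<in>Z. ?n a * (pi * \<delta>\<^sup>2 * ln (norm (c - a)))) + pi * \<delta>\<^sup>2 * ln (norm (g c))"
    using ln_norm_factorization[where G = G and g = g and m = "\<lambda>a. nat (zorder G a)", OF g(5) g(1) cZ g(4)] cK
    by (simp add: sum_distrib_left algebra_simps)
  also have "\<dots> \<le> (\<Sum>a\<in>Z. ?n a * (LINT z:ball c \<delta>|lborel. ln (norm (z - a)))) + (LINT z:ball c \<delta>|lborel. ln (norm (g z)))"
    unfolding two by (intro add_mono sum_mono mult_left_mono one) auto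
  also have "\<dots> = (\<integral>z. (\<Sum>a\<in>Z. ?n a * (indicator (ball c \<delta>) z * ln (norm (z - a)))) + indicator (ball c \<delta>) z * ln (norm (g z)) \<partial>lborel)"
    using int1 int2 by (simp add: set_integrable_def set_lebesgue_integral_def)
  also have "\<dots> = (\<integral>z. indicator (ball c \<delta>) z * ln (norm (G z)) \<partial>lborel)"
  proof (rule integral_cong_AE)
    show "AE z in lborel. (\<Sum>a\<in>Z. ?n a * (indicator (ball c \<delta>) z * ln (norm (z - a)))) + indicator (ball c \<delta>) z * ln (norm (g z))
      = indicator (ball c \<delta>) z * ln (norm (G z))"
      using AE_not_in_finite[OF g(1)]
    proof eventually_elim
      case (elim z)
      show ?case
      proof (cases "z \<in> ball c \<delta>")
        case True
        then have "z \<in> K" "z \<in> D" using \<delta>' by (auto simp: K_def)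
        then show ?thesis
          using ln_norm_factorization[where G = G and g = g and m = "\<lambda>a. nat (zorder G a)", OF g(5) g(1) elim g(4)] True
          by (simp del: mem_ball)
      qed simp
    qed
  qed auto
  finally show ?thesis by (simp add: set_lebesgue_integral_def)
qed

subsection \<open>Tents\<close>

lemma bounded_compact_support:
  fixes \<phi> :: "complex \<Rightarrow> real"
  assumes "continuous_on UNIV \<phi>" "\<And>z. norm z > R \<Longrightarrow> \<phi> z = 0"
  obtains B where "0 < B" "\<And>z. \<bar>\<phi> z\<bar> \<le> B"
proof -
  have "compact (\<phi> ` cball 0 R)"
    using assms(1) by (intro compact_continuous_image) (auto intro: continuous_on_subset)
  then obtain B where "\<And>z. norm z \<le> R \<Longrightarrow> \<bar>\<phi> z\<bar> \<le> B"
    by (force dest!: compact_imp_bounded simp: bounded_iff)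
  then have "\<bar>\<phi> z\<bar> \<le> max B 1" for z using assms(2)[of z] by (cases "norm z \<le> R") (auto simp: le_max_iff_disj)
  then show ?thesis using that[of "max B 1"] by auto
qed

text \<open>The mean of \<open>ln (norm (z - b))\<close> over the circle of radius rho about 0 is
  \<open>ln (max rho (norm b))\<close>; the tent is the difference for rho = 2 * r and rho = r. It
  equals ln 2 up to modulus r, then decreases logarithmically, and vanishes from modulus 2 * r
  on.\<close>

definition tent :: "real \<Rightarrow> complex \<Rightarrow> real" where
  "tent r b = ln (max (2 * r) (norm b)) - ln (max r (norm b))"

definition tent_mass :: "real \<Rightarrow> real" where
  "tent_mass r = (\<integral>b. tent r b \<partial>lborel)"

text \<open>Dividing by the mass makes the kernel a probability density supported in a disc of
  radius 2 * r, hence an approximate identity as r tends to 0.\<close>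

definition tent_conv :: "(complex \<Rightarrow> real) \<Rightarrow> real \<Rightarrow> complex \<Rightarrow> real" where
  "tent_conv \<phi> r a = (\<integral>c. \<phi> c * tent r (a - c) \<partial>lborel) / tent_mass r"

definition circ_avg :: "(complex \<Rightarrow> real) \<Rightarrow> real \<Rightarrow> complex \<Rightarrow> real" where
  "circ_avg \<phi> \<rho> z = (\<integral>\<zeta>. \<phi> (z - of_real \<rho> * \<zeta>) \<partial>circ)"

text \<open>Stands in for \<open>\<Delta>(tent_conv \<phi> r) / (2 * pi)\<close>: integrating \<open>ln \<bar>G\<bar>\<close> against it sums
  \<open>tent_conv \<phi> r\<close> over the zeros of \<open>G\<close>.\<close>

definition tent_laplacian :: "(complex \<Rightarrow> real) \<Rightarrow> real \<Rightarrow> complex \<Rightarrow> real" where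
  "tent_laplacian \<phi> r z = (circ_avg \<phi> (2 * r) z - circ_avg \<phi> r z) / tent_mass r"

lemma continuous_on_tent: "0 < r \<Longrightarrow> continuous_on A (tent r)"
  unfolding tent_def by (intro continuous_intros) auto

lemma tent_measurable [measurable]: "tent r \<in> borel_measurable borel"
  unfolding tent_def by measurable

lemma tent_nonneg: "0 < r \<Longrightarrow> 0 \<le> tent r b"
  unfolding tent_def by (simp add: ln_mono)

lemma tent_eq_0: "0 < r \<Longrightarrow> 2 * r \<le> norm b \<Longrightarrow> tent r b = 0"
  unfolding tent_def by (auto simp: max_def)

lemma integrable_tent: "0 < r \<Longrightarrow> integrable lborel (tent r)"
proof -
  assume r: "0 < r"
  have "integrable lborel (\<lambda>x. indicator (cball 0 (2 * r)) x *\<^sub>R tent r x)"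
    by (rule borel_integrable_compact) (use r in \<open>auto intro: continuous_on_tent\<close>)
  moreover have "indicator (cball 0 (2 * r)) x *\<^sub>R tent r x = tent r x" for x
    using tent_eq_0[OF r, of x] by (auto simp: indicator_def)
  ultimately show ?thesis by (simp only:)
qed

text \<open>The plateau of height ln 2 on the disc of radius \<open>r\<close> already has positive
  mass.\<close>

lemma tent_mass_pos: "0 < r \<Longrightarrow> 0 < tent_mass r"
proof -
  assume r: "0 < r"
  have "0 < pi * r\<^sup>2 * ln 2" using r by simp
  also have "\<dots> = (\<integral>z. indicator (ball (0::complex) r) z * ln 2 \<partial>lborel)"
    using r by (simp add: measure_def emeasure_ball_complex)
  also have "\<dots> \<le> tent_mass r"
    unfolding tent_mass_def
  proof (rule integral_mono)
    show "integrable lborel (\<lambda>z. indicator (ball (0::complex) r) z * ln (2::real))"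
      using r by (intro integrable_mult_left impI integrable_real_indicator) (auto simp: emeasure_ball_complex)
    show "indicator (ball 0 r) z * ln 2 \<le> tent r z" for z
      using r tent_nonneg[OF r, of z] by (auto simp: indicator_def tent_def max_def ln_mult)
  qed (use r integrable_tent in auto)
  finally show ?thesis .
qed

section \<open>The Riesz formula without derivatives\<close>

text \<open>Translating by \<open>of_real \<rho> * \<zeta>\<close> inside Fubini moves the circle
  average from the test function to \<open>f\<close>. Averaging enlarges the support by
  \<open>\<rho>\<close>, whence the radius on which \<open>f\<close> must be integrable.\<close>

lemma integral_circ_avg:
  fixes f :: "complex \<Rightarrow> real"
  assumes \<phi>: "continuous_on UNIV \<phi>" "\<And>z. norm z > R \<Longrightarrow> \<phi> z = 0"
    and [measurable]: "f \<in> borel_measurable borel" and \<rho>: "0 \<le> \<rho>"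
    and f: "set_integrable lborel (cball 0 (R + \<rho>)) f"
  shows "integrable lborel (\<lambda>z. f z * circ_avg \<phi> \<rho> z)"
    and "integrable lborel (\<lambda>c. \<phi> c * (\<integral>\<zeta>. f (c + of_real \<rho> * \<zeta>) \<partial>circ))"
    and "(\<integral>z. f z * circ_avg \<phi> \<rho> z \<partial>lborel) = (\<integral>c. \<phi> c * (\<integral>\<zeta>. f (c + of_real \<rho> * \<zeta>) \<partial>circ) \<partial>lborel)"
proof -
  have [measurable]: "\<phi> \<in> borel_measurable borel"
    using \<phi>(1) by (rule borel_measurable_continuous_onI)
  obtain B where "0 < B" and B: "\<And>z. \<bar>\<phi> z\<bar> \<le> B"
    using bounded_compact_support[OF \<phi>] by blast
  then have B: "\<And>z. \<bar>\<phi> z\<bar> \<le> B" "0 \<le> B" by auto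
  have [measurable]: "cball (0::complex) (R + \<rho>) \<in> sets borel" by simp
  have fin: "(\<integral>\<^sup>+z. ennreal (B * (indicator (cball 0 (R + \<rho>)) z * \<bar>f z\<bar>)) \<partial>lborel) < \<infinity>"
  proof -
    have "integrable lborel (\<lambda>z. B * (indicator (cball 0 (R + \<rho>)) z * f z))"
      using integrable_mult_right[OF f[unfolded set_integrable_def], of B] by simp
    then have "(\<integral>\<^sup>+z. ennreal (norm (B * (indicator (cball 0 (R + \<rho>)) z * f z))) \<partial>lborel) < \<infinity>"
      by (simp only: integrable_iff_bounded)
    moreover have "norm (B * (indicator (cball 0 (R + \<rho>)) z * f z)) = B * (indicator (cball 0 (R + \<rho>)) z * \<bar>f z\<bar>)" for z
      using B(2) by (simp add: abs_mult)
    ultimately show ?thesis by (simp only:)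
  qed
  have bound: "(\<integral>\<^sup>+z. ennreal (norm (f z * \<phi> (z - of_real \<rho> * \<zeta>))) \<partial>lborel)
      \<le> (\<integral>\<^sup>+z. ennreal (B * (indicator (cball 0 (R + \<rho>)) z * \<bar>f z\<bar>)) \<partial>lborel)" if "norm \<zeta> = 1" for \<zeta>
  proof (intro nn_integral_mono ennreal_leI)
    fix z
    show "norm (f z * \<phi> (z - of_real \<rho> * \<zeta>)) \<le> B * (indicator (cball 0 (R + \<rho>)) z * \<bar>f z\<bar>)"
    proof (cases "norm z \<le> R + \<rho>")
      case True
      then show ?thesis using B(1)[of "z - of_real \<rho> * \<zeta>"] by (auto simp: abs_mult mult.commute[of B] intro!: mult_left_mono)
    next
      case False
      have "norm z - norm (of_real \<rho> * \<zeta>) \<le> norm (z - of_real \<rho> * \<zeta>)" by (rule norm_triangle_ineq2)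
      then have "\<phi> (z - of_real \<rho> * \<zeta>) = 0" using False that \<rho> by (intro \<phi>(2)) (simp add: norm_mult)
      then show ?thesis using False by simp
    qed
  qed
  have boundAE: "AE \<zeta> in circ. (\<integral>\<^sup>+z. ennreal (norm (f z * \<phi> (z - of_real \<rho> * \<zeta>))) \<partial>lborel)
      \<le> (\<integral>\<^sup>+z. ennreal (B * (indicator (cball 0 (R + \<rho>)) z * \<bar>f z\<bar>)) \<partial>lborel)"
    using AE_circ by eventually_elim (rule bound)
  have trans: "(\<integral>\<^sup>+z. h z \<partial>lborel) = (\<integral>\<^sup>+c. h (c + w) \<partial>lborel)"
    if "h \<in> borel_measurable borel" for h and w :: complex
  proof -
    have "(\<integral>\<^sup>+z. h z \<partial>distr lborel borel (\<lambda>c. w + c)) = (\<integral>\<^sup>+c. h (w + c) \<partial>lborel)"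
      by (rule nn_integral_distr) (use that in auto)
    then show ?thesis unfolding lborel_distr_plus by (simp only: add.commute)
  qed
  have int1: "integrable (lborel \<Otimes>\<^sub>M circ) (\<lambda>(z, \<zeta>). f z * \<phi> (z - of_real \<rho> * \<zeta>))"
  proof (rule integrableI_bounded)
    have "(\<integral>\<^sup>+p. ennreal (norm (case p of (z, \<zeta>) \<Rightarrow> f z * \<phi> (z - of_real \<rho> * \<zeta>))) \<partial>(lborel \<Otimes>\<^sub>M circ))
      = (\<integral>\<^sup>+\<zeta>. \<integral>\<^sup>+z. ennreal (norm (f z * \<phi> (z - of_real \<rho> * \<zeta>))) \<partial>lborel \<partial>circ)"
      by (subst lborel_circ.nn_integral_snd[symmetric]) (auto simp: case_prod_beta)
    also have "\<dots> \<le> (\<integral>\<^sup>+\<zeta>. (\<integral>\<^sup>+z. ennreal (B * (indicator (cball 0 (R + \<rho>)) z * \<bar>f z\<bar>)) \<partial>lborel) \<partial>circ)"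
      by (rule nn_integral_mono_AE[OF boundAE])
    also have "\<dots> < \<infinity>" using fin by (simp add: circ.emeasure_space_1[simplified])
    finally show "(\<integral>\<^sup>+p. ennreal (norm (case p of (z, \<zeta>) \<Rightarrow> f z * \<phi> (z - of_real \<rho> * \<zeta>))) \<partial>(lborel \<Otimes>\<^sub>M circ)) < \<infinity>" .
  qed measurable
  have int2: "integrable (lborel \<Otimes>\<^sub>M circ) (\<lambda>(c, \<zeta>). \<phi> c * f (c + of_real \<rho> * \<zeta>))"
  proof (rule integrableI_bounded)
    have "(\<integral>\<^sup>+p. ennreal (norm (case p of (c, \<zeta>) \<Rightarrow> \<phi> c * f (c + of_real \<rho> * \<zeta>))) \<partial>(lborel \<Otimes>\<^sub>M circ))
      = (\<integral>\<^sup>+\<zeta>. \<integral>\<^sup>+c. ennreal (norm (\<phi> c * f (c + of_real \<rho> * \<zeta>))) \<partial>lborel \<partial>circ)"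
      by (subst lborel_circ.nn_integral_snd[symmetric]) (auto simp: case_prod_beta)
    also have "\<dots> = (\<integral>\<^sup>+\<zeta>. \<integral>\<^sup>+z. ennreal (norm (f z * \<phi> (z - of_real \<rho> * \<zeta>))) \<partial>lborel \<partial>circ)"
    proof (rule nn_integral_cong)
      fix \<zeta>
      show "(\<integral>\<^sup>+c. ennreal (norm (\<phi> c * f (c + of_real \<rho> * \<zeta>))) \<partial>lborel)
        = (\<integral>\<^sup>+z. ennreal (norm (f z * \<phi> (z - of_real \<rho> * \<zeta>))) \<partial>lborel)"
        by (subst trans[of "\<lambda>z. ennreal (norm (f z * \<phi> (z - of_real \<rho> * \<zeta>)))" "of_real \<rho> * \<zeta>"])
           (auto simp: mult.commute)
    qed
    also have "\<dots> \<le> (\<integral>\<^sup>+\<zeta>. (\<integral>\<^sup>+z. ennreal (B * (indicator (cball 0 (R + \<rho>)) z * \<bar>f z\<bar>)) \<partial>lborel) \<partial>circ)"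
      by (rule nn_integral_mono_AE[OF boundAE])
    also have "\<dots> < \<infinity>" using fin by (simp add: circ.emeasure_space_1[simplified])
    finally show "(\<integral>\<^sup>+p. ennreal (norm (case p of (c, \<zeta>) \<Rightarrow> \<phi> c * f (c + of_real \<rho> * \<zeta>))) \<partial>(lborel \<Otimes>\<^sub>M circ)) < \<infinity>" .
  qed measurable
  show "integrable lborel (\<lambda>z. f z * circ_avg \<phi> \<rho> z)"
    using lborel_circ.integrable_fst'[OF int1] by (simp add: circ_avg_def)
  show "integrable lborel (\<lambda>c. \<phi> c * (\<integral>\<zeta>. f (c + of_real \<rho> * \<zeta>) \<partial>circ))"
    using lborel_circ.integrable_fst'[OF int2] by simp
  have "(\<integral>z. f z * circ_avg \<phi> \<rho> z \<partial>lborel) = (\<integral>\<zeta>. \<integral>z. f z * \<phi> (z - of_real \<rho> * \<zeta>) \<partial>lborel \<partial>circ)"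
    using lborel_circ.Fubini_integral[OF int1] by (simp add: circ_avg_def)
  also have "\<dots> = (\<integral>\<zeta>. \<integral>c. \<phi> c * f (c + of_real \<rho> * \<zeta>) \<partial>lborel \<partial>circ)"
  proof (rule Bochner_Integration.integral_cong[OF refl])
    fix \<zeta>
    have "(\<integral>z. f z * \<phi> (z - of_real \<rho> * \<zeta>) \<partial>distr lborel borel (\<lambda>z. of_real \<rho> * \<zeta> + z))
       = (\<integral>c. \<phi> c * f (c + of_real \<rho> * \<zeta>) \<partial>lborel)"
      by (subst integral_distr) (auto simp: mult.commute add.commute)
    then show "(\<integral>z. f z * \<phi> (z - of_real \<rho> * \<zeta>) \<partial>lborel) = (\<integral>c. \<phi> c * f (c + of_real \<rho> * \<zeta>) \<partial>lborel)"
      by (simp only: lborel_distr_plus)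
  qed
  also have "\<dots> = (\<integral>c. \<phi> c * (\<integral>\<zeta>. f (c + of_real \<rho> * \<zeta>) \<partial>circ) \<partial>lborel)"
    using lborel_circ.Fubini_integral[OF int2] by simp
  finally show "(\<integral>z. f z * circ_avg \<phi> \<rho> z \<partial>lborel) = (\<integral>c. \<phi> c * (\<integral>\<zeta>. f (c + of_real \<rho> * \<zeta>) \<partial>circ) \<partial>lborel)" .
qed

lemma circ_mean_real: "(\<integral>\<zeta>. (k::real) \<partial>circ) = k"
  using circ.prob_space by simp

lemma continuous_on_circ_avg:
  assumes "continuous_on UNIV \<phi>" "\<And>z. norm z > R \<Longrightarrow> \<phi> z = 0"
  shows "continuous_on UNIV (circ_avg \<phi> \<rho>)"
proof -
  have [measurable]: "\<phi> \<in> borel_measurable borel"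
    using assms(1) by (rule borel_measurable_continuous_onI)
  obtain B where B: "\<And>z. \<bar>\<phi> z\<bar> \<le> B" using bounded_compact_support[OF assms] by blast
  show ?thesis
    unfolding continuous_on_eq_continuous_at[OF open_UNIV] isCont_def
  proof (intro ballI)
    fix z :: complex
    show "circ_avg \<phi> \<rho> \<midarrow>z\<rightarrow> circ_avg \<phi> \<rho> z"
      unfolding circ_avg_def
    proof (rule tendsto_at_iff_sequentially[THEN iffD2], intro allI impI)
      fix X assume X: "\<forall>i. X i \<in> UNIV - {z}" "X \<longlonglongrightarrow> z"
      show "((\<lambda>z. \<integral>\<zeta>. \<phi> (z - of_real \<rho> * \<zeta>) \<partial>circ) \<circ> X) \<longlonglongrightarrow> (\<integral>\<zeta>. \<phi> (z - of_real \<rho> * \<zeta>) \<partial>circ)"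
        unfolding o_def
      proof (rule integral_dominated_convergence[where w = "\<lambda>_. B"])
        show "AE \<zeta> in circ. (\<lambda>i. \<phi> (X i - of_real \<rho> * \<zeta>)) \<longlonglongrightarrow> \<phi> (z - of_real \<rho> * \<zeta>)"
        proof (rule AE_I2)
          fix \<zeta>
          have "(\<lambda>i. X i - of_real \<rho> * \<zeta>) \<longlonglongrightarrow> z - of_real \<rho> * \<zeta>" by (intro tendsto_intros X)
          moreover have "isCont \<phi> (z - of_real \<rho> * \<zeta>)" using assms(1) by (simp add: continuous_on_eq_continuous_at)
          ultimately show "(\<lambda>i. \<phi> (X i - of_real \<rho> * \<zeta>)) \<longlonglongrightarrow> \<phi> (z - of_real \<rho> * \<zeta>)"
            by (rule isCont_tendsto_compose[rotated])
        qed
      qed (use B in auto)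
    qed
  qed
qed

lemma circ_avg_eq_0:
  assumes "\<And>z. norm z > R \<Longrightarrow> \<phi> z = 0" "0 \<le> \<rho>" "R + \<rho> < norm z"
  shows "circ_avg \<phi> \<rho> z = 0"
proof -
  show ?thesis
    unfolding circ_avg_def
  proof (rule integral_eq_zero_AE)
    show "AE \<zeta> in circ. \<phi> (z - of_real \<rho> * \<zeta>) = 0"
      using AE_circ
    proof eventually_elim
      case (elim \<zeta>)
      have "norm z - norm (of_real \<rho> * \<zeta>) \<le> norm (z - of_real \<rho> * \<zeta>)" by (rule norm_triangle_ineq2)
      then show ?case using elim assms by (intro assms(1)) (simp add: norm_mult)
    qed
  qed
qed

lemma tent_laplacian_eq_0:
  assumes "\<And>z. norm z > R \<Longrightarrow> \<phi> z = 0" "0 < r" "R + 2 * r < norm z"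
  shows "tent_laplacian \<phi> r z = 0"
  using assms circ_avg_eq_0[of R \<phi> "2 * r" z] circ_avg_eq_0[of R \<phi> r z] by (simp add: tent_laplacian_def)

lemma continuous_on_tent_laplacian:
  assumes "continuous_on UNIV \<phi>" "\<And>z. norm z > R \<Longrightarrow> \<phi> z = 0" "0 < r"
  shows "continuous_on UNIV (tent_laplacian \<phi> r)"
  unfolding tent_laplacian_def
  using continuous_on_circ_avg[OF assms(1,2)] tent_mass_pos[OF assms(3)]
  by (intro continuous_intros) auto

text \<open>This replaces the distributional identity that the Laplacian of ln |z - a| is 2 * pi
  times the unit mass at \<open>a\<close>. With the averages moved to the logarithm, Jensen's
  formula gives \<open>ln (max \<rho> (norm (a - c)))\<close>, and the difference of the radii 2 * r
  and r is the tent.\<close>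

lemma integral_ln_norm_diff_tent_laplacian:
  fixes a :: complex
  assumes \<phi>: "continuous_on UNIV \<phi>" "\<And>z. norm z > R \<Longrightarrow> \<phi> z = 0" and r: "0 < r"
  shows "integrable lborel (\<lambda>z. ln (norm (z - a)) * tent_laplacian \<phi> r z)"
    and "(\<integral>z. ln (norm (z - a)) * tent_laplacian \<phi> r z \<partial>lborel) = tent_conv \<phi> r a"
proof -
  have [measurable]: "\<phi> \<in> borel_measurable borel"
    using \<phi>(1) by (rule borel_measurable_continuous_onI)
  have *: "integrable lborel (\<lambda>z. ln (norm (z - a)) * circ_avg \<phi> \<rho> z) \<and>
    integrable lborel (\<lambda>c. \<phi> c * ln (max \<rho> (norm (a - c)))) \<and>
    (\<integral>z. ln (norm (z - a)) * circ_avg \<phi> \<rho> z \<partial>lborel) = (\<integral>c. \<phi> c * ln (max \<rho> (norm (a - c))) \<partial>lborel)"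
    if \<rho>: "0 < \<rho>" for \<rho>
  proof -
    let ?f = "\<lambda>z. ln (norm (z - a))"
    have ae: "AE c in lborel. \<phi> c * (\<integral>\<zeta>. ?f (c + of_real \<rho> * \<zeta>) \<partial>circ) = \<phi> c * ln (max \<rho> (norm (a - c)))"
      using AE_norm_neq[of a \<rho>]
    proof eventually_elim
      case (elim c)
      have "(\<integral>\<zeta>. ?f (c + of_real \<rho> * \<zeta>) \<partial>circ) = (\<integral>\<zeta>. ln (norm (\<zeta> * of_real \<rho> - (a - c))) \<partial>circ)"
        by (simp add: algebra_simps)
      also have "\<dots> = ln (max \<rho> (norm (a - c)))"
        using elim \<rho> by (subst circ_mean_ln_norm_diff) (auto simp: norm_minus_commute)
      finally show ?case by simp
    qed
    have si: "set_integrable lborel (cball 0 (R + \<rho>)) ?f" by (rule set_integrable_ln_norm) auto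
    have m: "(\<lambda>z. ln (norm (z - a))) \<in> borel_measurable borel" by measurable
    note A = integral_circ_avg[OF \<phi> m less_imp_le[OF \<rho>] si]
    have m1: "(\<lambda>c. \<phi> c * ln (max \<rho> (norm (a - c)))) \<in> borel_measurable lborel" by measurable
    show ?thesis
      using A(1) A(2) A(3) integrable_cong_AE[OF borel_measurable_integrable[OF A(2)] m1 ae]
        integral_cong_AE[OF borel_measurable_integrable[OF A(2)] m1 ae] by simp
  qed
  have r2: "0 < 2 * r" using r by simp
  have eq: "ln (norm (z - a)) * tent_laplacian \<phi> r z
     = (ln (norm (z - a)) * circ_avg \<phi> (2 * r) z - ln (norm (z - a)) * circ_avg \<phi> r z) / tent_mass r" for z
    by (simp add: tent_laplacian_def algebra_simps diff_divide_distrib)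
  have eq2: "\<phi> c * tent r (a - c) = \<phi> c * ln (max (2 * r) (norm (a - c))) - \<phi> c * ln (max r (norm (a - c)))" for c
    by (simp add: tent_def algebra_simps)
  show "integrable lborel (\<lambda>z. ln (norm (z - a)) * tent_laplacian \<phi> r z)"
    unfolding eq using *[OF r] *[OF r2] by (intro integrable_divide Bochner_Integration.integrable_diff) auto
  show "(\<integral>z. ln (norm (z - a)) * tent_laplacian \<phi> r z \<partial>lborel) = tent_conv \<phi> r a"
    unfolding eq tent_conv_def eq2 using *[OF r] *[OF r2] by simp
qed

text \<open>For harmonic \<open>ln (norm (g z))\<close> the averages over both circles return the
  central value and cancel. The bound on \<open>R1\<close> keeps circles of radius 2 * r about the
  support inside the zero-free ball.\<close>

lemma integral_ln_norm_nonvanishing_tent_laplacian: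
  assumes \<phi>: "continuous_on UNIV \<phi>" "\<And>z. norm z > R \<Longrightarrow> \<phi> z = 0" and r: "0 < r"
    and R1: "R + 2 * r < R1"
    and g: "g holomorphic_on ball 0 R1" "\<And>z. z \<in> ball 0 R1 \<Longrightarrow> g z \<noteq> 0"
      and m [measurable]: "g \<in> borel_measurable borel"
  shows "integrable lborel (\<lambda>z. ln (norm (g z)) * tent_laplacian \<phi> r z)"
    and "(\<integral>z. ln (norm (g z)) * tent_laplacian \<phi> r z \<partial>lborel) = 0"
proof -
  have *: "integrable lborel (\<lambda>z. ln (norm (g z)) * circ_avg \<phi> \<rho> z) \<and>
    (\<integral>z. ln (norm (g z)) * circ_avg \<phi> \<rho> z \<partial>lborel) = (\<integral>c. \<phi> c * ln (norm (g c)) \<partial>lborel)"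
    if \<rho>: "0 < \<rho>" "R + \<rho> < R1" for \<rho>
  proof -
    have eq: "\<phi> c * (\<integral>\<zeta>. ln (norm (g (c + of_real \<rho> * \<zeta>))) \<partial>circ) = \<phi> c * ln (norm (g c))" for c
    proof (cases "norm c \<le> R")
      case True
      have sub: "ball c (R1 - R) \<subseteq> ball 0 R1"
      proof
        fix x assume "x \<in> ball c (R1 - R)"
        then show "x \<in> ball 0 R1" using True norm_triangle_ineq2[of x c] by (auto simp: dist_norm norm_minus_commute)
      qed
      have "(\<integral>\<zeta>. ln (norm (g (c + \<zeta> * of_real \<rho>))) \<partial>circ) = ln (norm (g c))"
        by (rule circ_mean_ln_norm(2)[where R = "R1 - R"])
           (use g sub \<rho> in \<open>auto intro: holomorphic_on_subset\<close>)
      then show ?thesis by (simp add: mult.commute)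
    qed (use \<phi>(2) in auto)
    have "set_integrable lborel (cball 0 (R + \<rho>)) (\<lambda>z. ln (norm (g z)))"
      by (rule set_integrable_ln_norm_nonvanishing)
         (use g \<rho> in \<open>auto intro!: holomorphic_on_imp_continuous_on holomorphic_on_subset[OF g(1)]\<close>)
    from integral_circ_avg[OF \<phi> _ less_imp_le[OF \<rho>(1)] this] show ?thesis by (simp add: eq)
  qed
  have eq: "ln (norm (g z)) * tent_laplacian \<phi> r z
     = (ln (norm (g z)) * circ_avg \<phi> (2 * r) z - ln (norm (g z)) * circ_avg \<phi> r z) / tent_mass r" for z
    by (simp add: tent_laplacian_def algebra_simps diff_divide_distrib)
  show "integrable lborel (\<lambda>z. ln (norm (g z)) * tent_laplacian \<phi> r z)"
    unfolding eq using *[of r] *[of "2*r"] r R1 by (intro integrable_divide Bochner_Integration.integrable_diff) auto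
  show "(\<integral>z. ln (norm (g z)) * tent_laplacian \<phi> r z \<partial>lborel) = 0"
    unfolding eq using *[of r] *[of "2*r"] r R1 by simp
qed

text \<open>With the zeros in the disc of radius \<open>R1\<close> factored out, every linear factor
  contributes one value of \<open>tent_conv\<close> and the cofactor contributes 0; outside that
  disc the kernel vanishes.\<close>

lemma integral_ln_norm_tent_laplacian:
  assumes \<phi>: "continuous_on UNIV \<phi>" "\<And>z. norm z > R \<Longrightarrow> \<phi> z = 0" and r: "0 < r"
    and R1: "R + 2 * r < R1" "cball 0 R1 \<subseteq> D"
    and G: "G holomorphic_on D" and D: "open D" "connected D" and nz: "\<exists>z\<in>D. G z \<noteq> 0"
    and m [measurable]: "G \<in> borel_measurable borel"
  shows "(\<integral>z. ln (norm (G z)) * tent_laplacian \<phi> r z \<partial>lborel)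
    = (\<Sum>a\<in>{z\<in>cball 0 R1. G z = 0}. real (nat (zorder G a)) * tent_conv \<phi> r a)"
proof -
  define Z where "Z = {z\<in>cball 0 R1. G z = 0}"
  obtain g where g: "finite Z" "g holomorphic_on D" "g \<in> borel_measurable borel"
    "\<And>z. z \<in> cball 0 R1 \<Longrightarrow> g z \<noteq> 0"
    "\<And>z. z \<in> D \<Longrightarrow> G z = (\<Prod>a\<in>Z. (z - a) ^ nat (zorder G a)) * g z"
    by (rule holomorphic_factorization[OF G D nz compact_cball R1(2), folded Z_def]) (rule that; assumption)
  have [measurable]: "g \<in> borel_measurable borel" by fact
  let ?L = "tent_laplacian \<phi> r" and ?n = "\<lambda>a. real (nat (zorder G a))"
  have Lm [measurable]: "?L \<in> borel_measurable borel"
    by (rule borel_measurable_continuous_onI[OF continuous_on_tent_laplacian[OF \<phi> r]])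
  note one = integral_ln_norm_diff_tent_laplacian[OF \<phi> r]
  have gs: "g holomorphic_on ball 0 R1" using R1(2) ball_subset_cball by (intro holomorphic_on_subset[OF g(2)]) blast
  have two: "integrable lborel (\<lambda>z. ln (norm (g z)) * ?L z)" "(\<integral>z. ln (norm (g z)) * ?L z \<partial>lborel) = 0"
    using integral_ln_norm_nonvanishing_tent_laplacian[OF \<phi> r R1(1) gs g(4) g(3)] by auto
  have "(\<integral>z. ln (norm (G z)) * ?L z \<partial>lborel)
     = (\<integral>z. (\<Sum>a\<in>Z. ?n a * (ln (norm (z - a)) * ?L z)) + ln (norm (g z)) * ?L z \<partial>lborel)"
  proof (rule integral_cong_AE)
    show "AE z in lborel. ln (norm (G z)) * ?L z = (\<Sum>a\<in>Z. ?n a * (ln (norm (z - a)) * ?L z)) + ln (norm (g z)) * ?L z"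
      using AE_not_in_finite[OF g(1)]
    proof eventually_elim
      case (elim z)
      show ?case
      proof (cases "z \<in> cball 0 R1")
        case True
        then have "z \<in> D" using R1 by auto
        from ln_norm_factorization[where G = G and g = g and m = "\<lambda>a. nat (zorder G a)", OF g(5)[OF this] g(1) elim g(4)[OF True]]
        show ?thesis by (simp add: distrib_right sum_distrib_right mult.assoc)
      next
        case False
        then have "?L z = 0" using R1(1) by (intro tent_laplacian_eq_0[OF \<phi>(2) r]) auto
        then show ?thesis by simp
      qed
    qed
  qed measurable
  also have "\<dots> = (\<Sum>a\<in>Z. ?n a * tent_conv \<phi> r a)"
    using one two by simp
  finally show ?thesis unfolding Z_def .
qed

section \<open>Tent convolutions as an approximate identity\<close>

lemma tent_conv_eq_0:
  assumes "\<And>z. norm z > R \<Longrightarrow> \<phi> z = 0" "0 < r" "R + 2 * r < norm a"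
  shows "tent_conv \<phi> r a = 0"
proof -
  have "\<phi> c * tent r (a - c) = 0" for c
  proof (cases "norm c \<le> R")
    case True
    then have "2 * r \<le> norm (a - c)" using assms(3) norm_triangle_ineq2[of a c] by linarith
    then show ?thesis using tent_eq_0[OF assms(2)] by simp
  qed (use assms(1) in auto)
  then have "(\<lambda>c. \<phi> c * tent r (a - c)) = (\<lambda>_. 0)" by blast
  then show ?thesis unfolding tent_conv_def by (simp only: integral_zero)
qed

lemma tent_integral_reflect:
  "(\<integral>c. tent r (a - c) \<partial>lborel) = tent_mass r" "0 < r \<Longrightarrow> integrable lborel (\<lambda>c. tent r (a - c))"
proof -
  have eq: "tent r (a - c) = tent r (-a + c)" for c
    by (simp add: tent_def norm_minus_commute)
  have d: "distr lborel borel (\<lambda>c. -a + c) = (lborel :: complex measure)" by (rule lborel_distr_plus)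
  have "(\<integral>b. tent r b \<partial>distr lborel borel (\<lambda>c. -a + c)) = (\<integral>c. tent r (-a + c) \<partial>lborel)"
    by (rule integral_distr) auto
  then show "(\<integral>c. tent r (a - c) \<partial>lborel) = tent_mass r"
    unfolding eq tent_mass_def d by simp
  show "integrable lborel (\<lambda>c. tent r (a - c))" if "0 < r"
    unfolding eq using integrable_distr[of "\<lambda>c. -a + c" lborel borel "tent r"] integrable_tent[OF that] d by simp
qed

lemma tent_conv_approx:
  assumes \<phi>: "continuous_on UNIV \<phi>" and r: "0 < r"
    and e: "\<And>c. norm (a - c) < 2 * r \<Longrightarrow> \<bar>\<phi> c - \<phi> a\<bar> \<le> e"
  shows "\<bar>tent_conv \<phi> r a - \<phi> a\<bar> \<le> e"
proof -
  have [measurable]: "\<phi> \<in> borel_measurable borel"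
    using \<phi> by (rule borel_measurable_continuous_onI)
  have b: "\<bar>(\<phi> c - \<phi> a) * tent r (a - c)\<bar> \<le> e * tent r (a - c)" for c
  proof (cases "norm (a - c) < 2 * r")
    case True
    then show ?thesis using e[OF True] tent_nonneg[OF r, of "a - c"] by (simp add: abs_mult mult_right_mono)
  next
    case False
    then show ?thesis using tent_eq_0[OF r] by simp
  qed
  have int: "integrable lborel (\<lambda>c. (\<phi> c - \<phi> a) * tent r (a - c))"
    by (rule Bochner_Integration.integrable_bound[OF integrable_mult_right[OF tent_integral_reflect(2)[OF r]], of _ e a])
       (use b in \<open>auto intro!: AE_I2 intro: order.trans[OF b abs_ge_self]\<close>)
  have "(\<integral>c. \<phi> c * tent r (a - c) \<partial>lborel) = (\<integral>c. (\<phi> c - \<phi> a) * tent r (a - c) + \<phi> a * tent r (a - c) \<partial>lborel)"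
    by (simp add: algebra_simps)
  also have "\<dots> = (\<integral>c. (\<phi> c - \<phi> a) * tent r (a - c) \<partial>lborel) + \<phi> a * tent_mass r"
    using int tent_integral_reflect[of r a] r by (subst Bochner_Integration.integral_add) auto
  finally have "tent_conv \<phi> r a - \<phi> a = (\<integral>c. (\<phi> c - \<phi> a) * tent r (a - c) \<partial>lborel) / tent_mass r"
    using tent_mass_pos[OF r] by (simp add: tent_conv_def field_simps)
  moreover have "\<bar>\<integral>c. (\<phi> c - \<phi> a) * tent r (a - c) \<partial>lborel\<bar> \<le> (\<integral>c. e * tent r (a - c) \<partial>lborel)"
    by (rule order.trans[OF integral_abs_bound integral_mono])
       (use int b tent_integral_reflect(2)[OF r] in auto)
  moreover have "(\<integral>c. e * tent r (a - c) \<partial>lborel) = e * tent_mass r"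
    using tent_integral_reflect(1)[of r a] by simp
  ultimately show ?thesis
    using tent_mass_pos[OF r] by (simp only: abs_divide) (simp add: pos_divide_le_eq)
qed

text \<open>Uniform continuity is needed only on a disc one unit larger than the support: two points
  at distance below 1 either both lie in it or both give the value 0.\<close>

lemma uniform_tent_conv_approx:
  assumes \<phi>: "continuous_on UNIV \<phi>" "\<And>z. norm z > R \<Longrightarrow> \<phi> z = 0" and e: "0 < e"
  obtains r0 where "0 < r0" "\<And>r a. 0 < r \<Longrightarrow> r \<le> r0 \<Longrightarrow> \<bar>tent_conv \<phi> r a - \<phi> a\<bar> \<le> e"
proof -
  have "uniformly_continuous_on (cball 0 (R + 1)) \<phi>"
    using \<phi>(1) by (intro compact_uniformly_continuous) (auto intro: continuous_on_subset)
  then obtain d where d: "0 < d" "\<And>x y. norm x \<le> R + 1 \<Longrightarrow> norm y \<le> R + 1 \<Longrightarrow> dist y x < d \<Longrightarrow> dist (\<phi> y) (\<phi> x) < e"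
    using e unfolding uniformly_continuous_on_def by (metis mem_cball_0)
  have *: "\<bar>\<phi> c - \<phi> a\<bar> \<le> e" if "norm (a - c) < min d 1" for a c
  proof (cases "norm a \<le> R \<or> norm c \<le> R")
    case True
    then have "norm a \<le> R + 1" "norm c \<le> R + 1"
      using that norm_triangle_ineq2[of a c] norm_triangle_ineq2[of c a] by (auto simp: norm_minus_commute)
    then show ?thesis using d(2)[of a c] that by (auto simp: dist_norm norm_minus_commute dist_real_def)
  next
    case False
    then show ?thesis using \<phi>(2)[of a] \<phi>(2)[of c] e by simp
  qed
  show ?thesis
  \<comment> \<open>Half of the admissible distance, since a tent of parameter r reaches out to 2 *
    r.\<close>
  proof (rule that[of "min d 1 / 2"])
    show "\<bar>tent_conv \<phi> r a - \<phi> a\<bar> \<le> e" if "0 < r" "r \<le> min d 1 / 2" for r a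
      using that by (intro tent_conv_approx[OF \<phi>(1)] *) auto
  qed (use d in auto)
qed

section \<open>Integrals against the zero measure\<close>

lemma scale_measure_eq_density: "scale_measure k N = density N (\<lambda>_. k)"
  by (rule measure_eqI) (simp_all add: emeasure_density_const)

text \<open>There may be infinitely many zeros in \<open>D\<close>, but only those in the compact
  set contribute, and by the factorization there are finitely many of them.\<close>

lemma integral_zero_measure:
  fixes \<phi> :: "complex \<Rightarrow> real"
  assumes G: "G holomorphic_on D" and D: "open D" "connected D" and nz: "\<exists>z\<in>D. G z \<noteq> 0"
    and K: "compact K" "K \<subseteq> D" and \<phi>: "continuous_on D \<phi>" "\<And>z. z \<in> D - K \<Longrightarrow> \<phi> z = 0" and k: "0 \<le> k"
  shows "(\<integral>z. \<phi> z \<partial>scale_measure (ennreal k) (zero_measure D G))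
    = k * (\<Sum>a\<in>{z\<in>K. G z = 0}. real (nat (zorder G a)) * \<phi> a)"
proof -
  have fin: "finite {z\<in>K. G z = 0}"
    by (rule holomorphic_factorization[OF G D nz K])
  have [measurable]: "\<phi> \<in> borel_measurable (restrict_space borel D)"
    using \<phi>(1) by (rule borel_measurable_continuous_on_restrict)
  let ?N = "density (count_space {z\<in>D. G z = 0}) (\<lambda>z. of_nat (nat (zorder G z)))"
  have [measurable]: "(\<lambda>z. z) \<in> ?N \<rightarrow>\<^sub>M restrict_space borel D"
    by (auto simp: measurable_def space_restrict_space)
  have "(\<integral>z. \<phi> z \<partial>scale_measure (ennreal k) (zero_measure D G)) = k * (\<integral>z. \<phi> z \<partial>zero_measure D G)"
    unfolding scale_measure_eq_density
    by (subst integral_density) (use k nz in \<open>auto simp: zero_measure_def\<close>)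
  also have "(\<integral>z. \<phi> z \<partial>zero_measure D G) = (\<integral>z. \<phi> z \<partial>?N)"
  proof -
    have "\<not> (\<forall>z\<in>D. G z = 0)" using nz by blast
    then have "zero_measure D G = distr ?N (restrict_space borel D) (\<lambda>z. z)" by (simp only: zero_measure_def if_False)
    then show ?thesis by (simp only:) (rule integral_distr, measurable)
  qed
  also have "\<dots> = (\<integral>z. real (nat (zorder G z)) * \<phi> z \<partial>count_space {z\<in>D. G z = 0})"
    unfolding ennreal_of_nat_eq_real_of_nat by (subst integral_density) auto
  also have "\<dots> = (\<integral>z. real (nat (zorder G z)) * \<phi> z * indicator K z \<partial>count_space {z\<in>D. G z = 0})"
    by (rule Bochner_Integration.integral_cong) (use \<phi>(2) in \<open>auto simp: indicator_def\<close>)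
  also have "\<dots> = (\<Sum>a\<in>{z\<in>K. G z = 0}. real (nat (zorder G a)) * \<phi> a * indicator K a)"
    (is "(\<integral>z. ?f z \<partial>count_space ?A) = _")
  proof -
    have sub: "{a\<in>?A. ?f a \<noteq> 0} \<subseteq> {z\<in>K. G z = 0}" by (auto simp: indicator_def split: if_splits)
    have "(\<integral>z. ?f z \<partial>count_space ?A) = (\<Sum>a | a \<in> ?A \<and> ?f a \<noteq> 0. ?f a)"
      by (rule lebesgue_integral_count_space_finite_support) (rule finite_subset[OF sub fin])
    also have "\<dots> = (\<Sum>a\<in>{z\<in>K. G z = 0}. ?f a)"
      by (rule sum.mono_neutral_left[OF fin sub]) (use K in blast)
    finally show ?thesis .
  qed
  also have "\<dots> = (\<Sum>a\<in>{z\<in>K. G z = 0}. real (nat (zorder G a)) * \<phi> a)"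
    by (rule sum.cong) auto
  finally show ?thesis .
qed

lemma integral_zero_measure_trivial:
  assumes "\<forall>z\<in>D. G z = 0"
  shows "(\<integral>z. \<phi> z \<partial>scale_measure k (zero_measure D G)) = (0::real)"
proof -
  have "AE z in scale_measure k (zero_measure D G). \<phi> z = 0"
    using assms by (intro AE_I[of _ _ "space (zero_measure D G)"]) (auto simp: zero_measure_def)
  then show ?thesis by (rule integral_eq_zero_AE)
qed

subsection \<open>The logarithmic potential of the limit measure\<close>

text \<open>In terms of \<open>r = \<bar>z\<bar>\<close>: \<open>log_growth \<alpha> r\<close> is the limit of \<open>ln \<bar>H\<^sub>n(z)\<bar> / n\<close>, and \<open>zero_count \<alpha> r\<close> is
  the limiting mass of the disc of radius \<open>r\<close>.\<close>

definition log_growth :: "real \<Rightarrow> real \<Rightarrow> real" where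
  "log_growth \<alpha> r = (if \<alpha> < 1 \<or> 1 < r then \<bar>1 - \<alpha>\<bar> * \<bar>ln r / \<alpha>\<bar> powr (\<alpha> / (\<alpha> - 1)) else 0)"

definition zero_count :: "real \<Rightarrow> real \<Rightarrow> real" where
  "zero_count \<alpha> r = (if \<alpha> < 1 \<or> 1 < r then \<bar>ln r / \<alpha>\<bar> powr (1 / (\<alpha> - 1)) else 0)"

definition radial_density :: "real \<Rightarrow> real \<Rightarrow> real" where
  "radial_density \<alpha> r = 1 / (2 * pi * \<alpha> * \<bar>1 - \<alpha>\<bar>) * (1 / r\<^sup>2) * \<bar>ln r / \<alpha>\<bar> powr ((2 - \<alpha>) / (\<alpha> - 1))
     * of_bool (\<alpha> < 1 \<and> r < 1 \<or> 1 \<le> \<alpha> \<and> 1 \<le> r)"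

lemma limit_density_eq_radial: "limit_density \<alpha> z = radial_density \<alpha> (norm z)"
  by (simp add: limit_density_def radial_density_def indicator_def not_less)

lemma radial_density_nonneg: "0 < \<alpha> \<Longrightarrow> 0 \<le> radial_density \<alpha> r"
  unfolding radial_density_def by (intro mult_nonneg_nonneg divide_nonneg_nonneg) auto

lemma radial_density_measurable [measurable]: "radial_density \<alpha> \<in> borel_measurable borel"
  unfolding radial_density_def by measurable

lemma zero_count_0 [simp]: "zero_count \<alpha> 0 = 0" and log_growth_0 [simp]: "log_growth \<alpha> 0 = 0"
  by (auto simp: zero_count_def log_growth_def)

text \<open>At r = 0 the conventions ln 0 = 0 and \<open>0 powr p = 0\<close> produce the value 0,
  which is the true limit because the negative power is applied to a base tending to
  infinity.\<close>

lemma continuous_on_neg_ln_powr: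
  fixes p \<alpha> :: real
  assumes "p < 0" "0 < \<alpha>"
  shows "continuous_on {0..<1} (\<lambda>r. \<bar>ln r / \<alpha>\<bar> powr p)"
  unfolding continuous_on_eq_continuous_within
proof
  fix r :: real assume r: "r \<in> {0..<1}"
  show "continuous (at r within {0..<1}) (\<lambda>r. \<bar>ln r / \<alpha>\<bar> powr p)"
  proof (cases "r = 0")
    case False
    then have "isCont (\<lambda>r. \<bar>ln r / \<alpha>\<bar> powr p) r"
      using r assms(2) by (intro continuous_intros) auto
    then show ?thesis by (rule continuous_at_imp_continuous_within)
  next
    case True
    have "filterlim (\<lambda>r. - ln r * (1 / \<alpha>)) at_top (at_right (0::real))"
      using ln_at_0 assms(2)
      by (intro filterlim_at_top_mult_tendsto_pos[where c = "1 / \<alpha>"]) (auto simp: filterlim_uminus_at_top)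
    then have "((\<lambda>r. (- ln r * (1 / \<alpha>)) powr p) \<longlongrightarrow> 0) (at_right 0)"
      by (rule tendsto_neg_powr[OF assms(1)])
    moreover have "\<forall>\<^sub>F r in at_right 0. (- ln r * (1 / \<alpha>)) powr p = \<bar>ln r / \<alpha>\<bar> powr p"
      using eventually_at_right_real[OF zero_less_one]
    proof eventually_elim
      case (elim x)
      then have "- ln x * (1 / \<alpha>) > 0" using assms(2) by (auto simp: divide_less_0_iff)
      then show ?case by (simp add: abs_if divide_less_0_iff)
    qed
    ultimately have "((\<lambda>r. \<bar>ln r / \<alpha>\<bar> powr p) \<longlongrightarrow> 0) (at_right 0)" by (rule Lim_transform_eventually)
    moreover have "at 0 within {0..<1} = at_right (0::real)"
      by (rule at_within_nhd[of 0 "{..<1}"]) auto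
    ultimately show ?thesis using True by (simp add: continuous_within)
  qed
qed

text \<open>The two branches meet at r = 1 with value 0; replacing r by \<open>max 1 r\<close>
  merges them into one formula.\<close>

lemma continuous_on_pos_ln_powr:
  fixes p \<alpha> :: real
  assumes "0 < p" "0 < \<alpha>"
  shows "continuous_on A (\<lambda>r. if 1 < r then \<bar>ln r / \<alpha>\<bar> powr p else 0)"
proof -
  have "(\<lambda>r. if 1 < r then \<bar>ln r / \<alpha>\<bar> powr p else 0) = (\<lambda>r. (ln (max 1 r) / \<alpha>) powr p)"
    using assms by (auto simp: fun_eq_iff max_def abs_div)
  moreover have "continuous_on A (\<lambda>r. (ln (max 1 r) / \<alpha>) powr p)"
    using assms by (intro continuous_on_powr' continuous_intros) (auto simp: max_def)
  ultimately show ?thesis by (simp only:)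
qed

section \<open>Derivatives, local mass and potential of the limit density\<close>

definition radii :: "real \<Rightarrow> real set" where "radii \<alpha> = (if \<alpha> < 1 then {0..<1} else {0..})"

context
  fixes \<alpha> :: real
  assumes \<alpha>: "\<alpha> \<in> {0<..<1} \<union> {1<..}"
begin

lemma \<alpha>_bounds: "0 < \<alpha>" "\<alpha> \<noteq> 1" using \<alpha> by auto

lemma continuous_on_zero_count: "continuous_on (radii \<alpha>) (zero_count \<alpha>)"
proof (cases "\<alpha> < 1")
  case True
  then have "zero_count \<alpha> = (\<lambda>r. \<bar>ln r / \<alpha>\<bar> powr (1 / (\<alpha> - 1)))" by (auto simp: zero_count_def)
  then show ?thesis using continuous_on_neg_ln_powr[of "1 / (\<alpha> - 1)" \<alpha>] True \<alpha>_bounds by (simp add: radii_def)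
next
  case False
  then have "zero_count \<alpha> = (\<lambda>r. if 1 < r then \<bar>ln r / \<alpha>\<bar> powr (1 / (\<alpha> - 1)) else 0)" by (auto simp: zero_count_def)
  then show ?thesis using continuous_on_pos_ln_powr[of "1 / (\<alpha> - 1)" \<alpha>] False \<alpha>_bounds by simp
qed

lemma continuous_on_log_growth: "continuous_on (radii \<alpha>) (log_growth \<alpha>)"
proof (cases "\<alpha> < 1")
  case True
  then have "log_growth \<alpha> = (\<lambda>r. \<bar>1 - \<alpha>\<bar> * \<bar>ln r / \<alpha>\<bar> powr (\<alpha> / (\<alpha> - 1)))" by (auto simp: log_growth_def)
  then show ?thesis using continuous_on_neg_ln_powr[of "\<alpha> / (\<alpha> - 1)" \<alpha>] True \<alpha>_bounds
    by (auto simp: radii_def divide_pos_neg intro!: continuous_intros)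
next
  case False
  then have "log_growth \<alpha> = (\<lambda>r. \<bar>1 - \<alpha>\<bar> * (if 1 < r then \<bar>ln r / \<alpha>\<bar> powr (\<alpha> / (\<alpha> - 1)) else 0))" by (auto simp: log_growth_def)
  then show ?thesis using continuous_on_pos_ln_powr[of "\<alpha> / (\<alpha> - 1)" \<alpha>] False \<alpha>_bounds
    by (auto intro!: continuous_intros)
qed

lemma has_derivative_abs_ln_powr:
  assumes r: "0 < r" "r \<noteq> 1"
  shows "((\<lambda>r. \<bar>ln r / \<alpha>\<bar> powr p) has_real_derivative p * \<bar>ln r / \<alpha>\<bar> powr (p - 1) * (sgn (ln r) / (\<alpha> * r))) (at r)"
proof -
  define \<sigma> where "\<sigma> = sgn (ln r)"
  \<comment> \<open>The side of 1 that contains \<open>r\<close>; on it ln has constant sign, so the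
    absolute value becomes multiplication by \<open>\<sigma>\<close>.\<close>
  define S where "S = (if 1 < r then {1<..} else {0<..<1::real})"
  have S: "open S" "r \<in> S" using r by (auto simp: S_def)
  have abs: "\<bar>ln x / \<alpha>\<bar> = \<sigma> * ln x / \<alpha>" "0 < \<sigma> * ln x / \<alpha>" if "x \<in> S" for x
  proof -
    have "\<bar>ln x\<bar> = \<sigma> * ln x" "0 < \<bar>ln x\<bar>"
      using that r by (auto simp: S_def \<sigma>_def sgn_if split: if_splits)
    then show "\<bar>ln x / \<alpha>\<bar> = \<sigma> * ln x / \<alpha>" "0 < \<sigma> * ln x / \<alpha>"
      using \<alpha>_bounds by (simp_all add: abs_div)
  qed
  have "((\<lambda>r. (\<sigma> * ln r / \<alpha>) powr p) has_real_derivative p * (\<sigma> * ln r / \<alpha>) powr (p - 1) * (\<sigma> * (1 / r) / \<alpha>)) (at r)"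
    by (rule DERIV_fun_powr[THEN DERIV_cong]) (use abs(2)[OF S(2)] r in \<open>auto intro!: derivative_eq_intros\<close>)
  then have "((\<lambda>r. \<bar>ln r / \<alpha>\<bar> powr p) has_real_derivative p * (\<sigma> * ln r / \<alpha>) powr (p - 1) * (\<sigma> * (1 / r) / \<alpha>)) (at r)"
    by (rule has_field_derivative_transform_within_open[OF _ S]) (simp only: abs(1))
  then show ?thesis using abs(1)[OF S(2)] by (simp add: \<sigma>_def mult.commute)
qed

text \<open>The mass of discs grows at the rate 2 * pi * r times the density, the exponents being
  related by 1/(\<alpha>-1) - 1 = (2-\<alpha>)/(\<alpha>-1). The radius 1 is left out because for
  \<alpha> > 1 the formula changes branch there.\<close>

lemma has_derivative_zero_count:
  assumes r: "r \<in> radii \<alpha>" "r \<noteq> 0" "r \<noteq> 1"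
  shows "(zero_count \<alpha> has_real_derivative 2 * pi * r * radial_density \<alpha> r) (at r)"
proof -
  have r0: "0 < r" using r by (auto simp: radii_def split: if_splits)
  have ex: "1 / (\<alpha> - 1) - 1 = (2 - \<alpha>) / (\<alpha> - 1)" using \<alpha>_bounds by (simp add: field_simps)
  show ?thesis
  proof (cases "\<alpha> < 1 \<or> 1 < r")
    case True
    have sg: "sgn (ln r) = (if \<alpha> < 1 then -1 else 1)"
      using True r r0 by (auto simp: radii_def split: if_splits)
    define S where "S = (if \<alpha> < 1 then UNIV else {1::real<..})"
    have "((\<lambda>r. \<bar>ln r / \<alpha>\<bar> powr (1 / (\<alpha> - 1))) has_real_derivative 2 * pi * r * radial_density \<alpha> r) (at r)"
      by (rule has_derivative_abs_ln_powr[OF r0 r(3), of "1 / (\<alpha> - 1)", THEN DERIV_cong])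
         (use True r r0 \<alpha>_bounds in \<open>auto simp: ex sg radial_density_def radii_def field_simps power2_eq_square split: if_splits\<close>)
    then show ?thesis
      by (rule has_field_derivative_transform_within_open[where S = S])
         (use True in \<open>auto simp: S_def zero_count_def\<close>)
  next
    case False
    then have "((\<lambda>_. 0) has_real_derivative 2 * pi * r * radial_density \<alpha> r) (at r)"
      using r by (simp add: radial_density_def)
    then show ?thesis
      by (rule has_field_derivative_transform_within_open[where S = "{..<1}"])
         (use False r in \<open>auto simp: zero_count_def\<close>)
  qed
qed

text \<open>In the form r * U'(r) = N(r) this is the relation between a radial potential U and the
  mass N(r) that its Riesz measure gives to discs.\<close>

lemma has_derivative_log_growth:
  assumes r: "r \<in> radii \<alpha>" "r \<noteq> 0" "r \<noteq> 1"
  shows "(log_growth \<alpha> has_real_derivative zero_count \<alpha> r / r) (at r)"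
proof -
  have r0: "0 < r" using r by (auto simp: radii_def split: if_splits)
  have ex: "\<alpha> / (\<alpha> - 1) - 1 = 1 / (\<alpha> - 1)" using \<alpha>_bounds by (simp add: field_simps)
  show ?thesis
  proof (cases "\<alpha> < 1 \<or> 1 < r")
    case True
    have sg: "sgn (ln r) = (if \<alpha> < 1 then -1 else 1)"
      using True r r0 by (auto simp: radii_def split: if_splits)
    define S where "S = (if \<alpha> < 1 then UNIV else {1::real<..})"
    have "\<bar>1 - \<alpha>\<bar> * (\<alpha> / (\<alpha> - 1) * x * ((if \<alpha> < 1 then - 1 else 1) / (\<alpha> * r))) = x / r" for x
      using \<alpha>_bounds r0 by (simp add: divide_simps)
    then have "((\<lambda>r. \<bar>1 - \<alpha>\<bar> * \<bar>ln r / \<alpha>\<bar> powr (\<alpha> / (\<alpha> - 1))) has_real_derivative zero_count \<alpha> r / r) (at r)"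
      by (intro DERIV_cmult[OF has_derivative_abs_ln_powr[OF r0 r(3), of "\<alpha> / (\<alpha> - 1)"], THEN DERIV_cong])
         (use True in \<open>simp add: ex sg zero_count_def\<close>)
    then show ?thesis
      by (rule has_field_derivative_transform_within_open[where S = S])
         (use True in \<open>auto simp: S_def log_growth_def\<close>)
  next
    case False
    then have "((\<lambda>_. 0) has_real_derivative zero_count \<alpha> r / r) (at r)"
      by (simp add: zero_count_def)
    then show ?thesis
      by (rule has_field_derivative_transform_within_open[where S = "{..<1}"])
         (use False r in \<open>auto simp: log_growth_def\<close>)
  qed
qed

text \<open>Polar coordinates followed by the fundamental theorem of calculus. The finite set
  \<open>S\<close> absorbs the radii at which the primitive has a kink, such as r = 1.\<close>

lemma nn_integral_radial_density:
  fixes F h :: "real \<Rightarrow> real"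
  assumes R: "0 < R" "R \<in> radii \<alpha>" and S: "finite S"
    and F: "continuous_on {0..R} F" "F 0 = 0"
    and d: "\<And>r. 0 < r \<Longrightarrow> r < R \<Longrightarrow> r \<notin> S \<Longrightarrow> (F has_real_derivative h r * (2 * pi * r * radial_density \<alpha> r)) (at r)"
    and h [measurable]: "h \<in> borel_measurable borel" and h0: "\<And>r. 0 \<le> r \<Longrightarrow> r \<le> R \<Longrightarrow> 0 \<le> h r"
  shows "(\<integral>\<^sup>+z. ennreal (indicator (ball 0 R) z * h (norm z) * limit_density \<alpha> z) \<partial>lborel) = ennreal (F R)"
proof -
  let ?g = "\<lambda>r. h r * (2 * pi * r * radial_density \<alpha> r)"
  have "(?g has_integral (F R - F 0)) {0..R}"
    by (rule fundamental_theorem_of_calculus_interior_strong[OF S])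
       (use R F d in \<open>auto simp: has_real_derivative_iff_has_vector_derivative[symmetric]\<close>)
  then have "((\<lambda>r. if r \<in> {0..R} then ?g r else 0) has_integral F R) UNIV"
    by (simp only: has_integral_restrict_UNIV F(2) diff_zero)
  then have 1: "(\<integral>\<^sup>+r. ennreal (if r \<in> {0..R} then ?g r else 0) \<partial>lborel) = ennreal (F R)"
    by (intro nn_integral_has_integral_lborel)
       (use h0 radial_density_nonneg[OF \<alpha>_bounds(1)] in \<open>auto\<close>)
  have "(\<integral>\<^sup>+z. ennreal (indicator (ball 0 R) z * h (norm z) * limit_density \<alpha> z) \<partial>lborel)
     = (\<integral>\<^sup>+z. ennreal (indicator {..<R} (norm (z::complex)) * h (norm z) * radial_density \<alpha> (norm z)) \<partial>lborel)"
    by (intro nn_integral_cong) (simp add: limit_density_eq_radial indicator_def)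
  also have "\<dots> = (\<integral>\<^sup>+r. ennreal (2 * pi * r) * indicator {0..} r * ennreal (indicator {..<R} r * h r * radial_density \<alpha> r) \<partial>lborel)"
    by (rule nn_integral_radial) measurable
  also have "\<dots> = (\<integral>\<^sup>+r. ennreal (if r \<in> {0..R} then ?g r else 0) \<partial>lborel)"
  proof (rule nn_integral_cong_AE)
    have "AE r in lborel. r \<notin> {R}" by (intro AE_not_in countable_imp_null_set_lborel) auto
    then show "AE r in lborel. ennreal (2 * pi * r) * indicator {0..} r * ennreal (indicator {..<R} r * h r * radial_density \<alpha> r)
      = ennreal (if r \<in> {0..R} then ?g r else 0)"
    proof eventually_elim
      case (elim r)
      show ?case
      proof (cases "0 \<le> r \<and> r < R")
        case True
        then have "ennreal (2 * pi * r) * ennreal (h r * radial_density \<alpha> r) = ennreal (2 * pi * r * (h r * radial_density \<alpha> r))"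
          by (intro ennreal_mult'[symmetric]) auto
        then show ?thesis using True by (simp add: mult_ac)
      qed (use elim in \<open>auto simp: indicator_def\<close>)
    qed
  qed
  finally show ?thesis using 1 by simp
qed

text \<open>The density is unbounded near 0 for \<alpha> < 1 and near the unit circle for \<alpha> >
  2; its mass is nevertheless read off from the primitive \<open>zero_count\<close>.\<close>

lemma nn_integral_limit_density:
  assumes R: "0 < R" "R \<in> radii \<alpha>"
  shows "(\<integral>\<^sup>+z. ennreal (indicator (ball 0 R) z * limit_density \<alpha> z) \<partial>lborel) < \<infinity>"
proof -
  have sub: "{0..R} \<subseteq> radii \<alpha>" using R by (auto simp: radii_def split: if_splits)
  have "(\<integral>\<^sup>+z. ennreal (indicator (ball 0 R) z * (\<lambda>_. 1) (norm z) * limit_density \<alpha> z) \<partial>lborel) = ennreal (zero_count \<alpha> R)"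
    by (rule nn_integral_radial_density[where S = "{1}"])
       (use R sub in \<open>auto intro!: continuous_on_subset[OF continuous_on_zero_count] has_derivative_zero_count\<close>)
  then show ?thesis by simp
qed

text \<open>Averaging over rotations replaces \<open>ln \<bar>w - a\<bar>\<close> by \<open>ln (max \<bar>w\<bar> \<bar>a\<bar>)\<close>.\<close>

lemma potential_limit_density:
  assumes R: "0 < R" "R \<in> radii \<alpha>" and w: "w \<noteq> 0" "norm w < R" and C: "0 \<le> C" "ln (2 * R) \<le> C"
  shows "(\<integral>\<^sup>+a. ennreal (indicator (ball 0 R) a * (C - ln (norm (w - a))) * limit_density \<alpha> a) \<partial>lborel)
    = ennreal ((C - ln R) * zero_count \<alpha> R + log_growth \<alpha> R - log_growth \<alpha> (norm w))"
proof -
  define s where "s = norm w"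
  have s: "0 < s" "s < R" using w by (auto simp: s_def)
  have sub: "{0..R} \<subseteq> radii \<alpha>" using R by (auto simp: radii_def split: if_splits)
  \<comment> \<open>Points of the disc are at distance at most 2 * R, so adding \<open>C\<close>
    makes the kernel nonnegative and frees the computation from integrability conditions. The
    condition 0 \<le> C covers coinciding points, where ln 0 = 0.\<close>
  have lnle: "ln x \<le> C" if "0 < x" "x \<le> 2 * R" for x
    using that C(2) ln_mono[of x "2 * R"] by linarith
  have [measurable]: "limit_density \<alpha> \<in> borel_measurable borel"
    unfolding limit_density_eq_radial[abs_def] by measurable
  have [measurable]: "ball (0::complex) R \<in> sets borel" by simp
  have "(\<integral>\<^sup>+a. ennreal (indicator (ball 0 R) a * (C - ln (norm (w - a))) * limit_density \<alpha> a) \<partial>lborel)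
    = (\<integral>\<^sup>+a. (\<integral>\<^sup>+\<zeta>. ennreal (indicator (ball 0 R) (\<zeta> * a) * (C - ln (norm (w - \<zeta> * a))) * limit_density \<alpha> (\<zeta> * a)) \<partial>circ) \<partial>lborel)"
    by (rule nn_integral_rotation_average) measurable
  also have "\<dots> = (\<integral>\<^sup>+a. ennreal (indicator (ball 0 R) a * (C - ln (max s (norm a))) * limit_density \<alpha> a) \<partial>lborel)"
  proof (rule nn_integral_cong_AE)
    show "AE a in lborel. (\<integral>\<^sup>+\<zeta>. ennreal (indicator (ball 0 R) (\<zeta> * a) * (C - ln (norm (w - \<zeta> * a))) * limit_density \<alpha> (\<zeta> * a)) \<partial>circ)
        = ennreal (indicator (ball 0 R) a * (C - ln (max s (norm a))) * limit_density \<alpha> a)"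
      using AE_norm_neq[of 0 s]
    proof eventually_elim
      case (elim a)
      show ?case
      proof (cases "norm a < R")
        case True
        have ne: "norm a \<noteq> norm w" using elim by (simp add: s_def)
        note m = circ_mean_ln_norm_diff[OF ne]
        have ld0: "0 \<le> limit_density \<alpha> a" by (simp add: limit_density_eq_radial radial_density_nonneg \<alpha>_bounds)
        have "(\<integral>\<^sup>+\<zeta>. ennreal (indicator (ball 0 R) (\<zeta> * a) * (C - ln (norm (w - \<zeta> * a))) * limit_density \<alpha> (\<zeta> * a)) \<partial>circ)
          = (\<integral>\<^sup>+\<zeta>. ennreal ((C - ln (norm (\<zeta> * a - w))) * limit_density \<alpha> a) \<partial>circ)"
          using AE_circ by (intro nn_integral_cong_AE)
            (auto elim!: eventually_mono simp: norm_mult True limit_density_eq_radial norm_minus_commute)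
        also have "\<dots> = ennreal (\<integral>\<zeta>. (C - ln (norm (\<zeta> * a - w))) * limit_density \<alpha> a \<partial>circ)"
        proof (rule nn_integral_eq_integral)
          show "integrable circ (\<lambda>\<zeta>. (C - ln (norm (\<zeta> * a - w))) * limit_density \<alpha> a)"
            using m(1) by (intro integrable_mult_left) auto
          show "AE \<zeta> in circ. 0 \<le> (C - ln (norm (\<zeta> * a - w))) * limit_density \<alpha> a"
            using AE_circ
          proof eventually_elim
            case (elim \<zeta>)
            have "norm (\<zeta> * a - w) \<le> norm a + norm w"
              using norm_triangle_ineq4[of "\<zeta> * a" w] elim by (simp add: norm_mult)
            then have "norm (\<zeta> * a - w) \<le> 2 * R" using True w(2) by simp
            then have "ln (norm (\<zeta> * a - w)) \<le> C"
              using lnle[of "norm (\<zeta> * a - w)"] C(1) by (cases "\<zeta> * a = w") auto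
            then show ?case using ld0 by simp
          qed
        qed
        also have "(\<integral>\<zeta>. (C - ln (norm (\<zeta> * a - w))) * limit_density \<alpha> a \<partial>circ) = (C - ln (max s (norm a))) * limit_density \<alpha> a"
          using m circ_mean_real by (simp add: s_def max.commute)
        finally show ?thesis using True by simp
      next
        case False
        have "(\<integral>\<^sup>+\<zeta>. ennreal (indicator (ball 0 R) (\<zeta> * a) * (C - ln (norm (w - \<zeta> * a))) * limit_density \<alpha> (\<zeta> * a)) \<partial>circ)
          = (\<integral>\<^sup>+\<zeta>. 0 \<partial>circ)"
          using AE_circ by (intro nn_integral_cong_AE) (auto elim!: eventually_mono simp: norm_mult False)
        then show ?thesis using False by simp
      qed
    qed
  qed
  \<comment> \<open>The primitive comes from integration by parts: beyond s the product (C - ln r) *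
    N(r) leaves the derivative -N(r)/r, which U'(r) = N(r)/r cancels. Subtracting U(s) makes the
    primitive vanish at 0.\<close>
  also have "\<dots> = ennreal ((\<lambda>r. (C - ln (max s r)) * zero_count \<alpha> r + (log_growth \<alpha> (max s r) - log_growth \<alpha> s)) R)"
  proof (rule nn_integral_radial_density[OF R, where S = "{s, 1}" and h = "\<lambda>r. C - ln (max s r)"])
    show "continuous_on {0..R} (\<lambda>r. (C - ln (max s r)) * zero_count \<alpha> r + (log_growth \<alpha> (max s r) - log_growth \<alpha> s))"
      using s sub
      by (intro continuous_intros continuous_on_subset[OF continuous_on_zero_count]
            continuous_on_compose2[OF continuous_on_log_growth]) (auto simp: subset_iff)
    show "((\<lambda>r. (C - ln (max s r)) * zero_count \<alpha> r + (log_growth \<alpha> (max s r) - log_growth \<alpha> s)) has_real_derivative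
        (C - ln (max s r)) * (2 * pi * r * radial_density \<alpha> r)) (at r)"
      if r: "0 < r" "r < R" "r \<notin> {s, 1}" for r
    proof -
      have N: "(zero_count \<alpha> has_real_derivative 2 * pi * r * radial_density \<alpha> r) (at r)"
        and J: "(log_growth \<alpha> has_real_derivative zero_count \<alpha> r / r) (at r)"
        using has_derivative_zero_count[of r] has_derivative_log_growth[of r] r subsetD[OF sub, of r] by auto
      show ?thesis
      proof (cases "r < s")
        case True
        have "((\<lambda>r. (C - ln s) * zero_count \<alpha> r) has_real_derivative (C - ln s) * (2 * pi * r * radial_density \<alpha> r)) (at r)"
          by (rule DERIV_cmult[OF N])
        then have "((\<lambda>r. (C - ln (max s r)) * zero_count \<alpha> r + (log_growth \<alpha> (max s r) - log_growth \<alpha> s)) has_real_derivative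
            (C - ln s) * (2 * pi * r * radial_density \<alpha> r)) (at r)"
          by (rule has_field_derivative_transform_within_open[where S = "{..<s}"]) (use True in auto)
        then show ?thesis using True by simp
      next
        case False
        then have sr: "s < r" using r by auto
        have "((\<lambda>r. (C - ln r) * zero_count \<alpha> r + (log_growth \<alpha> r - log_growth \<alpha> s)) has_real_derivative
            (C - ln r) * (2 * pi * r * radial_density \<alpha> r)) (at r)"
          by (rule derivative_eq_intros N J refl | use r in simp)+
        then have "((\<lambda>r. (C - ln (max s r)) * zero_count \<alpha> r + (log_growth \<alpha> (max s r) - log_growth \<alpha> s)) has_real_derivative
            (C - ln r) * (2 * pi * r * radial_density \<alpha> r)) (at r)"
          by (rule has_field_derivative_transform_within_open[where S = "{s<..}"]) (use sr in auto)
        then show ?thesis using sr by simp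
      qed
    qed
    show "0 \<le> C - ln (max s r)" if "0 \<le> r" "r \<le> R" for r
      using that s lnle[of "max s r"] by auto
  qed (use s in auto)
  finally show ?thesis using s by (simp add: s_def algebra_simps)
qed

end

section \<open>Integrals against the limit measure\<close>

lemma radii_pos_D: "R \<in> radii \<alpha> \<Longrightarrow> ball 0 R \<subseteq> H_domain \<alpha>" "R \<in> radii \<alpha> \<Longrightarrow> cball 0 R \<subseteq> H_domain \<alpha>"
  by (auto simp: radii_def H_domain_def split: if_splits)

lemma limit_density_measurable [measurable]: "limit_density \<alpha> \<in> borel_measurable borel"
  unfolding limit_density_eq_radial[abs_def] by measurable

lemma limit_density_nonneg: "0 < \<alpha> \<Longrightarrow> 0 \<le> limit_density \<alpha> z"
  by (simp add: limit_density_eq_radial radial_density_nonneg)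

lemma H_domain_borel [measurable, simp]: "H_domain \<alpha> \<in> sets borel"
  by (simp add: H_domain_def)

lemma integral_limit_measure:
  fixes f :: "complex \<Rightarrow> real"
  assumes [measurable]: "f \<in> borel_measurable borel" and "0 < \<alpha>" and f: "\<And>z. z \<notin> H_domain \<alpha> \<Longrightarrow> f z = 0"
  shows "(\<integral>z. f z \<partial>limit_measure \<alpha>) = (\<integral>z. f z * limit_density \<alpha> z \<partial>lborel)"
proof -
  have [measurable]: "f \<in> borel_measurable (restrict_space lborel (H_domain \<alpha>))"
    "limit_density \<alpha> \<in> borel_measurable (restrict_space lborel (H_domain \<alpha>))"
    by (auto intro!: measurable_restrict_space1)
  have "(\<integral>z. f z \<partial>limit_measure \<alpha>) = (\<integral>z. limit_density \<alpha> z * f z \<partial>restrict_space lborel (H_domain \<alpha>))"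
    unfolding limit_measure_def using limit_density_nonneg[OF assms(2)] by (subst integral_density) auto
  also have "\<dots> = (\<integral>z. indicator (H_domain \<alpha>) z * (limit_density \<alpha> z * f z) \<partial>lborel)"
    by (subst integral_restrict_space) auto
  also have "\<dots> = (\<integral>z. f z * limit_density \<alpha> z \<partial>lborel)"
    by (rule Bochner_Integration.integral_cong) (use f in \<open>auto simp: indicator_def\<close>)
  finally show ?thesis .
qed

lemma integrable_limit_density:
  fixes f :: "complex \<Rightarrow> real"
  assumes \<alpha>: "\<alpha> \<in> {0<..<1} \<union> {1<..}" and R: "0 < R" "R \<in> radii \<alpha>"
    and f [measurable]: "f \<in> borel_measurable borel" and B: "\<And>z. \<bar>f z\<bar> \<le> B" and f0: "\<And>z. norm z \<ge> R \<Longrightarrow> f z = 0"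
  shows "integrable lborel (\<lambda>z. f z * limit_density \<alpha> z)"
proof (rule Bochner_Integration.integrable_bound)
  have [measurable]: "ball (0::complex) R \<in> sets borel" by simp
  have "integrable lborel (\<lambda>z. indicator (ball 0 R) z * limit_density \<alpha> z)"
  proof (rule integrableI_bounded)
    have "norm (indicator (ball 0 R) z * limit_density \<alpha> z) = indicator (ball 0 R) z * limit_density \<alpha> z" for z
      using limit_density_nonneg[of \<alpha> z] \<alpha> by auto
    then show "(\<integral>\<^sup>+ z. ennreal (norm (indicator (ball 0 R) z * limit_density \<alpha> z)) \<partial>lborel) < \<infinity>"
      using nn_integral_limit_density[OF \<alpha> R] by simp
  qed measurable
  then show "integrable lborel (\<lambda>z. B * (indicator (ball 0 R) z * limit_density \<alpha> z))"
    by (rule integrable_mult_right)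
  show "AE z in lborel. norm (f z * limit_density \<alpha> z) \<le> norm (B * (indicator (ball 0 R) z * limit_density \<alpha> z))"
  proof (rule AE_I2)
    fix z
    show "norm (f z * limit_density \<alpha> z) \<le> norm (B * (indicator (ball 0 R) z * limit_density \<alpha> z))"
      using B[of z] f0[of z] limit_density_nonneg[of \<alpha> z] \<alpha>
      by (cases "norm z < R") (auto simp: abs_mult intro!: mult_right_mono)
  qed
qed measurable

lemma continuous_on_log_growth_norm:
  assumes \<alpha>: "\<alpha> \<in> {0<..<1} \<union> {1<..}" and R: "R \<in> radii \<alpha>"
  shows "continuous_on (cball (0::complex) R) (\<lambda>z. log_growth \<alpha> (norm z))"
  by (rule continuous_on_compose2[OF continuous_on_log_growth[OF \<alpha>]])
     (use R in \<open>auto intro!: continuous_intros simp: radii_def split: if_splits\<close>)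

lemma log_growth_measurable [measurable]: "log_growth \<alpha> \<in> borel_measurable borel"
  unfolding log_growth_def by measurable

lemma log_growth_nonneg: "0 \<le> log_growth \<alpha> r"
  by (simp add: log_growth_def)

text \<open>For \<alpha> < 1 both |ln r| and the power with its negative exponent are decreasing.
  Monotonicity keeps the potential computed above nonnegative, so that its value can be recovered
  from \<open>ennreal\<close>.\<close>

lemma log_growth_mono:
  assumes \<alpha>: "\<alpha> \<in> {0<..<1} \<union> {1<..}" and r: "0 < r" "r \<le> s" "s \<in> radii \<alpha>"
  shows "log_growth \<alpha> r \<le> log_growth \<alpha> s"
proof (cases "\<alpha> < 1")
  case True
  then have s1: "s < 1" using r by (simp add: radii_def)
  have "\<bar>ln s\<bar> / \<alpha> \<le> \<bar>ln r\<bar> / \<alpha>" "0 < \<bar>ln s\<bar> / \<alpha>"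
    using r s1 \<alpha> ln_mono[of r s] by (auto intro!: divide_right_mono divide_neg_pos)
  then have "(\<bar>ln r\<bar> / \<alpha>) powr (\<alpha> / (\<alpha> - 1)) \<le> (\<bar>ln s\<bar> / \<alpha>) powr (\<alpha> / (\<alpha> - 1))"
    using True \<alpha> by (intro powr_mono2') (auto simp: divide_nonneg_neg)
  then show ?thesis using True \<alpha> by (auto simp: log_growth_def abs_div intro!: mult_left_mono)
next
  case False
  show ?thesis
  proof (cases "1 < r")
    case True
    have "\<bar>ln r\<bar> / \<alpha> \<le> \<bar>ln s\<bar> / \<alpha>" "0 \<le> \<bar>ln r\<bar> / \<alpha>"
      using r True \<alpha> ln_mono[of r s] by (auto intro!: divide_right_mono)
    then have "(\<bar>ln r\<bar> / \<alpha>) powr (\<alpha> / (\<alpha> - 1)) \<le> (\<bar>ln s\<bar> / \<alpha>) powr (\<alpha> / (\<alpha> - 1))"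
      using False \<alpha> by (intro powr_mono2) auto
    then show ?thesis using True r False \<alpha> by (auto simp: log_growth_def abs_div intro!: mult_left_mono)
  next
    case r1: False
    then have "log_growth \<alpha> r = 0" using False by (simp add: log_growth_def)
    then show ?thesis by (simp add: log_growth_nonneg)
  qed
qed

text \<open>On the disc of radius \<open>R\<close> the function \<open>log_growth\<close> is, up to
  a constant, the logarithmic potential of the limit density there. Fubini reduces the claim to the
  identity for a single logarithm, and the constant drops out because the kernel has integral
  0.\<close>

lemma integral_log_growth_tent_laplacian:
  assumes \<alpha>: "\<alpha> \<in> {0<..<1} \<union> {1<..}" and R: "0 < R" "R \<in> radii \<alpha>"
    and \<phi>: "continuous_on UNIV \<phi>" "\<And>z. norm z > R0 \<Longrightarrow> \<phi> z = 0" and r: "0 < r" and R0: "R0 + 2 * r < R"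
  shows "(\<integral>z. log_growth \<alpha> (norm z) * tent_laplacian \<phi> r z \<partial>lborel)
    = (\<integral>a. tent_conv \<phi> r a * limit_density \<alpha> a \<partial>lborel)"
proof -
  define C where "C = max 0 (ln (2 * R))"
  have C: "0 \<le> C" "ln (2 * R) \<le> C" by (auto simp: C_def)
  define K where "K = (C - ln R) * zero_count \<alpha> R + log_growth \<alpha> R"
  define \<Psi> where "\<Psi> = tent_laplacian \<phi> r"
  have \<Psi>c: "continuous_on UNIV \<Psi>" unfolding \<Psi>_def by (rule continuous_on_tent_laplacian[OF \<phi> r])
  have \<Psi>0: "\<Psi> z = 0" if "norm z \<ge> R" for z
    unfolding \<Psi>_def by (rule tent_laplacian_eq_0[OF \<phi>(2) r]) (use that R0 in auto)
  have [measurable]: "\<Psi> \<in> borel_measurable borel" using \<Psi>c by (rule borel_measurable_continuous_onI)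
  have [measurable]: "ball (0::complex) R \<in> sets borel" by simp
  define k where "k z a = indicator (ball 0 R) a * (C - ln (norm (z - a))) * limit_density \<alpha> a" for z a :: complex
  have k_meas [measurable]: "case_prod k \<in> borel_measurable (borel \<Otimes>\<^sub>M borel)" unfolding k_def by measurable
  have k0: "0 \<le> k z a" if z: "norm z < R" for z a
  proof (cases "norm a < R")
    case True
    have "norm (z - a) \<le> 2 * R" using norm_triangle_ineq4[of z a] z True by linarith
    then have "ln (norm (z - a)) \<le> C"
      using C ln_mono[of "norm (z - a)" "2 * R"] by (cases "z = a") auto
    then show ?thesis using limit_density_nonneg[of \<alpha> a] \<alpha> by (auto simp: k_def)
  qed (simp add: k_def)
  have pot: "(\<integral>\<^sup>+a. ennreal (k z a) \<partial>lborel) = ennreal (K - log_growth \<alpha> (norm z))" if "z \<noteq> 0" "norm z < R" for z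
    using potential_limit_density[OF \<alpha> R that C] by (simp add: k_def K_def)
  have Kc: "continuous_on (cball 0 R) (\<lambda>z. \<Psi> z * (K - log_growth \<alpha> (norm z)))"
    by (intro continuous_intros continuous_on_log_growth_norm[OF \<alpha> R(2)] continuous_on_subset[OF \<Psi>c]) auto
  have nz: "AE z in lborel. z \<noteq> (0::complex)" using AE_norm_neq[of 0 0] by simp
  have int: "integrable (lborel \<Otimes>\<^sub>M lborel) (\<lambda>(z, a). \<Psi> z * k z a)"
  proof (rule integrableI_bounded)
    have "integrable lborel (\<lambda>z. indicator (cball 0 R) z *\<^sub>R (\<Psi> z * (K - log_growth \<alpha> (norm z))))"
      by (rule borel_integrable_compact[OF _ Kc]) auto
    then have fin: "(\<integral>\<^sup>+z. ennreal (norm (indicator (cball 0 R) z *\<^sub>R (\<Psi> z * (K - log_growth \<alpha> (norm z))))) \<partial>lborel) < \<infinity>"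
      by (simp only: integrable_iff_bounded)
    have "(\<integral>\<^sup>+p. ennreal (norm (case p of (z, a) \<Rightarrow> \<Psi> z * k z a)) \<partial>(lborel \<Otimes>\<^sub>M lborel))
      = (\<integral>\<^sup>+z. \<integral>\<^sup>+a. ennreal (norm (\<Psi> z * k z a)) \<partial>lborel \<partial>lborel)"
      by (subst lborel.nn_integral_fst[symmetric]) (auto simp: case_prod_beta)
    also have "\<dots> \<le> (\<integral>\<^sup>+z. ennreal (norm (indicator (cball 0 R) z *\<^sub>R (\<Psi> z * (K - log_growth \<alpha> (norm z))))) \<partial>lborel)"
    proof (rule nn_integral_mono_AE)
      show "AE z in lborel. (\<integral>\<^sup>+a. ennreal (norm (\<Psi> z * k z a)) \<partial>lborel)
        \<le> ennreal (norm (indicator (cball 0 R) z *\<^sub>R (\<Psi> z * (K - log_growth \<alpha> (norm z)))))"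
        using nz
      proof eventually_elim
        case (elim z)
        show ?case
        proof (cases "norm z < R")
          case True
          have "(\<integral>\<^sup>+a. ennreal (norm (\<Psi> z * k z a)) \<partial>lborel) = (\<integral>\<^sup>+a. ennreal \<bar>\<Psi> z\<bar> * ennreal (k z a) \<partial>lborel)"
            using k0[OF True] by (intro nn_integral_cong) (simp add: abs_mult ennreal_mult)
          also have "\<dots> = ennreal \<bar>\<Psi> z\<bar> * ennreal (K - log_growth \<alpha> (norm z))"
            by (subst nn_integral_cmult) (auto simp: pot[OF elim True])
          also have "\<dots> = ennreal (\<bar>\<Psi> z\<bar> * (K - log_growth \<alpha> (norm z)))"
            by (rule ennreal_mult'[symmetric]) simp
          also have "\<dots> \<le> ennreal (norm (indicator (cball 0 R) z *\<^sub>R (\<Psi> z * (K - log_growth \<alpha> (norm z)))))"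
            using True by (intro ennreal_leI) (auto simp: abs_mult intro!: mult_left_mono)
          finally show ?thesis .
        qed (use \<Psi>0 in simp)
      qed
    qed
    finally show "(\<integral>\<^sup>+p. ennreal (norm (case p of (z, a) \<Rightarrow> \<Psi> z * k z a)) \<partial>(lborel \<Otimes>\<^sub>M lborel)) < \<infinity>"
      using fin by (rule order.strict_trans1)
  qed measurable
  have J: "integrable lborel (\<lambda>z. \<Psi> z * log_growth \<alpha> (norm z))"
  proof -
    have "integrable lborel (\<lambda>z. indicator (cball 0 R) z *\<^sub>R (\<Psi> z * log_growth \<alpha> (norm z)))"
      by (rule borel_integrable_compact)
         (auto intro!: continuous_intros continuous_on_log_growth_norm[OF \<alpha> R(2)] continuous_on_subset[OF \<Psi>c])
    moreover have "indicator (cball 0 R) z *\<^sub>R (\<Psi> z * log_growth \<alpha> (norm z)) = \<Psi> z * log_growth \<alpha> (norm z)" for z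
      using \<Psi>0[of z] by (auto simp: indicator_def)
    ultimately show ?thesis by (simp only:)
  qed
  \<comment> \<open>The constant function e has no zeros and logarithm 1, so the identity for
    zero-free functions says that the kernel has integral 0.\<close>
  have \<Psi>i: "integrable lborel \<Psi>" "(\<integral>z. \<Psi> z \<partial>lborel) = 0"
    using integral_ln_norm_nonvanishing_tent_laplacian[OF \<phi> r R0, of "\<lambda>_. exp 1"]
    by (auto simp: norm_exp_eq_Re \<Psi>_def)
  have "(\<integral>z. (\<integral>a. \<Psi> z * k z a \<partial>lborel) \<partial>lborel) = (\<integral>z. K * \<Psi> z - \<Psi> z * log_growth \<alpha> (norm z) \<partial>lborel)"
  proof (rule integral_cong_AE)
    show "AE z in lborel. (\<integral>a. \<Psi> z * k z a \<partial>lborel) = K * \<Psi> z - \<Psi> z * log_growth \<alpha> (norm z)"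
      using nz
    proof eventually_elim
      case (elim z)
      show ?case
      proof (cases "norm z < R")
        case True
        have "log_growth \<alpha> (norm z) \<le> log_growth \<alpha> R"
          using elim True R(2) by (intro log_growth_mono[OF \<alpha>]) auto
        moreover have "0 \<le> (C - ln R) * zero_count \<alpha> R"
        proof (rule mult_nonneg_nonneg)
          have "ln R \<le> ln (2 * R)" using R(1) by (intro ln_mono) auto
          then show "0 \<le> C - ln R" using C(2) by simp
        qed (simp add: zero_count_def)
        ultimately have K0: "0 \<le> K - log_growth \<alpha> (norm z)" by (simp add: K_def)
        have "(\<integral>a. k z a \<partial>lborel) = enn2real (ennreal (K - log_growth \<alpha> (norm z)))"
          using k0[OF True] by (subst integral_eq_nn_integral) (auto simp: pot[OF elim True])
        also have "\<dots> = K - log_growth \<alpha> (norm z)" using K0 by simp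
        finally have "(\<integral>a. k z a \<partial>lborel) = K - log_growth \<alpha> (norm z)" .
        then have "(\<integral>a. \<Psi> z * k z a \<partial>lborel) = \<Psi> z * (K - log_growth \<alpha> (norm z))" by simp
        then show ?thesis by (simp add: algebra_simps)
      qed (use \<Psi>0 in simp)
    qed
  qed measurable
  also have "\<dots> = - (\<integral>z. log_growth \<alpha> (norm z) * \<Psi> z \<partial>lborel)"
    using J \<Psi>i by (simp add: mult.commute)
  finally have 1: "(\<integral>z. (\<integral>a. \<Psi> z * k z a \<partial>lborel) \<partial>lborel) = - (\<integral>z. log_growth \<alpha> (norm z) * \<Psi> z \<partial>lborel)" .
  have "(\<integral>z. (\<integral>a. \<Psi> z * k z a \<partial>lborel) \<partial>lborel) = (\<integral>a. (\<integral>z. \<Psi> z * k z a \<partial>lborel) \<partial>lborel)"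
    using lborel_pair.Fubini_integral[OF int] by simp
  also have "\<dots> = (\<integral>a. - (tent_conv \<phi> r a * limit_density \<alpha> a) \<partial>lborel)"
  proof (rule Bochner_Integration.integral_cong[OF refl])
    fix a :: complex
    note t = integral_ln_norm_diff_tent_laplacian[where R = R0 and a = a, OF \<phi> r, folded \<Psi>_def]
    have "(\<integral>z. \<Psi> z * k z a \<partial>lborel)
      = (\<integral>z. indicator (ball 0 R) a * limit_density \<alpha> a * (C * \<Psi> z - ln (norm (z - a)) * \<Psi> z) \<partial>lborel)"
      by (simp add: k_def algebra_simps)
    also have "\<dots> = indicator (ball 0 R) a * limit_density \<alpha> a * (- tent_conv \<phi> r a)"
      using t \<Psi>i by simp
    also have "\<dots> = - (tent_conv \<phi> r a * limit_density \<alpha> a)"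
      using tent_conv_eq_0[where R = R0 and a = a, OF \<phi>(2) r] R0 by (cases "norm a < R") (auto simp: indicator_def)
    finally show "(\<integral>z. \<Psi> z * k z a \<partial>lborel) = - (tent_conv \<phi> r a * limit_density \<alpha> a)" .
  qed
  finally show ?thesis using 1 by (simp add: \<Psi>_def)
qed

subsection \<open>Local convergence in mean from pointwise bounds\<close>

text \<open>The centres are those of the cells of a square mesh of side R/N; the half-cell shift
  keeps them off the origin. The quadratic count matters: times the area of discs of radius
  comparable to R/N it gives a bound free of N.\<close>

lemma disc_grid_cover:
  assumes R: "0 < R" and N: "0 < N"
  obtains C where "finite C" "card C \<le> 9 * N\<^sup>2" "\<And>c. c \<in> C \<Longrightarrow> c \<noteq> 0 \<and> norm c \<le> R + R / real N"
    "\<And>z::complex. norm z \<le> R \<Longrightarrow> \<exists>c\<in>C. norm (z - c) \<le> R / real N"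
proof -
  define \<delta> where "\<delta> = R / real N"
  have \<delta>: "0 < \<delta>" "real N * \<delta> = R" using R N by (auto simp: \<delta>_def)
  define c where "c = (\<lambda>(i::int, j::int). Complex (\<delta> * (of_int i + 1/2)) (\<delta> * (of_int j + 1/2)))"
  define I where "I = {- int N..int N}"
  define C where "C = {z \<in> c ` (I \<times> I). norm z \<le> R + \<delta>}"
  have "card C \<le> card (I \<times> I)"
    unfolding C_def by (intro order.trans[OF card_mono card_image_le]) (auto simp: I_def)
  also have "\<dots> = (2 * N + 1)\<^sup>2"
    by (simp add: I_def card_cartesian_product power2_eq_square nat_add_distrib nat_mult_distrib)
  also have "\<dots> \<le> (3 * N)\<^sup>2" using N by (intro power_mono) auto
  also have "\<dots> = 9 * N\<^sup>2" by (simp add: power2_eq_square)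
  finally have card: "card C \<le> 9 * N\<^sup>2" .
  show ?thesis
  proof (rule that[of C])
    show "finite C" by (simp add: C_def I_def)
    show "card C \<le> 9 * N\<^sup>2" by (rule card)
  next
    fix x assume x: "x \<in> C"
    then obtain i j :: int where ij: "x = c (i, j)" by (auto simp: C_def)
    have "real_of_int i + 1/2 \<noteq> 0"
    proof
      assume "real_of_int i + 1/2 = 0"
      then have "real_of_int (2 * i + 1) = 0" by simp
      then have "2 * i + 1 = 0" by linarith
      then show False by presburger
    qed
    then have "Re x \<noteq> 0" using \<delta> ij by (simp add: c_def)
    then have "x \<noteq> 0" by auto
    with x show "x \<noteq> 0 \<and> norm x \<le> R + R / real N" by (simp add: C_def \<delta>_def)
  next
    fix z :: complex assume z: "norm z \<le> R"
    have fl: "\<lfloor>x / \<delta>\<rfloor> \<in> I \<and> \<bar>x - \<delta> * (of_int \<lfloor>x / \<delta>\<rfloor> + 1/2)\<bar> \<le> \<delta> / 2" if "\<bar>x\<bar> \<le> R" for x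
    proof -
      have "\<bar>x / \<delta>\<bar> \<le> real N" using that \<delta> by (simp add: abs_div pos_divide_le_eq)
      then have "- real N \<le> x / \<delta>" "x / \<delta> \<le> real N" unfolding abs_le_iff by linarith+
      then have I: "\<lfloor>x / \<delta>\<rfloor> \<in> I" by (auto simp: I_def le_floor_iff floor_le_iff)
      define t where "t = x / \<delta> - of_int \<lfloor>x / \<delta>\<rfloor>"
      have t: "0 \<le> t" "t < 1" unfolding t_def by linarith+
      have "x - \<delta> * (of_int \<lfloor>x / \<delta>\<rfloor> + 1/2) = \<delta> * (t - 1/2)"
        using \<delta> by (simp add: t_def field_simps)
      moreover have "\<bar>\<delta> * (t - 1/2)\<bar> \<le> \<delta> * (1/2)"
      proof -
        have "\<bar>t - 1/2\<bar> \<le> 1/2" using t unfolding abs_le_iff by auto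
        then show ?thesis using \<delta>(1) unfolding abs_mult by (intro mult_mono) auto
      qed
      ultimately show ?thesis using I by simp
    qed
    define w where "w = c (\<lfloor>Re z / \<delta>\<rfloor>, \<lfloor>Im z / \<delta>\<rfloor>)"
    have a: "\<bar>Re z\<bar> \<le> R" "\<bar>Im z\<bar> \<le> R" using z abs_Re_le_cmod[of z] abs_Im_le_cmod[of z] by auto
    have "norm (z - w) \<le> \<bar>Re (z - w)\<bar> + \<bar>Im (z - w)\<bar>" by (rule cmod_le)
    also have "\<dots> \<le> \<delta>" using fl[OF a(1)] fl[OF a(2)] by (simp add: w_def c_def)
    finally have d: "norm (z - w) \<le> \<delta>" .
    then have "norm w \<le> R + \<delta>" using z norm_triangle_ineq2[of w z] by (simp add: norm_minus_commute)
    then have "w \<in> C" using fl[OF a(1)] fl[OF a(2)] by (auto simp: C_def w_def)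
    with d show "\<exists>c\<in>C. norm (z - c) \<le> R / real N" by (auto simp: \<delta>_def)
  qed
qed

text \<open>The integrand \<open>U + \<epsilon> - ln \<bar>G\<bar> / n\<close> is nonnegative, so its integral may be bounded on a covering by
  small discs, where the submean inequality at the centres applies.\<close>

lemma L1_close_of_pointwise:
  fixes U :: "complex \<Rightarrow> real"
  assumes R: "0 < R" "R < R1" and U: "continuous_on (cball 0 R1) U" "\<And>z. 0 \<le> U z"
    and Um [measurable]: "U \<in> borel_measurable borel" and \<epsilon>: "0 < \<epsilon>"
  obtains C where "finite C" "C \<subseteq> cball 0 R1 - {0}"
    "\<forall>G D n. G holomorphic_on D \<and> open D \<and> connected D \<and> cball 0 R1 \<subseteq> D \<and> G \<in> borel_measurable borel \<and> 0 < n \<and>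
      (\<forall>z. norm z \<le> R1 \<longrightarrow> norm (G z) \<le> exp (n * (U z + \<epsilon>))) \<and> (\<forall>c\<in>C. exp (n * (U c - \<epsilon>)) \<le> norm (G c)) \<longrightarrow>
      set_integrable lborel (cball 0 R) (\<lambda>z. ln (norm (G z)) / n - U z) \<and>
      (LINT z:cball 0 R|lborel. \<bar>ln (norm (G z)) / n - U z\<bar>) \<le> 109 * pi * R\<^sup>2 * \<epsilon>"
proof -
  have "uniformly_continuous_on (cball 0 R1) U"
    using U(1) by (intro compact_uniformly_continuous) auto
  then obtain d where d: "0 < d" "\<And>x y. norm x \<le> R1 \<Longrightarrow> norm y \<le> R1 \<Longrightarrow> dist y x < d \<Longrightarrow> dist (U y) (U x) < \<epsilon>"
    using \<epsilon> unfolding uniformly_continuous_on_def by (metis mem_cball_0)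
  \<comment> \<open>The first condition makes U vary by less than \<open>\<epsilon>\<close> over
    discs of radius 2 * \<delta>; the second keeps the discs of that radius about all grid centres
    inside radius \<open>R1\<close>.\<close>
  obtain N :: nat where N: "max (2 * R / d) (3 * R / (R1 - R)) < real N" using reals_Archimedean2 by blast
  have N0: "0 < N"
  proof (rule ccontr)
    assume "\<not> 0 < N"
    then have "2 * R / d < 0" using N by simp
    moreover have "0 < 2 * R / d" using R d by simp
    ultimately show False by simp
  qed
  define \<delta> where "\<delta> = R / real N"
  have \<delta>0: "0 < \<delta>" using R N0 by (simp add: \<delta>_def)
  have "2 * R < real N * d" using N d by (simp add: pos_divide_less_eq)
  then have \<delta>d: "2 * \<delta> < d" using N0 by (simp add: \<delta>_def field_simps)
  have "3 * R < real N * (R1 - R)" using N R by (simp add: pos_divide_less_eq)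
  then have \<delta>R: "R + 3 * \<delta> < R1" using N0 by (simp add: \<delta>_def field_simps)
  obtain C where C: "finite C" "card C \<le> 9 * N\<^sup>2" "\<And>c. c \<in> C \<Longrightarrow> c \<noteq> 0 \<and> norm c \<le> R + \<delta>"
    "\<And>z::complex. norm z \<le> R \<Longrightarrow> \<exists>c\<in>C. norm (z - c) \<le> \<delta>"
    using disc_grid_cover[OF R(1) N0] unfolding \<delta>_def by metis
  show ?thesis
  proof (rule that[OF C(1)])
    show "C \<subseteq> cball 0 R1 - {0}" using C(3) \<delta>R \<delta>0 by force
  next
    show "\<forall>G D n. G holomorphic_on D \<and> open D \<and> connected D \<and> cball 0 R1 \<subseteq> D \<and> G \<in> borel_measurable borel \<and> 0 < n \<and>
      (\<forall>z. norm z \<le> R1 \<longrightarrow> norm (G z) \<le> exp (n * (U z + \<epsilon>))) \<and> (\<forall>c\<in>C. exp (n * (U c - \<epsilon>)) \<le> norm (G c)) \<longrightarrow>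
      set_integrable lborel (cball 0 R) (\<lambda>z. ln (norm (G z)) / n - U z) \<and>
      (LINT z:cball 0 R|lborel. \<bar>ln (norm (G z)) / n - U z\<bar>) \<le> 109 * pi * R\<^sup>2 * \<epsilon>"
    proof (intro allI impI, elim conjE)
      fix G :: "complex \<Rightarrow> complex" and D and n :: real
      assume G: "G holomorphic_on D" and D: "open D" "connected D" "cball 0 R1 \<subseteq> D"
        and m [measurable]: "G \<in> borel_measurable borel" and n: "0 < n"
        and up: "\<forall>z. norm z \<le> R1 \<longrightarrow> norm (G z) \<le> exp (n * (U z + \<epsilon>))"
        and lo: "\<forall>c\<in>C. exp (n * (U c - \<epsilon>)) \<le> norm (G c)"
      define u where "u z = ln (norm (G z)) / n" for z
      have [measurable]: "u \<in> borel_measurable borel" unfolding u_def by measurable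
      have Gc: "G c \<noteq> 0" if "c \<in> C" for c
      proof -
        have "0 < norm (G c)" by (rule less_le_trans[OF exp_gt_zero lo[rule_format, OF that]])
        then show ?thesis by simp
      qed
      have "\<exists>c\<in>C. norm (0 - c) \<le> \<delta>" using C(4)[of 0] R by simp
      then obtain c0 where "c0 \<in> C" by blast
      then have nz: "\<exists>z\<in>D. G z \<noteq> 0" using Gc C(3)[of c0] \<delta>R \<delta>0 D(3) by force
      have "set_integrable lborel (cball 0 R1) (\<lambda>z. ln (norm (G z)))"
        by (rule set_integrable_ln_norm_holomorphic[OF G D(1,2) nz _ D(3) m]) simp
      then have ui: "set_integrable lborel (cball 0 R1) u"
        unfolding u_def by (rule set_integrable_divide)
      have Ui: "set_integrable lborel (cball 0 R1) U"
        unfolding set_integrable_def by (rule borel_integrable_compact[OF _ U(1)]) simp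
      define f where "f z = U z + \<epsilon> - u z" for z
      have [measurable]: "f \<in> borel_measurable borel" unfolding f_def by measurable
      have \<epsilon>i: "set_integrable lborel (cball (0::complex) R1) (\<lambda>_. \<epsilon>)"
        unfolding set_integrable_def by (rule borel_integrable_compact) auto
      have fi: "set_integrable lborel (cball 0 R1) f"
        unfolding f_def by (intro set_integral_diff set_integral_add Ui ui \<epsilon>i)
      \<comment> \<open>At a zero of \<open>G\<close> the convention ln 0 = 0 makes
        \<open>u z = 0\<close>, and there the claim rests on \<open>U\<close> being
        nonnegative.\<close>
      have f0: "0 \<le> f z" if "norm z \<le> R1" for z
      proof (cases "G z = 0")
        case True
        then show ?thesis using U(2)[of z] \<epsilon> by (simp add: f_def u_def)
      next
        case False
        then have "ln (norm (G z)) \<le> n * (U z + \<epsilon>)" using up[rule_format, OF that] by (metis ln_exp ln_mono zero_less_norm_iff)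
        then show ?thesis using n by (simp add: f_def u_def pos_divide_le_eq mult.commute)
      qed
      have sub: "ball c (2 * \<delta>) \<subseteq> cball 0 R1" "cball c (2 * \<delta>) \<subseteq> cball 0 R1" if "c \<in> C" for c
      proof -
        show "cball c (2 * \<delta>) \<subseteq> cball 0 R1"
        proof
          fix x assume "x \<in> cball c (2 * \<delta>)"
          then have "norm (x - c) \<le> 2 * \<delta>" by (simp add: dist_norm norm_minus_commute)
          then show "x \<in> cball 0 R1" using norm_triangle_ineq2[of x c] C(3)[OF that] \<delta>R by simp
        qed
        then show "ball c (2 * \<delta>) \<subseteq> cball 0 R1" using ball_subset_cball by blast
      qed
      \<comment> \<open>The disc has area 4 * pi * \<delta>^2, and the mean of f is at most 3 *
        \<epsilon>: one from the definition of f, one from the variation of U, one from the lower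
        bound at the centre.\<close>
      have one: "(LINT z:ball c (2 * \<delta>)|lborel. f z) \<le> 12 * pi * \<delta>\<^sup>2 * \<epsilon>" if c: "c \<in> C" for c
      proof -
        have si: "set_integrable lborel (ball c (2 * \<delta>)) u" "set_integrable lborel (ball c (2 * \<delta>)) U"
           "set_integrable lborel (ball c (2 * \<delta>)) (\<lambda>_. \<epsilon>)"
          using sub(1)[OF c] by (auto intro: set_integrable_subset[OF ui] set_integrable_subset[OF Ui] set_integrable_subset[OF \<epsilon>i])
        have cR: "norm c \<le> R1" using C(3)[OF c] \<delta>R \<delta>0 by simp
        have const: "(LINT z:ball c (2 * \<delta>)|lborel. k) = 4 * pi * \<delta>\<^sup>2 * k" for k :: real
          using \<delta>0 by (simp add: set_lebesgue_integral_def measure_def emeasure_ball_complex power2_eq_square)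
        have constint: "set_integrable lborel (ball c (2 * \<delta>)) (\<lambda>_. k)" for k :: real
        proof (rule set_integrable_subset[of _ "cball c (2 * \<delta>)"])
          show "set_integrable lborel (cball c (2 * \<delta>)) (\<lambda>_. k)"
            unfolding set_integrable_def by (rule borel_integrable_compact) auto
        qed auto
        have "pi * (2 * \<delta>)\<^sup>2 * ln (norm (G c)) \<le> (LINT z:ball c (2 * \<delta>)|lborel. ln (norm (G z)))"
        proof (rule ln_norm_le_disc_average[OF G D(1,2) m])
          show "2 * \<delta> < R1 - norm c" using C(3)[OF c] \<delta>R by simp
          show "cball c (R1 - norm c) \<subseteq> D"
          proof
            fix x assume "x \<in> cball c (R1 - norm c)"
            then show "x \<in> D" using norm_triangle_ineq2[of x c] D(3) by (auto simp: dist_norm norm_minus_commute subset_iff)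
          qed
        qed (use \<delta>0 Gc[OF c] in auto)
        then have "pi * (2 * \<delta>)\<^sup>2 * ln (norm (G c)) / n \<le> (LINT z:ball c (2 * \<delta>)|lborel. ln (norm (G z))) / n"
          using n by (simp add: divide_right_mono)
        then have u1: "4 * pi * \<delta>\<^sup>2 * u c \<le> (LINT z:ball c (2 * \<delta>)|lborel. u z)"
          by (simp add: u_def power2_eq_square mult_ac)
        have "n * (U c - \<epsilon>) \<le> ln (norm (G c))"
          using lo[rule_format, OF c] Gc[OF c] by (metis ln_ge_iff zero_less_norm_iff)
        then have uc: "U c - \<epsilon> \<le> u c" using n by (simp add: u_def pos_le_divide_eq mult.commute)
        have "(LINT z:ball c (2 * \<delta>)|lborel. f z) = (LINT z:ball c (2 * \<delta>)|lborel. U z + \<epsilon>) - (LINT z:ball c (2 * \<delta>)|lborel. u z)"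
          unfolding f_def by (intro set_integral_diff set_integral_add si)
        also have "(LINT z:ball c (2 * \<delta>)|lborel. U z + \<epsilon>) \<le> (LINT z:ball c (2 * \<delta>)|lborel. U c + 2 * \<epsilon>)"
        proof (rule set_integral_mono)
          fix z assume z: "z \<in> ball c (2 * \<delta>)"
          then have "z \<in> cball 0 R1" using sub(1)[OF c] by blast
          then have "norm z \<le> R1" by simp
          moreover have "dist z c < d" using z \<delta>d by (simp add: dist_commute)
          ultimately have "dist (U z) (U c) < \<epsilon>" by (rule d(2)[OF cR])
          then show "U z + \<epsilon> \<le> U c + 2 * \<epsilon>" by (simp add: dist_real_def)
        qed (intro set_integral_add si constint)+
        also have "\<dots> = 4 * pi * \<delta>\<^sup>2 * (U c + 2 * \<epsilon>)" by (rule const)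
        finally have "(LINT z:ball c (2 * \<delta>)|lborel. f z) \<le> 4 * pi * \<delta>\<^sup>2 * (U c + 2 * \<epsilon>) - 4 * pi * \<delta>\<^sup>2 * u c"
          using u1 by linarith
        also have "\<dots> = 4 * pi * \<delta>\<^sup>2 * (U c - u c + 2 * \<epsilon>)" by (simp add: algebra_simps)
        also have "\<dots> \<le> 4 * pi * \<delta>\<^sup>2 * (3 * \<epsilon>)" using uc by (intro mult_left_mono) auto
        finally show ?thesis by (simp add: mult_ac)
      qed
      have fR: "set_integrable lborel (cball 0 R) f" and UR: "set_integrable lborel (cball 0 R) (\<lambda>z. u z - U z)"
        and \<epsilon>R: "set_integrable lborel (cball (0::complex) R) (\<lambda>_. \<epsilon>)"
        using R by (auto intro!: set_integrable_subset[OF fi] set_integrable_subset[OF set_integral_diff(1)[OF ui Ui]] set_integrable_subset[OF \<epsilon>i])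
      have "(LINT z:cball 0 R|lborel. f z) \<le> (\<integral>z. (\<Sum>c\<in>C. indicator (ball c (2 * \<delta>)) z * f z) \<partial>lborel)"
        unfolding set_lebesgue_integral_def
      proof (rule integral_mono)
        show "integrable lborel (\<lambda>z. indicator (cball 0 R) z *\<^sub>R f z)" using fR by (simp add: set_integrable_def)
        show "integrable lborel (\<lambda>z. \<Sum>c\<in>C. indicator (ball c (2 * \<delta>)) z * f z)"
        proof (rule Bochner_Integration.integrable_sum)
          fix c assume "c \<in> C"
          then have "set_integrable lborel (ball c (2 * \<delta>)) f" using sub by (intro set_integrable_subset[OF fi]) auto
          then show "integrable lborel (\<lambda>z. indicator (ball c (2 * \<delta>)) z * f z)" by (simp add: set_integrable_def)
        qed
        fix z :: complex
        have nn: "0 \<le> indicator (ball c (2 * \<delta>)) z * f z" if "c \<in> C" for c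
        proof (cases "z \<in> ball c (2 * \<delta>)")
          case True
          then have "norm z \<le> R1" using sub(1)[OF that] by auto
          then show ?thesis using f0[of z] by simp
        qed simp
        show "indicator (cball 0 R) z *\<^sub>R f z \<le> (\<Sum>c\<in>C. indicator (ball c (2 * \<delta>)) z * f z)"
        proof (cases "norm z \<le> R")
          case True
          then obtain c where c: "c \<in> C" "norm (z - c) \<le> \<delta>" using C(4) by blast
          then have "z \<in> ball c (2 * \<delta>)" using \<delta>0 by (simp add: dist_norm norm_minus_commute)
          then have "indicator (cball 0 R) z *\<^sub>R f z = indicator (ball c (2 * \<delta>)) z * f z" using True by simp
          also have "\<dots> \<le> (\<Sum>c\<in>C. indicator (ball c (2 * \<delta>)) z * f z)"
            by (rule member_le_sum[OF c(1) _ C(1)]) (use nn in auto)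
          finally show ?thesis .
        qed (use nn in \<open>auto intro!: sum_nonneg\<close>)
      qed
      also have "\<dots> = (\<Sum>c\<in>C. (LINT z:ball c (2 * \<delta>)|lborel. f z))"
        unfolding set_lebesgue_integral_def real_scaleR_def
      proof (rule Bochner_Integration.integral_sum)
        fix c assume "c \<in> C"
        then have "set_integrable lborel (ball c (2 * \<delta>)) f" using sub by (intro set_integrable_subset[OF fi]) auto
        then show "integrable lborel (\<lambda>z. indicator (ball c (2 * \<delta>)) z * f z)" by (simp add: set_integrable_def)
      qed
      also have "\<dots> \<le> (\<Sum>c\<in>C. 12 * pi * \<delta>\<^sup>2 * \<epsilon>)" by (rule sum_mono) (rule one)
      also have "\<dots> = real (card C) * (12 * pi * \<delta>\<^sup>2 * \<epsilon>)" by simp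
      also have "\<dots> \<le> real (9 * N\<^sup>2) * (12 * pi * \<delta>\<^sup>2 * \<epsilon>)"
        using C(2) \<epsilon> by (intro mult_right_mono) (simp_all only: of_nat_le_iff, auto)
      also have "\<dots> = 108 * pi * R\<^sup>2 * \<epsilon>"
        using N0 by (simp add: \<delta>_def power2_eq_square field_simps)
      finally have f_le: "(LINT z:cball 0 R|lborel. f z) \<le> 108 * pi * R\<^sup>2 * \<epsilon>" .
      \<comment> \<open>Summing over at most 9 * N^2 discs gave 9 * 12 = 108. Since f exceeds U - u
        by \<open>\<epsilon>\<close>, the absolute value costs one more \<open>\<epsilon>\<close>
        times the area, which makes 109.\<close>
      have "(LINT z:cball 0 R|lborel. \<bar>u z - U z\<bar>) \<le> (LINT z:cball 0 R|lborel. f z + \<epsilon>)"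
      proof (rule set_integral_mono)
        show "set_integrable lborel (cball 0 R) (\<lambda>z. \<bar>u z - U z\<bar>)" by (rule set_integrable_abs[OF UR])
        show "set_integrable lborel (cball 0 R) (\<lambda>z. f z + \<epsilon>)" by (intro set_integral_add fR \<epsilon>R)
        fix z :: complex assume "z \<in> cball 0 R"
        then have "0 \<le> f z" using R by (intro f0) auto
        then show "\<bar>u z - U z\<bar> \<le> f z + \<epsilon>" using \<epsilon> by (auto simp: f_def)
      qed
      also have "\<dots> = (LINT z:cball 0 R|lborel. f z) + (LINT z:cball (0::complex) R|lborel. \<epsilon>)"
        by (intro set_integral_add fR \<epsilon>R)
      also have "(LINT z:cball (0::complex) R|lborel. \<epsilon>) = pi * R\<^sup>2 * \<epsilon>"
        using R by (simp add: set_lebesgue_integral_def measure_def emeasure_cball_complex)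
      finally show "set_integrable lborel (cball 0 R) (\<lambda>z. ln (norm (G z)) / n - U z) \<and>
        (LINT z:cball 0 R|lborel. \<bar>ln (norm (G z)) / n - U z\<bar>) \<le> 109 * pi * R\<^sup>2 * \<epsilon>"
        using f_le UR unfolding u_def by (simp add: algebra_simps)
    qed
  qed
qed

subsection \<open>Growth of the series\<close>

text \<open>It lets both ranges of \<alpha> be treated together; in particular
  \<open>coef_sign \<alpha> * (1 - \<alpha>)\<close> is |1 - \<alpha>|.\<close>

definition coef_sign :: "real \<Rightarrow> real" where
  "coef_sign \<alpha> = (if \<alpha> < 1 then 1 else -1)"

definition weight :: "real \<Rightarrow> nat \<Rightarrow> nat \<Rightarrow> real" where
  "weight \<alpha> n k = exp (coef_sign \<alpha> * (real n powr (1 - \<alpha>) * real k powr \<alpha>))"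

text \<open>With t = k/n and s = ln |z|, n times this number is the logarithm of the modulus of the
  k-th term without its random coefficient.\<close>

definition exponent :: "real \<Rightarrow> real \<Rightarrow> real \<Rightarrow> real" where
  "exponent \<alpha> s t = t * s + coef_sign \<alpha> * t powr \<alpha>"

lemma H_eq: "H \<alpha> a n z = (\<Sum>k. a k * of_real (weight \<alpha> n k) * z ^ k)"
  by (simp add: H_def coef_sign_def weight_def)

section \<open>The Legendre transform of the exponent\<close>

text \<open>The graph of x^\<alpha> lies on one side of its tangent at 1, by concavity for \<alpha>
  < 1 and by convexity for \<alpha> > 1. The second case is the first for the exponent 1/\<alpha>,
  applied to x^\<alpha>.\<close>

lemma bernoulli_powr:
  assumes \<alpha>: "\<alpha> \<in> {0<..<1} \<union> {1<..}" and x: "0 \<le> x"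
  shows "coef_sign \<alpha> * (x powr \<alpha> - \<alpha> * x) \<le> coef_sign \<alpha> * (1 - \<alpha>)"
proof (cases "x = 0")
  case True
  then show ?thesis using \<alpha> by (auto simp: coef_sign_def)
next
  case False
  show ?thesis
  proof (cases "\<alpha> < 1")
    case True
    then show ?thesis using Youngs_inequality_0[of \<alpha> "1 - \<alpha>" x 1] \<alpha> x False by (auto simp: coef_sign_def)
  next
    case a1: False
    have "(x powr \<alpha>) powr (1 / \<alpha>) * 1 powr (1 - 1 / \<alpha>) \<le> 1 / \<alpha> * (x powr \<alpha>) + (1 - 1 / \<alpha>) * 1"
      by (rule Youngs_inequality_0) (use \<alpha> a1 x False in auto)
    then have "x \<le> 1 / \<alpha> * (x powr \<alpha>) + (1 - 1 / \<alpha>)" using \<alpha> a1 x False by (simp add: powr_powr)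
    then have "\<alpha> * x \<le> \<alpha> * (1 / \<alpha> * (x powr \<alpha>) + (1 - 1 / \<alpha>))" using \<alpha> by (intro mult_left_mono) auto
    also have "\<dots> = x powr \<alpha> + \<alpha> - 1" using \<alpha> by (auto simp: field_simps)
    finally show ?thesis using a1 by (simp add: coef_sign_def)
  qed
qed

text \<open>\<open>log_growth\<close> is the Legendre transform of the exponent; the supremum is attained where the
  derivative in \<open>t\<close> vanishes.\<close>

lemma exponent_le_log_growth:
  assumes \<alpha>: "\<alpha> \<in> {0<..<1} \<union> {1<..}" and r: "0 < r" "r \<in> radii \<alpha>"
  shows "0 \<le> t \<Longrightarrow> exponent \<alpha> (ln r) t \<le> log_growth \<alpha> r"
    and "\<exists>t\<ge>0. exponent \<alpha> (ln r) t = log_growth \<alpha> r"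
proof -
  have "(\<forall>t\<ge>0. exponent \<alpha> (ln r) t \<le> log_growth \<alpha> r) \<and> (\<exists>t\<ge>0. exponent \<alpha> (ln r) t = log_growth \<alpha> r)"
  proof (cases "\<alpha> < 1 \<or> 1 < r")
    case True
    define y where "y = \<bar>ln r / \<alpha>\<bar>"
    \<comment> \<open>The critical point: it solves t^(\<alpha>-1) = y. In the variable t/t0 the
      inequality is the tangent line inequality, with equality at 1.\<close>
    define t0 where "t0 = y powr (1 / (\<alpha> - 1))"
    have lnr: "ln r = - coef_sign \<alpha> * \<alpha> * y" and y: "0 < y"
    proof -
      have "\<alpha> < 1 \<Longrightarrow> ln r < 0" "\<not> \<alpha> < 1 \<Longrightarrow> 0 < ln r" using True r by (auto simp: radii_def)
      then show "ln r = - coef_sign \<alpha> * \<alpha> * y" "0 < y"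
        using \<alpha> by (auto simp: y_def coef_sign_def abs_div divide_neg_pos)
    qed
    have t0: "0 < t0" using y by (simp add: t0_def)
    have "t0 powr (\<alpha> - 1) = y" using y \<alpha> by (auto simp: t0_def powr_powr)
    then have yt: "t0 * y = t0 powr \<alpha>" using t0 by (simp add: powr_diff field_simps)
    have ex: "1 / (\<alpha> - 1) * \<alpha> = \<alpha> / (\<alpha> - 1)" by simp
    have J: "log_growth \<alpha> r = coef_sign \<alpha> * (1 - \<alpha>) * t0 powr \<alpha>"
      using True \<alpha> by (auto simp: log_growth_def t0_def powr_powr ex coef_sign_def y_def)
    have "exponent \<alpha> (ln r) t = coef_sign \<alpha> * ((t / t0) powr \<alpha> - \<alpha> * (t / t0)) * t0 powr \<alpha>" if "0 \<le> t" for t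
    proof -
      have "t powr \<alpha> = (t / t0) powr \<alpha> * t0 powr \<alpha>" using t0 that by (simp add: powr_mult[symmetric])
      moreover have "t * ln r = - coef_sign \<alpha> * \<alpha> * (t / t0) * t0 powr \<alpha>"
        using t0 unfolding lnr yt[symmetric] by (simp add: field_simps)
      ultimately show ?thesis by (simp add: exponent_def algebra_simps)
    qed
    note eq = this
    have "exponent \<alpha> (ln r) t \<le> log_growth \<alpha> r" if "0 \<le> t" for t
      unfolding eq[OF that] J using that t0 by (intro mult_right_mono bernoulli_powr[OF \<alpha>]) auto
    moreover have "exponent \<alpha> (ln r) t0 = log_growth \<alpha> r"
      unfolding eq[OF less_imp_le[OF t0]] J using t0 by simp
    ultimately show ?thesis using t0 less_imp_le by blast
  next
    case False
    then have "ln r \<le> 0" using r by simp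
    have "exponent \<alpha> (ln r) t \<le> 0" if "0 \<le> t" for t
    proof -
      have "t * ln r \<le> 0" using that \<open>ln r \<le> 0\<close> by (rule mult_nonneg_nonpos)
      moreover have "0 \<le> t powr \<alpha>" by simp
      ultimately have "t * ln r \<le> t powr \<alpha>" by (rule order.trans)
      then show ?thesis using False unfolding exponent_def coef_sign_def by auto
    qed
    moreover have "exponent \<alpha> (ln r) 0 = 0" using \<alpha> by (auto simp: exponent_def)
    moreover have "log_growth \<alpha> r = 0" using False by (simp add: log_growth_def)
    ultimately show ?thesis by auto
  qed
  then show "0 \<le> t \<Longrightarrow> exponent \<alpha> (ln r) t \<le> log_growth \<alpha> r"
    and "\<exists>t\<ge>0. exponent \<alpha> (ln r) t = log_growth \<alpha> r" by auto
qed

text \<open>After division by t it remains to compare t^(\<alpha>-1), which tends to 0 or to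
  infinity, with ln r. This supplies the right end of an interval on which the exponent passes
  through a range of intermediate values.\<close>

lemma exponent_eventually_neg:
  assumes \<alpha>: "\<alpha> \<in> {0<..<1} \<union> {1<..}" and r: "0 < r" "r \<in> radii \<alpha>"
  shows "\<forall>\<^sub>F t in at_top. exponent \<alpha> (ln r) t < 0"
proof (cases "\<alpha> < 1")
  case True
  then have "ln r < 0" using r by (simp add: radii_def)
  have "((\<lambda>t. t powr (\<alpha> - 1)) \<longlongrightarrow> 0) at_top"
    using True by (intro tendsto_neg_powr filterlim_ident) auto
  then have "\<forall>\<^sub>F t in at_top. t powr (\<alpha> - 1) < - ln r"
    using \<open>ln r < 0\<close> by (intro order_tendstoD) auto
  then show ?thesis
    using eventually_gt_at_top[of 0]
  proof eventually_elim
    case (elim t)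
    have "t powr \<alpha> = t * t powr (\<alpha> - 1)" using elim by (simp add: powr_diff)
    also have "\<dots> < t * (- ln r)" using elim by (intro mult_strict_left_mono) auto
    finally show ?case using True by (simp add: exponent_def coef_sign_def)
  qed
next
  case False
  have "filterlim (\<lambda>t::real. t powr (\<alpha> - 1)) at_top at_top"
    using False \<alpha> by real_asymp
  then have "\<forall>\<^sub>F t in at_top. ln r < t powr (\<alpha> - 1)"
    by (simp add: filterlim_at_top_dense)
  then show ?thesis
    using eventually_gt_at_top[of 0]
  proof eventually_elim
    case (elim t)
    have "t * ln r < t * t powr (\<alpha> - 1)" using elim by (intro mult_strict_left_mono) auto
    also have "\<dots> = t powr \<alpha>" using elim by (simp add: powr_diff)
    finally show ?case using False by (simp add: exponent_def coef_sign_def)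
  qed
qed

lemma continuous_on_exponent: "0 < \<alpha> \<Longrightarrow> continuous_on {0..} (exponent \<alpha> s)"
  unfolding exponent_def by (intro continuous_intros continuous_on_powr') auto

text \<open>The factor n^(1-\<alpha>) is exactly what makes the weight homogeneous: n^(1-\<alpha>) *
  k^\<alpha> = n * (k/n)^\<alpha>.\<close>

lemma coef_eq_exponent:
  assumes "0 < n"
  shows "weight \<alpha> n k * exp (real k * s)
    = exp (real n * exponent \<alpha> s (real k / real n))"
proof -
  have "real n * (real k / real n) powr \<alpha> = real n powr (1 - \<alpha>) * real k powr \<alpha>"
    using assms by (simp add: powr_divide powr_diff field_simps)
  then have "real n * exponent \<alpha> s (real k / real n) = real k * s + coef_sign \<alpha> * (real n powr (1 - \<alpha>) * real k powr \<alpha>)"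
    using assms by (simp add: exponent_def algebra_simps)
  then show ?thesis by (simp add: weight_def exp_add)
qed

lemma norm_coef_power:
  fixes z :: complex
  assumes "0 < n" "z \<noteq> 0"
  shows "norm (of_real (weight \<alpha> n k) * z ^ k)
    = exp (real n * exponent \<alpha> (ln (norm z)) (real k / real n))"
proof -
  have "norm z ^ k = exp (real k * ln (norm z))"
    using assms(2) by (simp add: exp_of_nat_mult)
  then show ?thesis using coef_eq_exponent[OF assms(1), of \<alpha> k "ln (norm z)"]
    by (simp add: norm_mult norm_power weight_def)
qed

section \<open>Convergence, holomorphy and upper bounds of the series\<close>

text \<open>Enlarging |z| by the factor exp(2 * \<epsilon>) gains exp(-2 * \<epsilon> * k): one half
  pays for the coefficient, the other is left as a geometric factor. The origin is separate because
  ln 0 = 0 would mislead the exponent.\<close>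

lemma H_term_bound:
  fixes a :: "nat \<Rightarrow> complex"
  assumes \<alpha>: "\<alpha> \<in> {0<..<1} \<union> {1<..}" and n: "0 < n" and \<epsilon>: "0 < \<epsilon>"
    and a: "norm (a k) \<le> C * exp (\<epsilon> * real k)" and z: "exp (2 * \<epsilon>) * norm z \<in> radii \<alpha>"
  shows "norm (a k * of_real (weight \<alpha> n k) * z ^ k)
    \<le> C * exp (real n * log_growth \<alpha> (exp (2 * \<epsilon>) * norm z)) * exp (- \<epsilon>) ^ k"
proof -
  have C: "0 \<le> C"
  proof -
    have "0 \<le> C * exp (\<epsilon> * real k)" by (rule order.trans[OF norm_ge_zero a])
    then show ?thesis by (simp add: zero_le_mult_iff not_le)
  qed
  have ek: "exp (- \<epsilon>) ^ k = exp (- (\<epsilon> * real k))" by (simp add: exp_of_nat_mult[symmetric] mult.commute)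
  show ?thesis
  proof (cases "z = 0")
    case True
    show ?thesis
    proof (cases "k = 0")
      case True
      then show ?thesis using \<open>z = 0\<close> a \<alpha> by (auto simp: weight_def)
    qed (use True C in \<open>simp add: zero_power\<close>)
  next
    case False
    define r where "r = exp (2 * \<epsilon>) * norm z"
    have r: "0 < r" "ln r = 2 * \<epsilon> + ln (norm z)" using False by (simp_all add: r_def ln_mult)
    have "real n * exponent \<alpha> (ln (norm z)) (real k / real n) = real n * exponent \<alpha> (ln r) (real k / real n) - 2 * \<epsilon> * real k"
      using n by (simp add: exponent_def r algebra_simps)
    also have "\<dots> \<le> real n * log_growth \<alpha> r - 2 * \<epsilon> * real k"
      using exponent_le_log_growth(1)[OF \<alpha> r(1), of "real k / real n"] z by (intro diff_right_mono mult_left_mono) (auto simp: r_def)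
    finally have le: "real n * exponent \<alpha> (ln (norm z)) (real k / real n) \<le> real n * log_growth \<alpha> r - 2 * \<epsilon> * real k" .
    have "norm (a k * of_real (weight \<alpha> n k) * z ^ k)
      = norm (a k) * exp (real n * exponent \<alpha> (ln (norm z)) (real k / real n))"
      by (simp only: mult.assoc norm_mult[of "a k"] norm_coef_power[OF n False])
    also have "\<dots> \<le> (C * exp (\<epsilon> * real k)) * exp (real n * log_growth \<alpha> r - 2 * \<epsilon> * real k)"
      using a le C by (intro mult_mono) auto
    also have "\<dots> = C * exp (real n * log_growth \<alpha> r) * exp (- (\<epsilon> * real k))"
      by (simp add: mult.assoc exp_add[symmetric] algebra_simps)
    finally show ?thesis by (simp add: ek r_def)
  qed
qed

lemma H_bound:
  assumes \<alpha>: "\<alpha> \<in> {0<..<1} \<union> {1<..}" and n: "0 < n" and \<epsilon>: "0 < \<epsilon>"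
    and a: "\<And>k. norm (a k) \<le> C * exp (\<epsilon> * real k)" and z: "exp (2 * \<epsilon>) * norm z \<in> radii \<alpha>"
  shows "summable (\<lambda>k. a k * of_real (weight \<alpha> n k) * z ^ k)"
    and "norm (H \<alpha> a n z) \<le> C / (1 - exp (- \<epsilon>)) * exp (real n * log_growth \<alpha> (exp (2 * \<epsilon>) * norm z))"
proof -
  let ?K = "C * exp (real n * log_growth \<alpha> (exp (2 * \<epsilon>) * norm z))"
  have s: "(\<lambda>k. ?K * exp (- \<epsilon>) ^ k) sums (?K * (1 / (1 - exp (- \<epsilon>))))"
    by (intro sums_mult geometric_sums) (use \<epsilon> in auto)
  have b: "norm (a k * of_real (weight \<alpha> n k) * z ^ k) \<le> ?K * exp (- \<epsilon>) ^ k" for k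
    by (rule H_term_bound[OF \<alpha> n \<epsilon> a z])
  show sm: "summable (\<lambda>k. a k * of_real (weight \<alpha> n k) * z ^ k)"
    by (rule summable_comparison_test'[OF sums_summable[OF s]]) (rule b)
  have "norm (H \<alpha> a n z) \<le> (\<Sum>k. ?K * exp (- \<epsilon>) ^ k)"
    unfolding H_eq by (rule norm_suminf_le[OF b sums_summable[OF s]])
  also have "\<dots> = C / (1 - exp (- \<epsilon>)) * exp (real n * log_growth \<alpha> (exp (2 * \<epsilon>) * norm z))"
    using s by (simp add: sums_iff)
  finally show "norm (H \<alpha> a n z) \<le> \<dots>" .
qed

text \<open>Equivalently, the k-th roots of |a_k| have limes superior at most 1.\<close>

definition subexp :: "(nat \<Rightarrow> complex) \<Rightarrow> bool" where
  "subexp a \<longleftrightarrow> (\<forall>\<epsilon>>0. \<exists>C. \<forall>k. norm (a k) \<le> C * exp (\<epsilon> * real k))"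

text \<open>Room outside a given circle. In the disc case the factor is r^(-1/2), so the new radius
  is the square root of r.\<close>

lemma radii_scale:
  assumes "r \<in> radii \<alpha>"
  obtains \<epsilon> where "0 < \<epsilon>" "exp (2 * \<epsilon>) * r \<in> radii \<alpha>"
proof (cases "\<alpha> < 1 \<and> 0 < r")
  case True
  then have "r < 1" using assms by (simp add: radii_def)
  then have "0 < - ln r / 4" using True by (simp add: divide_neg_pos)
  moreover have "exp (2 * (- ln r / 4)) * r \<in> radii \<alpha>"
  proof -
    have "exp (2 * (- ln r / 4)) * exp (ln r) = exp (ln r / 2)" by (simp add: exp_add[symmetric])
    moreover have "exp (ln r / 2) < 1" using True \<open>r < 1\<close> by simp
    ultimately show ?thesis using True by (simp add: radii_def)
  qed
  ultimately show ?thesis by (rule that)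
qed (use assms that[of 1] in \<open>auto simp: radii_def split: if_splits\<close>)

lemma norm_in_radii: "z \<in> H_domain \<alpha> \<longleftrightarrow> norm z \<in> radii \<alpha>"
  by (simp add: H_domain_def radii_def)

lemma H_summable:
  assumes \<alpha>: "\<alpha> \<in> {0<..<1} \<union> {1<..}" and n: "0 < n" and a: "subexp a" and z: "z \<in> H_domain \<alpha>"
  shows "summable (\<lambda>k. a k * of_real (weight \<alpha> n k) * z ^ k)"
proof -
  obtain \<epsilon> where \<epsilon>: "0 < \<epsilon>" "exp (2 * \<epsilon>) * norm z \<in> radii \<alpha>"
    using radii_scale z norm_in_radii by blast
  then obtain C where "\<And>k. norm (a k) \<le> C * exp (\<epsilon> * real k)" using a unfolding subexp_def by blast
  from H_bound(1)[where a = a, OF \<alpha> n \<epsilon>(1) this \<epsilon>(2)] show ?thesis .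
qed

lemma H_holomorphic:
  assumes \<alpha>: "\<alpha> \<in> {0<..<1} \<union> {1<..}" and n: "0 < n" and a: "subexp a"
  shows "H \<alpha> a n holomorphic_on H_domain \<alpha>"
proof -
  have ball: "H \<alpha> a n holomorphic_on ball 0 R" if "ball 0 R \<subseteq> H_domain \<alpha>" for R
  proof (rule power_series_holomorphic)
    fix w :: complex assume "w \<in> ball 0 R"
    then have "w \<in> H_domain \<alpha>" using that by blast
    from H_summable[OF \<alpha> n a this]
    show "(\<lambda>k. (a k * of_real (weight \<alpha> n k)) * (w - 0) ^ k) sums H \<alpha> a n w"
      unfolding H_eq by (simp add: summable_sums)
  qed
  show ?thesis
  proof (cases "\<alpha> < 1")
    case True
    then show ?thesis using ball[of 1] by (simp add: H_domain_def)
  next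
    case False
    show ?thesis
    proof (rule holomorphic_onI)
      fix z assume "z \<in> H_domain \<alpha>"
      have "H \<alpha> a n holomorphic_on ball 0 (norm z + 1)" by (rule ball) (use False in \<open>simp add: H_domain_def\<close>)
      then have "H \<alpha> a n field_differentiable at z"
        by (rule holomorphic_on_imp_differentiable_at) auto
      then show "H \<alpha> a n field_differentiable at z within H_domain \<alpha>"
        by (rule field_differentiable_at_within)
    qed
  qed
qed

text \<open>The order of the quantifiers matters: \<open>\<epsilon>\<close> is fixed before
  \<open>C\<close>, which is chosen later to bound the coefficients with high probability, and only
  the threshold \<open>N\<close> depends on \<open>C\<close>. Half of \<open>e\<close> pays for the
  enlarged radius by uniform continuity, half absorbs the constant C/(1 - exp(-\<epsilon>)).\<close>

lemma H_upper_bound: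
  assumes \<alpha>: "\<alpha> \<in> {0<..<1} \<union> {1<..}" and R: "0 < R" "R \<in> radii \<alpha>" and e: "0 < e"
  obtains \<epsilon> where "0 < \<epsilon>" "\<And>C. \<exists>N. \<forall>n\<ge>N. \<forall>a. (\<forall>k. norm (a k) \<le> C * exp (\<epsilon> * real k)) \<longrightarrow>
      (\<forall>z. norm z \<le> R \<longrightarrow> norm (H \<alpha> a n z) \<le> exp (real n * (log_growth \<alpha> (norm z) + e)))"
proof -
  obtain \<epsilon>1 where \<epsilon>1: "0 < \<epsilon>1" "exp (2 * \<epsilon>1) * R \<in> radii \<alpha>" using radii_scale[OF R(2)] by blast
  define R1 where "R1 = exp (2 * \<epsilon>1) * R"
  have sub: "{0..R1} \<subseteq> radii \<alpha>" using \<epsilon>1(2) by (auto simp: R1_def radii_def split: if_splits)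
  have "uniformly_continuous_on {0..R1} (log_growth \<alpha>)"
    by (intro compact_uniformly_continuous continuous_on_subset[OF continuous_on_log_growth[OF \<alpha>] sub]) auto
  then obtain d where d: "0 < d" "\<And>x y. x \<in> {0..R1} \<Longrightarrow> y \<in> {0..R1} \<Longrightarrow> dist y x < d \<Longrightarrow> dist (log_growth \<alpha> y) (log_growth \<alpha> x) < e / 2"
    using e unfolding uniformly_continuous_on_def by (meson half_gt_zero)
  have "((\<lambda>\<epsilon>. (exp (2 * \<epsilon>) - 1) * R) \<longlongrightarrow> (exp (2 * 0) - 1) * R) (at_right 0)"
    by (intro tendsto_intros)
  then have "\<forall>\<^sub>F \<epsilon> in at_right 0. (exp (2 * \<epsilon>) - 1) * R < d" using d(1) by (intro order_tendstoD) auto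
  moreover have "\<forall>\<^sub>F \<epsilon> in at_right 0. \<epsilon> \<in> {0<..<\<epsilon>1}" by (rule eventually_at_right_real[OF \<epsilon>1(1)])
  ultimately have "\<exists>\<epsilon>. (exp (2 * \<epsilon>) - 1) * R < d \<and> \<epsilon> \<in> {0<..<\<epsilon>1}"
    using eventually_happens'[OF trivial_limit_at_right_real eventually_conj] by blast
  then obtain \<epsilon> where \<epsilon>: "0 < \<epsilon>" "\<epsilon> < \<epsilon>1" "(exp (2 * \<epsilon>) - 1) * R < d" by auto
  show ?thesis
  proof (rule that[OF \<epsilon>(1)])
    fix C :: real
    define K where "K = max 1 (C / (1 - exp (- \<epsilon>)))"
    have K: "1 \<le> K" "C / (1 - exp (- \<epsilon>)) \<le> K" by (auto simp: K_def)
    obtain N :: nat where N: "max 0 (2 * ln K / e) < real N" using reals_Archimedean2 by blast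
    show "\<exists>N. \<forall>n\<ge>N. \<forall>a. (\<forall>k. norm (a k) \<le> C * exp (\<epsilon> * real k)) \<longrightarrow>
      (\<forall>z. norm z \<le> R \<longrightarrow> norm (H \<alpha> a n z) \<le> exp (real n * (log_growth \<alpha> (norm z) + e)))"
    proof (intro exI[of _ N] allI impI)
      fix n and a :: "nat \<Rightarrow> complex" and z :: complex assume n: "N \<le> n" and a: "\<forall>k. norm (a k) \<le> C * exp (\<epsilon> * real k)" and z: "norm z \<le> R"
      have n0: "0 < n" using N n by simp
      have "2 * ln K / e < real n" using N n by linarith
      then have "ln K \<le> real n * (e / 2)" using e by (simp add: pos_divide_less_eq mult.commute)
      then have "exp (ln K) \<le> exp (real n * (e / 2))" by simp
      then have Kn: "K \<le> exp (real n * (e / 2))" using K(1) by simp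
      define x where "x = exp (2 * \<epsilon>) * norm z"
      have e1: "1 \<le> exp (2 * \<epsilon>)" using \<epsilon> by simp
      have "x \<le> exp (2 * \<epsilon>1) * R" unfolding x_def using \<epsilon> z R by (intro mult_mono) auto
      then have x: "x \<in> {0..R1}" by (simp add: x_def R1_def)
      have xz: "norm z \<le> x" using e1 mult_right_mono[OF e1, of "norm z"] by (simp add: x_def)
      have "x - norm z = (exp (2 * \<epsilon>) - 1) * norm z" by (simp add: x_def algebra_simps)
      also have "\<dots> \<le> (exp (2 * \<epsilon>) - 1) * R" using z e1 by (intro mult_left_mono) auto
      finally have "dist x (norm z) < d" using xz \<epsilon>(3) by (simp add: dist_real_def)
      then have "dist (log_growth \<alpha> x) (log_growth \<alpha> (norm z)) < e / 2"
        using x xz by (intro d(2)) auto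
      then have J: "log_growth \<alpha> x \<le> log_growth \<alpha> (norm z) + e / 2" unfolding dist_real_def by linarith
      have "norm (H \<alpha> a n z) \<le> C / (1 - exp (- \<epsilon>)) * exp (real n * log_growth \<alpha> x)"
        using H_bound(2)[OF \<alpha> n0 \<epsilon>(1), of a C z] a subsetD[OF sub x] by (auto simp: x_def)
      also have "\<dots> \<le> exp (real n * (e / 2)) * exp (real n * (log_growth \<alpha> (norm z) + e / 2))"
        using K(2) Kn J by (intro mult_mono) (auto intro: mult_left_mono)
      also have "\<dots> = exp (real n * (log_growth \<alpha> (norm z) + e))"
        by (simp add: exp_add[symmetric] algebra_simps)
      finally show "norm (H \<alpha> a n z) \<le> exp (real n * (log_growth \<alpha> (norm z) + e))" .
    qed
  qed
qed

subsection \<open>Small ball probabilities\<close>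

text \<open>Deleting the terms inside the series, instead of subtracting them from its value, makes
  the independence from the coordinates in \<open>J\<close> hold without any assumption of
  convergence.\<close>

definition lacunary_sum :: "(nat \<Rightarrow> complex) \<Rightarrow> nat set \<Rightarrow> (nat \<Rightarrow> complex) \<Rightarrow> complex" where
  "lacunary_sum b J x = (\<Sum>k. if k \<in> J then 0 else b k * x k)"

lemma lacunary_sum_upd: "k \<in> J \<Longrightarrow> lacunary_sum b J (x(k := c)) = lacunary_sum b J x"
  unfolding lacunary_sum_def by (intro arg_cong[where f = suminf]) auto

lemma lacunary_sum_measurable [measurable]:
  "lacunary_sum b J \<in> borel_measurable (Pi\<^sub>M UNIV (\<lambda>_::nat. borel))"
  unfolding lacunary_sum_def[abs_def] by measurable

lemma lacunary_sum_eq: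
  assumes s: "summable (\<lambda>k. b k * x k)" and J: "finite J"
  shows "lacunary_sum b J x = (\<Sum>k. b k * x k) - (\<Sum>k\<in>J. b k * x k)"
proof -
  have "(\<lambda>k. b k * x k - (if k \<in> J then b k * x k else 0)) sums ((\<Sum>k. b k * x k) - (\<Sum>k\<in>J. b k * x k))"
    by (intro sums_diff summable_sums s sums_If_finite_set J)
  moreover have "(\<lambda>k. b k * x k - (if k \<in> J then b k * x k else 0)) = (\<lambda>k. if k \<in> J then 0 else b k * x k)"
    by auto
  ultimately show ?thesis unfolding lacunary_sum_def by (simp add: sums_iff)
qed

context prob_space
begin

text \<open>Neither \<open>P\<close> nor \<open>f\<close> depends on the coordinate
  \<open>k\<close>. Once all other variables are frozen, the second condition asks
  \<open>\<xi> k\<close> to lie in a fixed ball, which has probability at most q; Tonelli over the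
  independent rest gives the product.\<close>

lemma indep_ball_bound:
  fixes \<xi> :: "nat \<Rightarrow> 'a \<Rightarrow> complex"
  assumes indep: "indep_vars (\<lambda>_. borel) \<xi> UNIV"
    and P [measurable]: "Measurable.pred (Pi\<^sub>M UNIV (\<lambda>_::nat. borel)) P"
    and f [measurable]: "f \<in> borel_measurable (Pi\<^sub>M UNIV (\<lambda>_::nat. borel))"
    and P_upd: "\<And>x c. P (x(k := c)) = P x" and f_upd: "\<And>x c. f (x(k := c)) = f x"
    and q: "\<And>x. prob {\<omega>\<in>space M. norm (\<xi> k \<omega> - x) \<le> \<eta>} \<le> q"
  shows "prob {\<omega>\<in>space M. P (\<lambda>i. \<xi> i \<omega>) \<and> norm (\<xi> k \<omega> - f (\<lambda>i. \<xi> i \<omega>)) \<le> \<eta>} \<le> q * prob {\<omega>\<in>space M. P (\<lambda>i. \<xi> i \<omega>)}"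
proof -
  have \<xi>m [measurable]: "random_variable borel (\<xi> i)" for i using indep by (simp add: indep_vars_def)
  have q0: "0 \<le> q" by (rule order.trans[OF measure_nonneg q])
  let ?T = "Pi\<^sub>M (- {k}) (\<lambda>_::nat. borel :: complex measure)"
  let ?S = "Pi\<^sub>M {k} (\<lambda>_::nat. borel :: complex measure)"
  define X where "X \<omega> = restrict (\<lambda>i. \<xi> i \<omega>) {k}" for \<omega>
  define Y where "Y \<omega> = restrict (\<lambda>i. \<xi> i \<omega>) (- {k})" for \<omega>
  have "indep_var ?S X ?T Y"
    unfolding X_def[abs_def] Y_def[abs_def] by (rule indep_var_restrict[OF indep]) auto
  then have Xm [measurable]: "random_variable ?S X" and Ym [measurable]: "random_variable ?T Y"
    and D: "distr M ?S X \<Otimes>\<^sub>M distr M ?T Y = distr M (?S \<Otimes>\<^sub>M ?T) (\<lambda>\<omega>. (X \<omega>, Y \<omega>))"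
    by (simp_all add: indep_var_distribution_eq)
  \<comment> \<open>The missing coordinate is filled with 0, a choice that \<open>P\<close> and
    \<open>f\<close> cannot see.\<close>
  define L where "L y = y(k := 0 :: complex)" for y :: "nat \<Rightarrow> complex"
  have Lm [measurable]: "L \<in> ?T \<rightarrow>\<^sub>M Pi\<^sub>M UNIV (\<lambda>_. borel)"
    unfolding L_def[abs_def] by (rule measurable_fun_upd[where J = "- {k}"]) auto
  have LY: "P (L (Y \<omega>)) = P (\<lambda>i. \<xi> i \<omega>)" "f (L (Y \<omega>)) = f (\<lambda>i. \<xi> i \<omega>)" for \<omega>
  proof -
    have "L (Y \<omega>) = (\<lambda>i. \<xi> i \<omega>)(k := 0)" by (auto simp: L_def Y_def)
    then show "P (L (Y \<omega>)) = P (\<lambda>i. \<xi> i \<omega>)" "f (L (Y \<omega>)) = f (\<lambda>i. \<xi> i \<omega>)" using P_upd f_upd by auto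
  qed
  define A where "A = {p \<in> space (?S \<Otimes>\<^sub>M ?T). P (L (snd p)) \<and> norm (fst p k - f (L (snd p))) \<le> \<eta>}"
  have Am [measurable]: "A \<in> sets (?S \<Otimes>\<^sub>M ?T)" unfolding A_def by measurable
  interpret DX: prob_space "distr M ?S X" by (rule prob_space_distr) measurable
  interpret DY: prob_space "distr M ?T Y" by (rule prob_space_distr) measurable
  interpret DXY: pair_sigma_finite "distr M ?S X" "distr M ?T Y" ..
  have "emeasure M {\<omega>\<in>space M. P (\<lambda>i. \<xi> i \<omega>) \<and> norm (\<xi> k \<omega> - f (\<lambda>i. \<xi> i \<omega>)) \<le> \<eta>}
    = emeasure (distr M (?S \<Otimes>\<^sub>M ?T) (\<lambda>\<omega>. (X \<omega>, Y \<omega>))) A"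
  proof (subst emeasure_distr)
    show "emeasure M {\<omega>\<in>space M. P (\<lambda>i. \<xi> i \<omega>) \<and> norm (\<xi> k \<omega> - f (\<lambda>i. \<xi> i \<omega>)) \<le> \<eta>}
      = emeasure M ((\<lambda>\<omega>. (X \<omega>, Y \<omega>)) -` A \<inter> space M)"
      using measurable_space[OF Ym] measurable_space[OF Xm]
      by (intro arg_cong[where f = "emeasure M"]) (auto simp: A_def LY space_pair_measure X_def)
  qed measurable
  also have "\<dots> = (\<integral>\<^sup>+y. emeasure (distr M ?S X) ((\<lambda>x. (x, y)) -` A) \<partial>distr M ?T Y)"
    unfolding D[symmetric] by (rule DXY.emeasure_pair_measure_alt2) simp
  also have "\<dots> \<le> (\<integral>\<^sup>+y. ennreal q * indicator {y\<in>space ?T. P (L y)} y \<partial>distr M ?T Y)"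
  proof (rule nn_integral_mono)
    fix y assume "y \<in> space (distr M ?T Y)"
    then have y: "y \<in> space ?T" by simp
    show "emeasure (distr M ?S X) ((\<lambda>x. (x, y)) -` A) \<le> ennreal q * indicator {y\<in>space ?T. P (L y)} y"
    proof (cases "P (L y)")
      case True
      then have "(\<lambda>x. (x, y)) -` A = {x\<in>space ?S. norm (x k - f (L y)) \<le> \<eta>}" using y by (auto simp: A_def space_pair_measure)
      moreover have "{x\<in>space ?S. norm (x k - f (L y)) \<le> \<eta>} \<in> sets ?S" by measurable
      moreover have "X -` {x\<in>space ?S. norm (x k - f (L y)) \<le> \<eta>} \<inter> space M = {\<omega>\<in>space M. norm (\<xi> k \<omega> - f (L y)) \<le> \<eta>}"
        using measurable_space[OF Xm] by (auto simp: X_def)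
      ultimately have "emeasure (distr M ?S X) ((\<lambda>x. (x, y)) -` A) = ennreal (prob {\<omega>\<in>space M. norm (\<xi> k \<omega> - f (L y)) \<le> \<eta>})"
        by (simp add: emeasure_distr emeasure_eq_measure)
      then show ?thesis using True y q by (simp add: ennreal_leI)
    next
      case False
      then have "(\<lambda>x. (x, y)) -` A = {}" by (auto simp: A_def)
      then show ?thesis by simp
    qed
  qed
  also have "\<dots> = ennreal q * emeasure (distr M ?T Y) {y\<in>space ?T. P (L y)}"
    by (rule nn_integral_cmult_indicator) simp
  also have "emeasure (distr M ?T Y) {y\<in>space ?T. P (L y)} = emeasure M {\<omega>\<in>space M. P (\<lambda>i. \<xi> i \<omega>)}"
    using measurable_space[OF Ym]
    by (subst emeasure_distr) (auto simp: LY intro!: arg_cong[where f = "emeasure M"])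
  finally show ?thesis
    using q0 by (simp add: emeasure_eq_measure ennreal_mult'[symmetric])
qed

text \<open>For j < l the index \<open>ks l\<close> differs from \<open>ks j\<close> and is deleted
  from the j-th lacunary sum. So the first l conditions ignore the variable at \<open>ks l\<close>,
  while the next one confines it to a ball whose centre ignores it too.\<close>

lemma successive_ball_bound:
  fixes \<xi> :: "nat \<Rightarrow> 'a \<Rightarrow> complex"
  assumes indep: "indep_vars (\<lambda>_. borel) \<xi> UNIV"
    and q: "\<And>k x. prob {\<omega>\<in>space M. norm (\<xi> k \<omega> - x) \<le> \<eta>} \<le> q"
    and ks: "inj_on ks {..<m}" "\<And>j. j < m \<Longrightarrow> b (ks j) \<noteq> 0"
  shows "l \<le> m \<Longrightarrow> prob {\<omega>\<in>space M. \<forall>j<l. norm (b (ks j) * \<xi> (ks j) \<omega> + lacunary_sum b (ks ` {j..<m}) (\<lambda>i. \<xi> i \<omega>))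
      \<le> \<eta> * norm (b (ks j))} \<le> q ^ l"
proof (induction l)
  case 0
  then show ?case by simp
next
  case (Suc l)
  have q0: "0 \<le> q" using order.trans[OF measure_nonneg q] .
  define P where "P x \<longleftrightarrow> (\<forall>j<l. norm (b (ks j) * x (ks j) + lacunary_sum b (ks ` {j..<m}) x) \<le> \<eta> * norm (b (ks j)))"
    for x :: "nat \<Rightarrow> complex"
  define f where "f x = - lacunary_sum b (ks ` {l..<m}) x / b (ks l)" for x
  have bl: "b (ks l) \<noteq> 0" using Suc.prems ks by simp
  have eq: "norm (y - f x) \<le> \<eta> \<longleftrightarrow> norm (b (ks l) * y + lacunary_sum b (ks ` {l..<m}) x) \<le> \<eta> * norm (b (ks l))" for x y
  proof -
    have "b (ks l) * y + lacunary_sum b (ks ` {l..<m}) x = b (ks l) * (y - f x)"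
      using bl by (simp add: f_def field_simps)
    then show ?thesis using bl by (simp add: norm_mult mult.commute)
  qed
  have "prob {\<omega>\<in>space M. \<forall>j<Suc l. norm (b (ks j) * \<xi> (ks j) \<omega> + lacunary_sum b (ks ` {j..<m}) (\<lambda>i. \<xi> i \<omega>)) \<le> \<eta> * norm (b (ks j))}
    = prob {\<omega>\<in>space M. P (\<lambda>i. \<xi> i \<omega>) \<and> norm (\<xi> (ks l) \<omega> - f (\<lambda>i. \<xi> i \<omega>)) \<le> \<eta>}"
    unfolding eq P_def by (intro arg_cong[where f = prob]) (auto simp: less_Suc_eq)
  also have "\<dots> \<le> q * prob {\<omega>\<in>space M. P (\<lambda>i. \<xi> i \<omega>)}"
  proof (rule indep_ball_bound[OF indep _ _ _ _ q])
    show "Measurable.pred (Pi\<^sub>M UNIV (\<lambda>_::nat. borel)) P" unfolding P_def[abs_def] by measurable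
    show "f \<in> borel_measurable (Pi\<^sub>M UNIV (\<lambda>_::nat. borel))" unfolding f_def[abs_def] by measurable
    show "f (x(ks l := c)) = f x" for x c
      using Suc.prems unfolding f_def by (subst lacunary_sum_upd) auto
    show "P (x(ks l := c)) = P x" for x c
    proof -
      have "ks j \<noteq> ks l" "ks l \<in> ks ` {j..<m}" if "j < l" for j
        using that Suc.prems inj_on_eq_iff[OF ks(1), of j l] by auto
      then show ?thesis unfolding P_def by (auto simp: lacunary_sum_upd)
    qed
  qed
  also have "\<dots> \<le> q * q ^ l"
    using Suc q0 unfolding P_def by (intro mult_left_mono) auto
  finally show ?case by simp
qed

text \<open>If the weights at the indices \<open>ks 0, ks 1, \<dots>\<close> decay fast, a small value of the whole sum confines the
  variables at these indices, one after the other, to balls of radius \<open>\<eta>\<close>.\<close>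

lemma small_ball_probability:
  fixes \<xi> :: "nat \<Rightarrow> 'a \<Rightarrow> complex"
  assumes indep: "indep_vars (\<lambda>_. borel) \<xi> UNIV"
    and q: "\<And>k x. prob {\<omega>\<in>space M. norm (\<xi> k \<omega> - x) \<le> \<eta>} \<le> q"
    and ks: "inj_on ks {..<m}" "\<And>j. j < m \<Longrightarrow> b (ks j) \<noteq> 0"
    and sm: "AE \<omega> in M. summable (\<lambda>k. b k * \<xi> k \<omega>)"
    and B: "0 \<le> B" and r: "\<And>j. j < m \<Longrightarrow> r + B * (\<Sum>i\<in>{j<..<m}. norm (b (ks i))) \<le> \<eta> * norm (b (ks j))"
  shows "prob {\<omega>\<in>space M. norm (\<Sum>k. b k * \<xi> k \<omega>) \<le> r} \<le> q ^ m + (\<Sum>j<m. prob {\<omega>\<in>space M. B < norm (\<xi> (ks j) \<omega>)})"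
proof -
  have \<xi>m [measurable]: "random_variable borel (\<xi> i)" for i using indep by (simp add: indep_vars_def)
  have \<xi>m' [measurable]: "(\<lambda>\<omega> i. \<xi> i \<omega>) \<in> M \<rightarrow>\<^sub>M Pi\<^sub>M UNIV (\<lambda>_::nat. borel)"
    by (rule measurable_PiM_single') auto
  define E where "E = {\<omega>\<in>space M. \<forall>j<m. norm (b (ks j) * \<xi> (ks j) \<omega> + lacunary_sum b (ks ` {j..<m}) (\<lambda>i. \<xi> i \<omega>))
      \<le> \<eta> * norm (b (ks j))}"
  define L where "L j = {\<omega>\<in>space M. B < norm (\<xi> (ks j) \<omega>)}" for j
  have lm: "(\<lambda>\<omega>. lacunary_sum b J (\<lambda>i. \<xi> i \<omega>)) \<in> borel_measurable M" for J
    by (rule measurable_compose[OF \<xi>m' lacunary_sum_measurable])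
  note lm [measurable]
  have [measurable]: "E \<in> events" "L j \<in> events" for j unfolding E_def L_def by measurable
  have "prob {\<omega>\<in>space M. norm (\<Sum>k. b k * \<xi> k \<omega>) \<le> r} \<le> prob (E \<union> (\<Union>j\<in>{..<m}. L j))"
  proof (rule finite_measure_mono_AE)
    show "AE \<omega> in M. \<omega> \<in> {\<omega>\<in>space M. norm (\<Sum>k. b k * \<xi> k \<omega>) \<le> r} \<longrightarrow> \<omega> \<in> E \<union> (\<Union>j\<in>{..<m}. L j)"
      using sm AE_space
    proof eventually_elim
      case (elim \<omega>)
      show ?case
      proof (intro impI)
        assume "\<omega> \<in> {\<omega>\<in>space M. norm (\<Sum>k. b k * \<xi> k \<omega>) \<le> r}"
        then have small: "norm (\<Sum>k. b k * \<xi> k \<omega>) \<le> r" by simp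
        show "\<omega> \<in> E \<union> (\<Union>j\<in>{..<m}. L j)"
        proof (cases "\<exists>j<m. B < norm (\<xi> (ks j) \<omega>)")
          case True
          then show ?thesis using elim(2) by (auto simp: L_def)
        next
          case False
          have "norm (b (ks j) * \<xi> (ks j) \<omega> + lacunary_sum b (ks ` {j..<m}) (\<lambda>i. \<xi> i \<omega>)) \<le> \<eta> * norm (b (ks j))"
            if j: "j < m" for j
          proof -
            have inj: "inj_on ks {j..<m}" using ks(1) by (rule inj_on_subset) auto
            have split: "{j..<m} = insert j {j<..<m}" using j by auto
            have "(\<Sum>k\<in>ks ` {j..<m}. b k * \<xi> k \<omega>) = (\<Sum>i\<in>{j..<m}. b (ks i) * \<xi> (ks i) \<omega>)"
              by (simp add: sum.reindex[OF inj])
            also have "\<dots> = b (ks j) * \<xi> (ks j) \<omega> + (\<Sum>i\<in>{j<..<m}. b (ks i) * \<xi> (ks i) \<omega>)"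
              unfolding split by simp
            \<comment> \<open>The j-th deleted sum with its leading term restored is the full sum
              minus the terms of later index, and both are small: the first by assumption, the
              second by the bound B and the decay of the weights.\<close>
            finally have "b (ks j) * \<xi> (ks j) \<omega> + lacunary_sum b (ks ` {j..<m}) (\<lambda>i. \<xi> i \<omega>)
              = (\<Sum>k. b k * \<xi> k \<omega>) - (\<Sum>i\<in>{j<..<m}. b (ks i) * \<xi> (ks i) \<omega>)"
              using lacunary_sum_eq[of b "\<lambda>i. \<xi> i \<omega>" "ks ` {j..<m}"] elim(1) by simp
            also have "norm \<dots> \<le> norm (\<Sum>k. b k * \<xi> k \<omega>) + norm (\<Sum>i\<in>{j<..<m}. b (ks i) * \<xi> (ks i) \<omega>)"
              by (rule norm_triangle_ineq4)
            also have "\<dots> \<le> r + (\<Sum>i\<in>{j<..<m}. B * norm (b (ks i)))"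
            proof (intro add_mono small sum_norm_le)
              fix i assume "i \<in> {j<..<m}"
              then have "norm (\<xi> (ks i) \<omega>) \<le> B" using False by auto
              then show "norm (b (ks i) * \<xi> (ks i) \<omega>) \<le> B * norm (b (ks i))"
                by (simp add: norm_mult mult.commute[of B] mult_left_mono)
            qed
            also have "\<dots> = r + B * (\<Sum>i\<in>{j<..<m}. norm (b (ks i)))" by (simp add: sum_distrib_left)
            finally show ?thesis using r[OF j] by simp
          qed
          then show ?thesis using elim(2) by (simp add: E_def)
        qed
      qed
    qed
  qed measurable
  also have "\<dots> \<le> prob E + prob (\<Union>j\<in>{..<m}. L j)" by (rule measure_Un_le) measurable
  also have "\<dots> \<le> q ^ m + (\<Sum>j<m. prob (L j))"
  proof (intro add_mono measure_UNION_le)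
    show "prob E \<le> q ^ m"
      unfolding E_def by (rule successive_ball_bound[where \<eta> = \<eta> and q = q, OF indep _ ks(1)]) (use q ks(2) in auto)
  qed auto
  finally show ?thesis by (simp add: L_def)
qed

section \<open>Consequences of nondegeneracy and of the logarithmic moment\<close>

text \<open>Otherwise there are balls with radii tending to 0 and probabilities tending to 1. Any
  two of them meet, so their centres form a Cauchy sequence, and the variable equals the limit
  almost surely.\<close>

lemma nondegenerate_ball_bound:
  fixes X :: "'a \<Rightarrow> complex"
  assumes [measurable]: "random_variable borel X" and nd: "\<not> (\<exists>c. AE \<omega> in M. X \<omega> = c)"
  obtains \<eta> q where "0 < \<eta>" "0 \<le> q" "q < 1" "\<And>x. prob {\<omega>\<in>space M. norm (X \<omega> - x) \<le> \<eta>} \<le> q"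
proof (rule ccontr)
  assume no: "\<not> thesis"
  let ?\<eta> = "\<lambda>i::nat. 1 / real (Suc i)"
  \<comment> \<open>The shift by 3 makes every probability exceed 2/3, so two such balls cannot be
    disjoint.\<close>
  have "\<exists>x. prob {\<omega>\<in>space M. norm (X \<omega> - x) \<le> ?\<eta> i} > 1 - 1 / real (i + 3)" for i
  proof (rule ccontr)
    assume "\<not> ?thesis"
    then have "prob {\<omega>\<in>space M. norm (X \<omega> - x) \<le> ?\<eta> i} \<le> 1 - 1 / real (i + 3)" for x by (auto simp: not_less)
    then show False using no that[of "?\<eta> i" "1 - 1 / real (i + 3)"] by auto
  qed
  then obtain x where x: "prob {\<omega>\<in>space M. norm (X \<omega> - x i) \<le> ?\<eta> i} > 1 - 1 / real (i + 3)" for i by metis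
  let ?B = "\<lambda>i. {\<omega>\<in>space M. norm (X \<omega> - x i) \<le> ?\<eta> i}"
  have close: "norm (x i - x j) \<le> ?\<eta> i + ?\<eta> j" for i j
  proof -
    have "1 / real (i + 3) \<le> 1 / 3" "1 / real (j + 3) \<le> 1 / 3" by (auto simp: field_simps)
    then have "1 < prob (?B i) + prob (?B j)" using x[of i] x[of j] by linarith
    moreover have "prob (?B i) + prob (?B j) \<le> 1" if "?B i \<inter> ?B j = {}"
      by (subst finite_measure_Union[symmetric]) (use that in auto)
    ultimately obtain \<omega> where "\<omega> \<in> ?B i" "\<omega> \<in> ?B j" by fastforce
    then show ?thesis using norm_triangle_ineq4[of "X \<omega> - x j" "X \<omega> - x i"] by auto
  qed
  have "Cauchy x"
  proof (rule metric_CauchyI)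
    fix e :: real assume e: "0 < e"
    obtain N where N: "1 / real (Suc N) < e / 2" using e nat_approx_posE[of "e / 2"] by auto
    have "?\<eta> i < e / 2" if "N \<le> i" for i
    proof -
      have "?\<eta> i \<le> ?\<eta> N" using that by (intro divide_left_mono) auto
      then show ?thesis using N by linarith
    qed
    then have "dist (x i) (x j) < e" if "N \<le> i" "N \<le> j" for i j
      using close[of i j] that unfolding dist_norm by (smt (verit) field_sum_of_halves)
    then show "\<exists>M. \<forall>m\<ge>M. \<forall>n\<ge>M. dist (x m) (x n) < e" by blast
  qed
  then obtain c where c: "x \<longlonglongrightarrow> c" using Cauchy_convergent_iff convergent_def by blast
  have lim: "norm (x i - c) \<le> ?\<eta> i" for i
  proof -
    have "(\<lambda>j. norm (x i - x j)) \<longlonglongrightarrow> norm (x i - c)" by (intro tendsto_intros c)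
    moreover have "(\<lambda>j. ?\<eta> i + ?\<eta> j) \<longlonglongrightarrow> ?\<eta> i + 0"
      by (intro tendsto_intros) (rule LIMSEQ_Suc[OF lim_1_over_n, unfolded o_def])
    ultimately show ?thesis using close by (intro LIMSEQ_le[where X = "\<lambda>j. norm (x i - x j)" and Y = "\<lambda>j. ?\<eta> i + ?\<eta> j"]) auto
  qed
  have "prob {\<omega>\<in>space M. norm (X \<omega> - c) \<le> 2 * ?\<eta> k} = 1" for k
  proof -
    have "1 - 1 / real (i + 3) \<le> prob {\<omega>\<in>space M. norm (X \<omega> - c) \<le> 2 * ?\<eta> k}" if "k \<le> i" for i
    proof -
      have "?B i \<subseteq> {\<omega>\<in>space M. norm (X \<omega> - c) \<le> 2 * ?\<eta> k}"
      proof safe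
        fix \<omega> assume "norm (X \<omega> - x i) \<le> ?\<eta> i"
        then have "norm (X \<omega> - c) \<le> ?\<eta> i + ?\<eta> i"
          using norm_triangle_ineq[of "X \<omega> - x i" "x i - c"] lim[of i] by simp
        also have "?\<eta> i \<le> ?\<eta> k" using that by (intro divide_left_mono) auto
        finally show "norm (X \<omega> - c) \<le> 2 * ?\<eta> k" using that by (auto simp: field_simps)
      qed
      then have "prob (?B i) \<le> prob {\<omega>\<in>space M. norm (X \<omega> - c) \<le> 2 * ?\<eta> k}"
        by (intro finite_measure_mono) measurable
      then show ?thesis using x[of i] by linarith
    qed
    moreover have "(\<lambda>i. 1 - 1 / real (i + 3)) \<longlonglongrightarrow> 1 - 0"
      by (intro tendsto_intros) (rule LIMSEQ_ignore_initial_segment[OF lim_1_over_n])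
    ultimately have "1 \<le> prob {\<omega>\<in>space M. norm (X \<omega> - c) \<le> 2 * ?\<eta> k}"
      by (intro LIMSEQ_le_const2[of "\<lambda>i. 1 - 1 / real (i + 3)"]) auto
    then show ?thesis using prob_le_1 by (intro antisym) auto
  qed
  then have "AE \<omega> in M. norm (X \<omega> - c) \<le> 2 * ?\<eta> k" for k
    using prob_eq_1[of "{\<omega>\<in>space M. norm (X \<omega> - c) \<le> 2 * ?\<eta> k}"] by (auto elim: eventually_mono)
  then have "AE \<omega> in M. \<forall>k. norm (X \<omega> - c) \<le> 2 * ?\<eta> k" by (simp add: AE_all_countable)
  then have "AE \<omega> in M. X \<omega> = c"
  proof eventually_elim
    case (elim \<omega>)
    have "(\<lambda>k. 2 * ?\<eta> k) \<longlonglongrightarrow> 2 * 0"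
      by (intro tendsto_intros) (rule LIMSEQ_Suc[OF lim_1_over_n, unfolded o_def])
    then have "norm (X \<omega> - c) \<le> 2 * 0" using elim by (intro LIMSEQ_le_const) auto
    then show ?case by simp
  qed
  then show False using nd by blast
qed

text \<open>Borel-Cantelli: by equality of the distributions, the probabilities that ln(1 + |xi_k|)
  exceeds \<epsilon> * k sum to at most E[ln(1 + |xi_0|)]/\<epsilon> + 1.\<close>

lemma AE_subexp:
  fixes \<xi> :: "nat \<Rightarrow> 'a \<Rightarrow> complex"
  assumes [measurable]: "\<And>k. random_variable borel (\<xi> k)"
    and id: "\<And>k. distr M borel (\<xi> k) = distr M borel (\<xi> 0)"
    and int: "integrable M (\<lambda>\<omega>. ln (1 + norm (\<xi> 0 \<omega>)))"
  shows "AE \<omega> in M. subexp (\<lambda>k. \<xi> k \<omega>)"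
proof -
  have main: "AE \<omega> in M. \<exists>C. \<forall>k. norm (\<xi> k \<omega>) \<le> C * exp (\<epsilon> * real k)" if \<epsilon>: "0 < \<epsilon>" for \<epsilon> :: real
  proof -
    define X where "X \<omega> = ln (1 + norm (\<xi> 0 \<omega>))" for \<omega>
    have [measurable]: "X \<in> borel_measurable M" unfolding X_def by measurable
    have X0: "0 \<le> X \<omega>" for \<omega> by (simp add: X_def)
    define A where "A k = {\<omega>\<in>space M. \<epsilon> * real k < ln (1 + norm (\<xi> k \<omega>))}" for k
    have [measurable]: "A k \<in> events" for k unfolding A_def by measurable
    have PA: "prob (A k) = prob {\<omega>\<in>space M. \<epsilon> * real k < X \<omega>}" for k
    proof -
      let ?S = "{z::complex. \<epsilon> * real k < ln (1 + norm z)}"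
      have S: "?S \<in> sets borel" by measurable
      have "prob (A k) = measure (distr M borel (\<xi> k)) ?S"
        using S by (subst measure_distr) (auto simp: A_def intro!: arg_cong[where f = prob])
      also have "\<dots> = measure (distr M borel (\<xi> 0)) ?S" by (simp add: id[of k])
      also have "\<dots> = prob {\<omega>\<in>space M. \<epsilon> * real k < X \<omega>}"
        using S by (subst measure_distr) (auto simp: X_def intro!: arg_cong[where f = prob])
      finally show ?thesis .
    qed
    \<comment> \<open>The sum counts the k \<ge> 0 with \<epsilon> * k < X; the summand 1 is for k =
      0.\<close>
    have count: "(\<Sum>k. indicator {\<omega>\<in>space M. \<epsilon> * real k < X \<omega>} \<omega> :: ennreal) \<le> ennreal (X \<omega> / \<epsilon> + 1)" for \<omega>
    proof (rule suminf_le_const)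
      fix n
      have "(\<Sum>k<n. indicator {\<omega>\<in>space M. \<epsilon> * real k < X \<omega>} \<omega> :: ennreal) \<le> (\<Sum>k<n. indicator {..nat \<lfloor>X \<omega> / \<epsilon>\<rfloor>} k)"
      proof (rule sum_mono)
        fix k
        have "k \<le> nat \<lfloor>X \<omega> / \<epsilon>\<rfloor>" if "\<epsilon> * real k < X \<omega>"
        proof -
          have "real k < X \<omega> / \<epsilon>" using that \<epsilon> by (simp add: pos_less_divide_eq mult.commute)
          then show ?thesis by linarith
        qed
        then show "(indicator {\<omega>\<in>space M. \<epsilon> * real k < X \<omega>} \<omega> :: ennreal) \<le> indicator {..nat \<lfloor>X \<omega> / \<epsilon>\<rfloor>} k"
          by (auto simp: indicator_def)
      qed
      also have "\<dots> = (\<Sum>k\<in>{..<n} \<inter> {..nat \<lfloor>X \<omega> / \<epsilon>\<rfloor>}. 1)"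
        unfolding sum.inter_restrict[OF finite_lessThan] by (intro sum.cong) (auto simp: indicator_def)
      also have "\<dots> \<le> (\<Sum>k\<in>{..nat \<lfloor>X \<omega> / \<epsilon>\<rfloor>}. 1)" by (rule sum_mono2) auto
      also have "\<dots> = ennreal (real (nat \<lfloor>X \<omega> / \<epsilon>\<rfloor>) + 1)"
        by (simp add: ennreal_of_nat_eq_real_of_nat add.commute)
      also have "\<dots> \<le> ennreal (X \<omega> / \<epsilon> + 1)"
        using X0[of \<omega>] \<epsilon> by (intro ennreal_leI) (simp add: of_nat_floor)
      finally show "(\<Sum>k<n. indicator {\<omega>\<in>space M. \<epsilon> * real k < X \<omega>} \<omega> :: ennreal) \<le> ennreal (X \<omega> / \<epsilon> + 1)" .
    qed simp
    have "(\<Sum>k. ennreal (prob (A k))) = (\<Sum>k. (\<integral>\<^sup>+\<omega>. indicator {\<omega>\<in>space M. \<epsilon> * real k < X \<omega>} \<omega> \<partial>M))"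
      by (simp add: PA emeasure_eq_measure[symmetric])
    also have "\<dots> = (\<integral>\<^sup>+\<omega>. (\<Sum>k. indicator {\<omega>\<in>space M. \<epsilon> * real k < X \<omega>} \<omega>) \<partial>M)"
      by (rule nn_integral_suminf[symmetric]) measurable
    also have "\<dots> \<le> (\<integral>\<^sup>+\<omega>. ennreal (X \<omega> / \<epsilon> + 1) \<partial>M)"
      by (rule nn_integral_mono) (rule count)
    also have "\<dots> = ennreal (expectation (\<lambda>\<omega>. X \<omega> / \<epsilon> + 1))"
      using int X0 \<epsilon> by (intro nn_integral_eq_integral) (auto simp: X_def[abs_def] intro!: add_nonneg_nonneg divide_nonneg_pos)
    finally have "(\<Sum>k. ennreal (prob (A k))) \<noteq> top" by (auto simp: top_unique)
    then have "summable (\<lambda>k. prob (A k))" by (intro summable_suminf_not_top) auto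
    then have "AE \<omega> in M. eventually (\<lambda>k. \<omega> \<in> space M - A k) sequentially"
      by (intro borel_cantelli_AE1) (auto simp: emeasure_eq_measure)
    then show ?thesis
    proof eventually_elim
      case (elim \<omega>)
      then obtain N where N: "\<And>k. N \<le> k \<Longrightarrow> \<omega> \<in> space M - A k" by (auto simp: eventually_sequentially)
      define C where "C = Max (insert 1 ((\<lambda>k. norm (\<xi> k \<omega>)) ` {..N}))"
      have C: "1 \<le> C" "\<And>k. k \<le> N \<Longrightarrow> norm (\<xi> k \<omega>) \<le> C" unfolding C_def by (intro Max_ge; auto)+
      have "norm (\<xi> k \<omega>) \<le> C * exp (\<epsilon> * real k)" for k
      proof (cases "k \<le> N")
        case True
        have "C * 1 \<le> C * exp (\<epsilon> * real k)" using C(1) \<epsilon> by (intro mult_left_mono) auto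
        then show ?thesis using C(2)[OF True] by simp
      next
        case False
        then have "ln (1 + norm (\<xi> k \<omega>)) \<le> \<epsilon> * real k" using N[of k] by (auto simp: A_def not_less)
        then have "exp (ln (1 + norm (\<xi> k \<omega>))) \<le> exp (\<epsilon> * real k)" by simp
        moreover have "exp (ln (1 + norm (\<xi> k \<omega>))) = 1 + norm (\<xi> k \<omega>)" by (rule exp_ln) (simp add: add_pos_nonneg)
        ultimately have "norm (\<xi> k \<omega>) \<le> 1 * exp (\<epsilon> * real k)" by simp
        also have "\<dots> \<le> C * exp (\<epsilon> * real k)" using C(1) by (intro mult_right_mono) auto
        finally show ?thesis .
      qed
      then show ?case by blast
    qed
  qed
  \<comment> \<open>Countably many values of \<open>\<epsilon>\<close> tending to 0 suffice, so the
    exceptional null sets can be united.\<close>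
  have "AE \<omega> in M. \<forall>i::nat. \<exists>C. \<forall>k. norm (\<xi> k \<omega>) \<le> C * exp (1 / real (Suc i) * real k)"
    unfolding AE_all_countable by (intro allI main) simp
  then show ?thesis
  proof eventually_elim
    case (elim \<omega>)
    show ?case
      unfolding subexp_def
    proof (intro allI impI)
      fix \<epsilon> :: real assume "0 < \<epsilon>"
      then obtain i where i: "1 / real (Suc i) < \<epsilon>" using nat_approx_posE by auto
      obtain C where C: "\<And>k. norm (\<xi> k \<omega>) \<le> C * exp (1 / real (Suc i) * real k)" using elim by blast
      have "0 \<le> C" using order.trans[OF norm_ge_zero C[of 0]] by simp
      have "norm (\<xi> k \<omega>) \<le> C * exp (\<epsilon> * real k)" for k
      proof -
        have "1 / real (Suc i) * real k \<le> \<epsilon> * real k"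
          using i by (intro mult_right_mono) (simp_all del: of_nat_Suc)
        then have "C * exp (1 / real (Suc i) * real k) \<le> C * exp (\<epsilon> * real k)"
          using \<open>0 \<le> C\<close> by (intro mult_left_mono) (simp_all del: of_nat_Suc)
        then show ?thesis using C[of k] by linarith
      qed
      then show "\<exists>C. \<forall>k. norm (\<xi> k \<omega>) \<le> C * exp (\<epsilon> * real k)" by blast
    qed
  qed
qed

end

subsection \<open>Convergence of the potentials and of the zeros\<close>

text \<open>Preimages change only by subsets of null sets, which the completion contains. It serves
  random integrals that are known only almost surely as limits of measurable functions.\<close>

lemma measurable_completion_of_AE_eq:
  fixes f g :: "'a \<Rightarrow> real"
  assumes g: "g \<in> borel_measurable M" and ae: "AE x in M. f x = g x"
  shows "f \<in> borel_measurable (completion M)"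
proof (rule measurableI)
  fix A :: "real set" assume A: "A \<in> sets borel"
  have "AE x in completion M. x \<in> g -` A \<inter> space M \<longleftrightarrow> x \<in> f -` A \<inter> space M"
    using AE_completion[OF ae] by eventually_elim simp
  moreover have "g -` A \<inter> space M \<in> sets (completion M)" using measurable_sets[OF g A] by simp
  moreover have "f -` A \<inter> space M \<subseteq> space (completion M)" by simp
  ultimately have "f -` A \<inter> space M \<in> sets (completion M)" by (rule completion.in_sets_AE)
  then show "f -` A \<inter> space (completion M) \<in> sets (completion M)" by simp
qed simp

locale iid_coefficients = prob_space M for M :: "'w measure" +
  fixes \<xi> :: "nat \<Rightarrow> 'w \<Rightarrow> complex" and \<alpha> :: real
  assumes \<alpha>: "\<alpha> \<in> {0<..<1} \<union> {1<..}"
    and indep: "indep_vars (\<lambda>_. borel) \<xi> UNIV"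
    and identical: "\<And>k. distr M borel (\<xi> k) = distr M borel (\<xi> 0)"
    and nondegenerate: "\<not> (\<exists>c. AE \<omega> in M. \<xi> 0 \<omega> = c)"
    and log_moment: "integrable M (\<lambda>\<omega>. ln (1 + norm (\<xi> 0 \<omega>)))"
begin

lemma measurable_\<xi> [measurable]: "random_variable borel (\<xi> k)"
  using indep by (simp add: indep_vars_def)

abbreviation HH :: "nat \<Rightarrow> 'w \<Rightarrow> complex \<Rightarrow> complex" where
  "HH n \<omega> \<equiv> H \<alpha> (\<lambda>k. \<xi> k \<omega>) n"

lemma measurable_HH: "(\<lambda>(\<omega>, z). HH n \<omega> z) \<in> borel_measurable (M \<Otimes>\<^sub>M borel)"
  unfolding H_eq case_prod_beta by measurable

lemma measurable_HH1 [measurable]: "(\<lambda>\<omega>. HH n \<omega> z) \<in> borel_measurable M"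
  unfolding H_eq by measurable

lemma measurable_HH2 [measurable]: "HH n \<omega> \<in> borel_measurable borel"
  unfolding H_eq[abs_def] by measurable

lemma prob_eq:
  assumes [measurable]: "S \<in> sets borel"
  shows "prob {\<omega>\<in>space M. \<xi> k \<omega> \<in> S} = prob {\<omega>\<in>space M. \<xi> 0 \<omega> \<in> S}"
proof -
  have "prob {\<omega>\<in>space M. \<xi> k \<omega> \<in> S} = measure (distr M borel (\<xi> k)) S" for k
    by (subst measure_distr) (auto intro!: arg_cong[where f = prob])
  then show ?thesis using identical[of k] by simp
qed

lemma AE_coefficients_subexp: "AE \<omega> in M. subexp (\<lambda>k. \<xi> k \<omega>)"
  by (rule AE_subexp[where \<xi> = \<xi>]) (use identical log_moment in auto)

text \<open>Tightness of a single variable, transferred to all indices by equality of the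
  distributions.\<close>

lemma tail_small:
  assumes e: "0 < e"
  obtains B where "0 \<le> B" "\<And>k. prob {\<omega>\<in>space M. B < norm (\<xi> k \<omega>)} < e"
proof -
  let ?A = "\<lambda>i::nat. {\<omega>\<in>space M. real i < norm (\<xi> 0 \<omega>)}"
  have "(\<lambda>i. prob (?A i)) \<longlonglongrightarrow> prob (\<Inter>i. ?A i)"
    by (rule finite_Lim_measure_decseq) (auto simp: decseq_def)
  moreover have "(\<Inter>i. ?A i) = {}"
  proof safe
    fix \<omega> assume "\<omega> \<in> (\<Inter>i. ?A i)"
    then have "real i < norm (\<xi> 0 \<omega>)" for i by auto
    then show "\<omega> \<in> {}" using reals_Archimedean2[of "norm (\<xi> 0 \<omega>)"] by (meson less_asym)
  qed
  ultimately have "(\<lambda>i. prob (?A i)) \<longlonglongrightarrow> 0" by simp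
  then have "\<forall>\<^sub>F i in sequentially. prob (?A i) < e" using e by (rule order_tendstoD)
  then obtain i where i: "prob (?A i) < e" by (auto simp: eventually_sequentially)
  show ?thesis
  proof (rule that[of "real i"])
    show "prob {\<omega>\<in>space M. real i < norm (\<xi> k \<omega>)} < e" for k
      using prob_eq[of "{z. real i < norm z}" k] i by simp
  qed simp
qed

text \<open>The exponent starts from its maximum I and later becomes negative, so it attains m
  equally spaced levels just below I. Indices k with k/n near the corresponding points carry weights
  that differ by factors exponential in n, which beat every constant in the small ball estimate. The
  choices are made in the order m, B, \<theta>, n.\<close>

lemma H_lower_bound:
  assumes c: "c \<noteq> 0" "c \<in> H_domain \<alpha>" and e: "0 < e" and \<tau>: "0 < \<tau>"
  shows "\<forall>\<^sub>F n in sequentially.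
    prob {\<omega>\<in>space M. norm (HH n \<omega> c) < exp (real n * (log_growth \<alpha> (norm c) - e))} \<le> \<tau>"
proof -
  obtain \<eta> q where \<eta>: "0 < \<eta>" "0 \<le> q" "q < 1" "\<And>x. prob {\<omega>\<in>space M. norm (\<xi> 0 \<omega> - x) \<le> \<eta>} \<le> q"
    by (rule nondegenerate_ball_bound[OF measurable_\<xi> nondegenerate]) (rule that; assumption)
  have q: "prob {\<omega>\<in>space M. norm (\<xi> k \<omega> - x) \<le> \<eta>} \<le> q" for k x
    using prob_eq[of "{z. norm (z - x) \<le> \<eta>}" k] \<eta>(4)[of x] by simp
  have "(\<lambda>m. q ^ m) \<longlonglongrightarrow> 0" using \<eta> by (intro LIMSEQ_power_zero) auto
  then have "\<forall>\<^sub>F m in sequentially. q ^ m < \<tau> / 2" using \<tau> by (intro order_tendstoD) auto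
  then obtain m where m: "q ^ m < \<tau> / 2" by (auto simp: eventually_sequentially)
  have \<tau>m: "0 < \<tau> / 2 / (real m + 1)" using \<tau> by simp
  obtain B where B: "0 \<le> B" "\<And>k. prob {\<omega>\<in>space M. B < norm (\<xi> k \<omega>)} < \<tau> / 2 / (real m + 1)"
    using tail_small[OF \<tau>m] by blast
  define s where "s = ln (norm c)"
  define I where "I = log_growth \<alpha> (norm c)"
  let ?g = "exponent \<alpha> s"
  have r: "0 < norm c" "norm c \<in> radii \<alpha>" using c by (auto simp: norm_in_radii)
  obtain t0 where t0: "0 \<le> t0" "?g t0 = I"
    using exponent_le_log_growth(2)[OF \<alpha> r] unfolding s_def I_def by auto
  have "\<forall>\<^sub>F t in at_top. ?g t < 0 \<and> t0 < t"
    using exponent_eventually_neg[OF \<alpha> r] eventually_gt_at_top[of t0] unfolding s_def by eventually_elim auto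
  \<comment> \<open>Since I is nonnegative, \<open>t1\<close> lies strictly below the maximal level
    and bounds the interval for the intermediate value theorem.\<close>
  then obtain t1 where t1: "?g t1 < 0" "t0 < t1" by (auto simp: eventually_at_top_linorder)
  have I0: "?g t1 < I" using t1(1) log_growth_nonneg[of \<alpha> "norm c"] unfolding I_def by linarith
  \<comment> \<open>The spacing of the levels: (m+1) * \<theta> is small enough to keep them above I
    - e/2 and above the value at \<open>t1\<close>.\<close>
  define \<theta> where "\<theta> = min (e / 2) ((I - ?g t1) / 2) / (real m + 1)"
  have \<theta>: "0 < \<theta>" "(real m + 1) * \<theta> = min (e / 2) ((I - ?g t1) / 2)"
    using e I0 by (auto simp: \<theta>_def)
  define v where "v j = I - (real j + 1) * \<theta>" for j
  have vb: "I - e / 2 \<le> v j" "?g t1 \<le> v j" "v j \<le> I" if "j < m" for j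
  proof -
    have "(real j + 1) * \<theta> \<le> (real m + 1) * \<theta>" using that \<theta>(1) by (intro mult_right_mono) auto
    then show "I - e / 2 \<le> v j" "?g t1 \<le> v j" using \<theta>(2) I0 by (auto simp: v_def min_def split: if_splits)
    show "v j \<le> I" using \<theta>(1) by (simp add: v_def)
  qed
  have gc: "continuous_on {0..} ?g" using \<alpha> by (intro continuous_on_exponent) auto
  have "\<exists>t\<ge>0. ?g t = v j" if "j < m" for j
  proof -
    have "\<exists>t\<ge>t0. t \<le> t1 \<and> ?g t = v j"
      by (rule IVT2') (use vb[OF that] t0 t1 in \<open>auto intro: continuous_on_subset[OF gc]\<close>)
    then show ?thesis using t0(1) by (meson order.trans)
  qed
  then obtain t where t: "\<And>j. j < m \<Longrightarrow> 0 \<le> t j \<and> ?g (t j) = v j" by metis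
  define k where "k n j = nat \<lfloor>real n * t j\<rfloor>" for n j
  have klim: "(\<lambda>n. ?g (real (k n j) / real n)) \<longlonglongrightarrow> v j" if j: "j < m" for j
  proof -
    have "(\<lambda>n. real (k n j) / real n) \<longlonglongrightarrow> t j"
    proof (rule tendsto_sandwich)
      show "\<forall>\<^sub>F n in sequentially. t j - 1 / real n \<le> real (k n j) / real n"
        using eventually_gt_at_top[of 0]
      proof eventually_elim
        case (elim n)
        have "real n * t j - 1 \<le> real (k n j)" unfolding k_def by linarith
        then have "(real n * t j - 1) / real n \<le> real (k n j) / real n" by (intro divide_right_mono) auto
        then show ?case using elim by (simp add: diff_divide_distrib)
      qed
      show "\<forall>\<^sub>F n in sequentially. real (k n j) / real n \<le> t j"
        using eventually_gt_at_top[of 0]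
      proof eventually_elim
        case (elim n)
        have "real (k n j) \<le> real n * t j" unfolding k_def using t[OF j] by (intro of_nat_floor) auto
        then show ?case using elim by (simp add: pos_divide_le_eq mult.commute)
      qed
      have "(\<lambda>n. t j - 1 / real n) \<longlonglongrightarrow> t j - 0" by (intro tendsto_intros lim_1_over_n)
      then show "(\<lambda>n. t j - 1 / real n) \<longlonglongrightarrow> t j" by simp
    qed simp
    then have "(\<lambda>n. ?g (real (k n j) / real n)) \<longlonglongrightarrow> ?g (t j)"
      by (rule continuous_on_tendsto_compose[OF gc]) (use t[OF j] in auto)
    then show ?thesis using t[OF j] by simp
  qed
  have "\<forall>\<^sub>F n in sequentially. dist (?g (real (k n j) / real n)) (v j) < \<theta> / 4" if "j < m" for j
    using klim[OF that] \<theta>(1) by (intro tendstoD) auto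
  then have ev1: "\<forall>\<^sub>F n in sequentially. \<forall>j\<in>{..<m}. dist (?g (real (k n j) / real n)) (v j) < \<theta> / 4"
    by (intro eventually_ball_finite) auto
  have "filterlim (\<lambda>n. exp (real n * (\<theta> / 2))) at_top sequentially"
    using \<theta>(1) by (intro filterlim_compose[OF exp_at_top] filterlim_tendsto_pos_mult_at_top[OF _ _ filterlim_real_sequentially]
        filterlim_at_top_mult_tendsto_pos[OF tendsto_const]) (auto simp: filterlim_real_sequentially)
  then have ev2: "\<forall>\<^sub>F n in sequentially. (1 + real m * B) / \<eta> \<le> exp (real n * (\<theta> / 2))"
    by (simp add: filterlim_at_top)
  show ?thesis
    using ev1 ev2 eventually_gt_at_top[of 0]
  proof eventually_elim
    case (elim n)
    have n: "0 < n" by fact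
    define b where "b k = of_real (weight \<alpha> n k) * c ^ k" for k
    have nb: "norm (b k) = exp (real n * ?g (real k / real n))" for k
      unfolding b_def s_def by (rule norm_coef_power[OF n c(1)])
    have near: "v j - \<theta> / 4 < ?g (real (k n j) / real n)" "?g (real (k n j) / real n) < v j + \<theta> / 4" if "j < m" for j
    proof -
      have "dist (?g (real (k n j) / real n)) (v j) < \<theta> / 4" using elim(1) that by auto
      then have "\<bar>?g (real (k n j) / real n) - v j\<bar> < \<theta> / 4" by (simp only: dist_real_def)
      then show "v j - \<theta> / 4 < ?g (real (k n j) / real n)" "?g (real (k n j) / real n) < v j + \<theta> / 4" by linarith+
    qed
    have gap: "v i \<le> v j - \<theta>" if "j < i" for i j
    proof -
      have "(real j + 1) * \<theta> + \<theta> \<le> (real i + 1) * \<theta>"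
        using mult_right_mono[of "real j + 2" "real i + 1" \<theta>] that \<theta>(1) by (simp add: algebra_simps)
      then show ?thesis by (simp add: v_def)
    qed
    have inj: "inj_on (k n) {..<m}"
    proof (rule linorder_inj_onI)
      fix i j assume ij: "i < j" "i \<in> {..<m}" "j \<in> {..<m}"
      have "?g (real (k n j) / real n) < ?g (real (k n i) / real n)"
        using near(2)[of j] near(1)[of i] gap[OF ij(1)] ij \<theta>(1) by auto
      then show "k n i \<noteq> k n j" by auto
    qed auto
    have Heq: "HH n \<omega> c = (\<Sum>k. b k * \<xi> k \<omega>)" for \<omega>
      unfolding H_eq b_def by (intro arg_cong[where f = suminf]) (simp add: fun_eq_iff mult_ac)
    have sm: "AE \<omega> in M. summable (\<lambda>k. b k * \<xi> k \<omega>)"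
      using AE_coefficients_subexp
    proof eventually_elim
      case (elim \<omega>)
      from H_summable[OF \<alpha> n elim c(2)] show ?case unfolding b_def by (simp add: mult_ac)
    qed
    have bound: "exp (real n * (I - e)) + B * (\<Sum>i\<in>{j<..<m}. norm (b (k n i))) \<le> \<eta> * norm (b (k n j))" if j: "j < m" for j
    proof -
      \<comment> \<open>With errors of \<theta>/4, lighter weights are at most \<open>w\<close> and
        the j-th one is at least exp(n * \<theta>/2) * w. This gap absorbs (1 + m *
        B)/\<eta>.\<close>
      define w where "w = exp (real n * (v j - 3 * \<theta> / 4))"
      have "I - e \<le> v j - 3 * \<theta> / 4"
      proof -
        have "\<theta> \<le> (real m + 1) * \<theta>" using \<theta>(1) by simp
        then have "\<theta> \<le> e / 2" using \<theta>(2) by linarith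
        then show ?thesis using vb(1)[OF j] \<theta>(1) by linarith
      qed
      then have 1: "exp (real n * (I - e)) \<le> w" unfolding w_def by (simp add: mult_left_mono)
      have "norm (b (k n i)) \<le> w" if i: "i \<in> {j<..<m}" for i
      proof -
        have "?g (real (k n i) / real n) \<le> v j - 3 * \<theta> / 4"
          using near(2)[of i] gap[of j i] i by auto
        then show ?thesis unfolding nb w_def by (simp add: mult_left_mono)
      qed
      then have "(\<Sum>i\<in>{j<..<m}. norm (b (k n i))) \<le> real (card {j<..<m}) * w"
        by (rule sum_bounded_above)
      also have "\<dots> \<le> real m * w" by (intro mult_right_mono) (auto simp: w_def)
      finally have 2: "B * (\<Sum>i\<in>{j<..<m}. norm (b (k n i))) \<le> B * (real m * w)" using B(1) by (rule mult_left_mono)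
      have "exp (real n * (I - e)) + B * (\<Sum>i\<in>{j<..<m}. norm (b (k n i))) \<le> (1 + real m * B) * w"
        using 1 2 by (simp add: algebra_simps)
      also have "\<dots> \<le> (\<eta> * exp (real n * (\<theta> / 2))) * w"
        using elim(2) \<eta>(1) by (intro mult_right_mono) (auto simp: w_def pos_divide_le_eq mult.commute)
      also have "\<dots> = \<eta> * exp (real n * (v j - \<theta> / 4))"
        by (simp add: w_def mult.assoc exp_add[symmetric] algebra_simps)
      also have "\<dots> \<le> \<eta> * norm (b (k n j))"
        unfolding nb using near(1)[OF j] \<eta>(1) by (intro mult_left_mono) (auto intro: mult_left_mono)
      finally show ?thesis .
    qed
    have "prob {\<omega>\<in>space M. norm (HH n \<omega> c) < exp (real n * (log_growth \<alpha> (norm c) - e))}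
      \<le> prob {\<omega>\<in>space M. norm (\<Sum>k. b k * \<xi> k \<omega>) \<le> exp (real n * (I - e))}"
      unfolding Heq[symmetric] I_def by (intro finite_measure_mono) auto
    also have "\<dots> \<le> q ^ m + (\<Sum>j<m. prob {\<omega>\<in>space M. B < norm (\<xi> (k n j) \<omega>)})"
      by (rule small_ball_probability[where \<eta> = \<eta>, OF indep _ inj _ sm B(1)]) (use q bound c in \<open>auto simp: b_def weight_def\<close>)
    also have "\<dots> \<le> q ^ m + (\<Sum>j<m. \<tau> / 2 / (real m + 1))"
      using B(2) by (intro add_left_mono sum_mono less_imp_le)
    also have "(\<Sum>j<m. \<tau> / 2 / (real m + 1)) \<le> \<tau> / 2"
      using \<tau> by (simp add: field_simps)
    finally show ?case using m by linarith
  qed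
qed

text \<open>Continuity from above turns the random constant in the growth bound into a deterministic
  one, at the price of a small exceptional event.\<close>

lemma coefficients_bounded_prob:
  assumes "0 < \<epsilon>" "0 < \<tau>"
  obtains C where "prob {\<omega>\<in>space M. \<not> (\<forall>k. norm (\<xi> k \<omega>) \<le> C * exp (\<epsilon> * real k))} \<le> \<tau>"
proof -
  let ?A = "\<lambda>i::nat. {\<omega>\<in>space M. \<not> (\<forall>k. norm (\<xi> k \<omega>) \<le> real i * exp (\<epsilon> * real k))}"
  have mono: "norm (\<xi> k \<omega>) \<le> real j * exp (\<epsilon> * real k)" if "norm (\<xi> k \<omega>) \<le> real i * exp (\<epsilon> * real k)" "i \<le> j" for i j k \<omega>
    using that by (meson exp_ge_zero mult_right_mono of_nat_mono order.trans)
  have "(\<lambda>i. prob (?A i)) \<longlonglongrightarrow> prob (\<Inter>i. ?A i)"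
    by (rule finite_Lim_measure_decseq) (use mono in \<open>auto simp: decseq_def\<close>, blast)
  moreover have "prob (\<Inter>i. ?A i) = 0"
  proof -
    have "AE \<omega> in M. \<omega> \<notin> (\<Inter>i. ?A i)"
      using AE_coefficients_subexp
    proof eventually_elim
      case (elim \<omega>)
      then obtain C where C: "\<And>k. norm (\<xi> k \<omega>) \<le> C * exp (\<epsilon> * real k)" using assms(1) unfolding subexp_def by blast
      obtain i :: nat where "C \<le> real i" using real_arch_simple by blast
      then have "norm (\<xi> k \<omega>) \<le> real i * exp (\<epsilon> * real k)" for k
        using C[of k] by (meson exp_ge_zero mult_right_mono order.trans)
      then show ?case by blast
    qed
    then show ?thesis by (subst prob_eq_0) auto
  qed
  ultimately have "(\<lambda>i. prob (?A i)) \<longlonglongrightarrow> 0" by simp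
  then have "\<forall>\<^sub>F i in sequentially. prob (?A i) < \<tau>" using assms(2) by (rule order_tendstoD)
  then obtain i where "prob (?A i) < \<tau>" by (auto simp: eventually_sequentially)
  then show ?thesis using that[of "real i"] by simp
qed

text \<open>Two failures form the event \<open>A\<close>: an excessive coefficient, or too small a
  value at some grid point. Off \<open>A\<close> the estimate is deterministic. The almost sure
  condition \<open>subexp\<close> stays apart and is discharged in the completion at the
  end.\<close>

lemma log_potential_tendsto:
  assumes \<phi>: "continuous_on UNIV \<phi>" "\<And>z. norm z > R0 \<Longrightarrow> \<phi> z = 0" and r: "0 < r"
    and R: "0 < R" "R \<in> radii \<alpha>" "R0 + 2 * r < R" and e: "0 < e" and \<tau>: "0 < \<tau>"
  shows "\<forall>\<^sub>F n in sequentially. \<exists>A\<in>events. prob A \<le> \<tau> \<and> (\<forall>\<omega>\<in>space M - A. subexp (\<lambda>k. \<xi> k \<omega>) \<longrightarrow>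
    \<bar>(\<integral>z. ln (norm (HH n \<omega> z)) * tent_laplacian \<phi> r z \<partial>lborel) / real n - (\<integral>a. tent_conv \<phi> r a * limit_density \<alpha> a \<partial>lborel)\<bar> \<le> e)"
proof -
  define \<Psi> where "\<Psi> = tent_laplacian \<phi> r"
  have \<Psi>c: "continuous_on UNIV \<Psi>" unfolding \<Psi>_def by (rule continuous_on_tent_laplacian[OF \<phi> r])
  have \<Psi>0: "\<Psi> z = 0" if "norm z > R" for z
    unfolding \<Psi>_def by (rule tent_laplacian_eq_0[OF \<phi>(2) r]) (use that R in auto)
  have [measurable]: "\<Psi> \<in> borel_measurable borel" using \<Psi>c by (rule borel_measurable_continuous_onI)
  obtain B where B: "0 < B" "\<And>z. \<bar>\<Psi> z\<bar> \<le> B" using bounded_compact_support[OF \<Psi>c \<Psi>0] by blast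
  define U where "U z = log_growth \<alpha> (norm z)" for z :: complex
  have [measurable]: "U \<in> borel_measurable borel" unfolding U_def by measurable
  obtain \<epsilon>0 where \<epsilon>0: "0 < \<epsilon>0" "exp (2 * \<epsilon>0) * R \<in> radii \<alpha>" using radii_scale[OF R(2)] by blast
  define R1 where "R1 = exp (2 * \<epsilon>0) * R"
  have R1: "R < R1" "R1 \<in> radii \<alpha>" "0 < R1" using \<epsilon>0 R by (auto simp: R1_def)
  have Uc: "continuous_on (cball 0 R1) U" unfolding U_def by (rule continuous_on_log_growth_norm[OF \<alpha> R1(2)])
  \<comment> \<open>Chosen so that the L^1 bound times the supremum \<open>B\<close> of the kernel
    is exactly \<open>e\<close>.\<close>
  define \<epsilon> where "\<epsilon> = e / (B * (109 * pi * R\<^sup>2))"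
  have \<epsilon>: "0 < \<epsilon>" "B * (109 * pi * R\<^sup>2 * \<epsilon>) = e" using e B R by (auto simp: \<epsilon>_def)
  have Un: "0 \<le> U z" for z by (simp add: U_def log_growth_nonneg)
  have Um: "U \<in> borel_measurable borel" by measurable
  obtain C where C: "finite C" "C \<subseteq> cball 0 R1 - {0}"
    and L1: "\<forall>G D n. G holomorphic_on D \<and> open D \<and> connected D \<and> cball 0 R1 \<subseteq> D \<and> G \<in> borel_measurable borel \<and> 0 < n \<and>
      (\<forall>z. norm z \<le> R1 \<longrightarrow> norm (G z) \<le> exp (n * (U z + \<epsilon>))) \<and> (\<forall>c\<in>C. exp (n * (U c - \<epsilon>)) \<le> norm (G c)) \<longrightarrow>
      set_integrable lborel (cball 0 R) (\<lambda>z. ln (norm (G z)) / n - U z) \<and>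
      (LINT z:cball 0 R|lborel. \<bar>ln (norm (G z)) / n - U z\<bar>) \<le> 109 * pi * R\<^sup>2 * \<epsilon>"
    by (rule L1_close_of_pointwise[OF R(1) R1(1) Uc Un Um \<epsilon>(1)])
  obtain \<delta> where \<delta>: "0 < \<delta>" and up: "\<And>C. \<exists>N. \<forall>n\<ge>N. \<forall>a. (\<forall>k. norm (a k) \<le> C * exp (\<delta> * real k)) \<longrightarrow>
      (\<forall>z. norm z \<le> R1 \<longrightarrow> norm (H \<alpha> a n z) \<le> exp (real n * (log_growth \<alpha> (norm z) + \<epsilon>)))"
    using H_upper_bound[OF \<alpha> R1(3,2) \<epsilon>(1)] by blast
  have \<tau>2: "0 < \<tau> / 2" using \<tau> by simp
  obtain K where K: "prob {\<omega>\<in>space M. \<not> (\<forall>k. norm (\<xi> k \<omega>) \<le> K * exp (\<delta> * real k))} \<le> \<tau> / 2"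
    by (rule coefficients_bounded_prob[OF \<delta> \<tau>2])
  obtain N where N: "\<And>n a z. N \<le> n \<Longrightarrow> (\<forall>k. norm (a k) \<le> K * exp (\<delta> * real k)) \<Longrightarrow> norm z \<le> R1 \<Longrightarrow>
      norm (H \<alpha> a n z) \<le> exp (real n * (U z + \<epsilon>))" using up[of K] unfolding U_def by blast
  define \<tau>' where "\<tau>' = \<tau> / 2 / (real (card C) + 1)"
  have \<tau>': "0 < \<tau>'" using \<tau> by (simp add: \<tau>'_def)
  have CD: "c \<noteq> 0 \<and> c \<in> H_domain \<alpha>" if "c \<in> C" for c
    using C(2) that radii_pos_D(2)[OF R1(2)] by blast
  have "\<forall>\<^sub>F n in sequentially. \<forall>c\<in>C. prob {\<omega>\<in>space M. norm (HH n \<omega> c) < exp (real n * (U c - \<epsilon>))} \<le> \<tau>'"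
    unfolding U_def using CD by (intro eventually_ball_finite C(1) ballI H_lower_bound \<epsilon>(1) \<tau>') auto
  then show ?thesis
    using eventually_ge_at_top[of N] eventually_gt_at_top[of 0]
  proof eventually_elim
    case (elim n)
    define A1 where "A1 = {\<omega>\<in>space M. \<not> (\<forall>k. norm (\<xi> k \<omega>) \<le> K * exp (\<delta> * real k))}"
    define A2 where "A2 c = {\<omega>\<in>space M. norm (HH n \<omega> c) < exp (real n * (U c - \<epsilon>))}" for c
    have [measurable]: "A1 \<in> events" "A2 c \<in> events" for c unfolding A1_def A2_def by measurable
    show ?case
    proof (intro bexI[of _ "A1 \<union> (\<Union>c\<in>C. A2 c)"] conjI ballI impI)
      have "prob (A1 \<union> (\<Union>c\<in>C. A2 c)) \<le> prob A1 + prob (\<Union>c\<in>C. A2 c)"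
        using C(1) by (intro measure_Un_le) auto
      also have "\<dots> \<le> \<tau> / 2 + (\<Sum>c\<in>C. prob (A2 c))"
        using K C(1) by (intro add_mono measure_UNION_le) (auto simp: A1_def)
      also have "(\<Sum>c\<in>C. prob (A2 c)) \<le> (\<Sum>c\<in>C. \<tau>')" by (rule sum_mono) (use elim(1) in \<open>auto simp: A2_def\<close>)
      also have "(\<Sum>c\<in>C. \<tau>') \<le> \<tau> / 2" using \<tau> by (simp add: \<tau>'_def field_simps)
      finally show "prob (A1 \<union> (\<Union>c\<in>C. A2 c)) \<le> \<tau>" by simp
      show "A1 \<union> (\<Union>c\<in>C. A2 c) \<in> events" by (intro sets.Un sets.finite_UN C(1)) auto
      fix \<omega> assume \<omega>: "\<omega> \<in> space M - (A1 \<union> (\<Union>c\<in>C. A2 c))" and sub: "subexp (\<lambda>k. \<xi> k \<omega>)"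
      define u where "u z = ln (norm (HH n \<omega> z)) / real n - U z" for z
      have "set_integrable lborel (cball 0 R) u \<and> (LINT z:cball 0 R|lborel. \<bar>u z\<bar>) \<le> 109 * pi * R\<^sup>2 * \<epsilon>"
        unfolding u_def
      proof (rule L1[rule_format, of _ "H_domain \<alpha>"], intro conjI allI impI ballI)
        show "HH n \<omega> holomorphic_on H_domain \<alpha>" by (rule H_holomorphic[OF \<alpha> elim(3) sub])
        show "open (H_domain \<alpha>)" "connected (H_domain \<alpha>)" by (auto simp: H_domain_def)
        show "cball 0 R1 \<subseteq> H_domain \<alpha>" by (rule radii_pos_D(2)[OF R1(2)])
        show "0 < real n" using elim(3) by simp
        show "norm (HH n \<omega> z) \<le> exp (real n * (U z + \<epsilon>))" if "norm z \<le> R1" for z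
          by (rule N[OF elim(2) _ that]) (use \<omega> in \<open>auto simp: A1_def\<close>)
        show "exp (real n * (U c - \<epsilon>)) \<le> norm (HH n \<omega> c)" if "c \<in> C" for c
          using \<omega> that by (auto simp: A2_def not_less)
      qed simp
      then have ui: "integrable lborel (\<lambda>z. indicator (cball 0 R) z * u z)"
        and ul: "(\<integral>z. indicator (cball 0 R) z * \<bar>u z\<bar> \<partial>lborel) \<le> 109 * pi * R\<^sup>2 * \<epsilon>"
        by (auto simp: set_integrable_def set_lebesgue_integral_def)
      have uabs: "integrable lborel (\<lambda>z. indicator (cball 0 R) z * \<bar>u z\<bar>)"
        using integrable_abs[OF ui] by (simp add: abs_mult)
      have [measurable]: "u \<in> borel_measurable borel" unfolding u_def by measurable
      have \<Psi>b: "\<bar>u z * \<Psi> z\<bar> \<le> B * (indicator (cball 0 R) z * \<bar>u z\<bar>)" for z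
        using B(2)[of z] \<Psi>0[of z] by (cases "norm z \<le> R") (auto simp: abs_mult mult.commute[of B] intro!: mult_left_mono)
      have u\<Psi>: "integrable lborel (\<lambda>z. u z * \<Psi> z)"
        by (rule Bochner_Integration.integrable_bound[OF integrable_mult_right[OF uabs, of B]])
           (use \<Psi>b in \<open>auto intro!: AE_I2 intro: order.trans[OF \<Psi>b abs_ge_self]\<close>)
      have U\<Psi>: "integrable lborel (\<lambda>z. U z * \<Psi> z)"
      proof -
        have "integrable lborel (\<lambda>z. indicator (cball 0 R) z *\<^sub>R (U z * \<Psi> z))"
          by (rule borel_integrable_compact)
             (use R1 in \<open>auto intro!: continuous_intros continuous_on_subset[OF Uc] continuous_on_subset[OF \<Psi>c]\<close>)
        moreover have "indicator (cball 0 R) z *\<^sub>R (U z * \<Psi> z) = U z * \<Psi> z" for z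
          using \<Psi>0[of z] by (auto simp: indicator_def)
        ultimately show ?thesis by (simp only:)
      qed
      have "(\<integral>z. ln (norm (HH n \<omega> z)) * \<Psi> z \<partial>lborel) / real n = (\<integral>z. u z * \<Psi> z + U z * \<Psi> z \<partial>lborel)"
        by (simp add: u_def algebra_simps flip: integral_divide_zero)
      also have "\<dots> = (\<integral>z. u z * \<Psi> z \<partial>lborel) + (\<integral>z. U z * \<Psi> z \<partial>lborel)"
        by (rule Bochner_Integration.integral_add[OF u\<Psi> U\<Psi>])
      also have "(\<integral>z. U z * \<Psi> z \<partial>lborel) = (\<integral>a. tent_conv \<phi> r a * limit_density \<alpha> a \<partial>lborel)"
        unfolding U_def \<Psi>_def by (rule integral_log_growth_tent_laplacian[OF \<alpha> R(1,2) \<phi> r R(3)])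
      finally have "(\<integral>z. ln (norm (HH n \<omega> z)) * \<Psi> z \<partial>lborel) / real n - (\<integral>a. tent_conv \<phi> r a * limit_density \<alpha> a \<partial>lborel)
        = (\<integral>z. u z * \<Psi> z \<partial>lborel)" by simp
      also have "\<bar>\<dots>\<bar> \<le> (\<integral>z. B * (indicator (cball 0 R) z * \<bar>u z\<bar>) \<partial>lborel)"
        by (rule order.trans[OF integral_abs_bound integral_mono])
           (use u\<Psi> \<Psi>b integrable_mult_right[OF uabs, of B] in auto)
      also have "\<dots> \<le> B * (109 * pi * R\<^sup>2 * \<epsilon>)" using ul B(1) by (simp add: mult_left_mono)
      finally show "\<bar>(\<integral>z. ln (norm (HH n \<omega> z)) * tent_laplacian \<phi> r z \<partial>lborel) / real n
        - (\<integral>a. tent_conv \<phi> r a * limit_density \<alpha> a \<partial>lborel)\<bar> \<le> e"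
        using \<epsilon>(2) by (simp add: \<Psi>_def)
    qed
  qed
qed

end

section \<open>From potentials to arbitrary test functions\<close>

lemma compact_subset_H_domain:
  assumes "compact K" "K \<subseteq> H_domain \<alpha>"
  obtains R where "0 < R" "R \<in> radii \<alpha>" "K \<subseteq> cball 0 R"
proof (cases "\<alpha> < 1")
  case True
  show ?thesis
  proof (cases "K = {}")
    case empty: True
    show ?thesis by (rule that[of "1/2"]) (use True empty in \<open>auto simp: radii_def\<close>)
  next
    case False
    obtain z where z: "z \<in> K" "\<And>w. w \<in> K \<Longrightarrow> norm w \<le> norm z"
      using continuous_attains_sup[OF assms(1) False continuous_on_norm_id] by auto
    have "norm z < 1" using z(1) assms(2) True by (auto simp: H_domain_def)
    then show ?thesis
      by (intro that[of "max (1/2) (norm z)"]) (use z True in \<open>auto simp: radii_def le_max_iff_disj\<close>)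
  qed
next
  case False
  obtain b where b: "\<And>x. x \<in> K \<Longrightarrow> norm x \<le> b" using compact_imp_bounded[OF assms(1)] by (auto simp: bounded_iff)
  show ?thesis
    by (rule that[of "max 1 b"]) (use b False in \<open>auto simp: radii_def le_max_iff_disj\<close>)
qed

text \<open>Extension by 0 is continuous because the domain and the complement of the support are
  open sets that cover the plane.\<close>

lemma compactly_supported_extension:
  fixes \<phi> :: "complex \<Rightarrow> real"
  assumes "compactly_supported_on (H_domain \<alpha>) \<phi>"
  obtains \<phi>' R where "continuous_on UNIV \<phi>'" "0 < R" "R \<in> radii \<alpha>" "\<And>z. norm z > R \<Longrightarrow> \<phi>' z = 0"
    "\<And>z. z \<in> H_domain \<alpha> \<Longrightarrow> \<phi>' z = \<phi> z"
proof -
  obtain K where K: "compact K" "K \<subseteq> H_domain \<alpha>" "\<And>z. z \<in> H_domain \<alpha> - K \<Longrightarrow> \<phi> z = 0"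
    and c: "continuous_on (H_domain \<alpha>) \<phi>"
    using assms unfolding compactly_supported_on_def by blast
  obtain R where R: "0 < R" "R \<in> radii \<alpha>" "K \<subseteq> cball 0 R" by (rule compact_subset_H_domain[OF K(1,2)])
  define \<phi>' where "\<phi>' z = (if z \<in> H_domain \<alpha> then \<phi> z else 0)" for z
  have "continuous_on (H_domain \<alpha> \<union> - K) \<phi>'"
  proof (rule continuous_on_open_Un)
    show "open (H_domain \<alpha>)" by (simp add: H_domain_def)
    show "open (- K)" using K(1) by (simp add: compact_imp_closed open_Compl)
    show "continuous_on (H_domain \<alpha>) \<phi>'" using c by (rule continuous_on_eq) (simp add: \<phi>'_def)
    show "continuous_on (- K) \<phi>'" by (rule continuous_on_eq[of _ "\<lambda>_. 0"]) (use K(3) in \<open>auto simp: \<phi>'_def\<close>)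
  qed
  moreover have "H_domain \<alpha> \<union> - K = UNIV" using K(2) by auto
  ultimately show ?thesis
    using that[of \<phi>' R] R K(3) by (force simp: \<phi>'_def)
qed

context iid_coefficients
begin

text \<open>A plain sum over a closed disc, so that it also accepts functions without compact
  support, such as the constant 1. The first branch matches the convention for a function that
  vanishes identically.\<close>

definition zero_avg :: "nat \<Rightarrow> 'w \<Rightarrow> real \<Rightarrow> (complex \<Rightarrow> real) \<Rightarrow> real" where
  "zero_avg n \<omega> R f = (if \<forall>z\<in>H_domain \<alpha>. HH n \<omega> z = 0 then 0
     else (\<Sum>a\<in>{z\<in>cball 0 R. HH n \<omega> z = 0}. real (nat (zorder (HH n \<omega>) a)) * f a) / real n)"

lemma HH_facts:
  assumes "0 < n" "subexp (\<lambda>k. \<xi> k \<omega>)"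
  shows "HH n \<omega> holomorphic_on H_domain \<alpha>" "open (H_domain \<alpha>)" "connected (H_domain \<alpha>)"
  using H_holomorphic[OF \<alpha> assms] by (auto simp: H_domain_def)

lemma integral_zero_measure_HH:
  assumes n: "0 < n" and sub: "subexp (\<lambda>k. \<xi> k \<omega>)" and R: "R \<in> radii \<alpha>"
    and \<phi>: "continuous_on UNIV \<phi>" "\<And>z. norm z > R \<Longrightarrow> \<phi> z = 0"
  shows "(\<integral>z. \<phi> z \<partial>scale_measure (ennreal (1 / real n)) (zero_measure (H_domain \<alpha>) (HH n \<omega>))) = zero_avg n \<omega> R \<phi>"
proof (cases "\<forall>z\<in>H_domain \<alpha>. HH n \<omega> z = 0")
  case True
  then show ?thesis using integral_zero_measure_trivial[OF True] by (simp add: zero_avg_def)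
next
  case False
  then have nz: "\<exists>z\<in>H_domain \<alpha>. HH n \<omega> z \<noteq> 0" by blast
  have "(\<integral>z. \<phi> z \<partial>scale_measure (ennreal (1 / real n)) (zero_measure (H_domain \<alpha>) (HH n \<omega>)))
    = 1 / real n * (\<Sum>a\<in>{z\<in>cball 0 R. HH n \<omega> z = 0}. real (nat (zorder (HH n \<omega>) a)) * \<phi> a)"
    by (rule integral_zero_measure[OF HH_facts[OF n sub] nz])
       (use radii_pos_D(2)[OF R] \<phi> in \<open>auto intro: continuous_on_subset\<close>)
  then show ?thesis unfolding zero_avg_def if_not_P[OF False] by simp
qed

text \<open>If the function vanishes identically, the right side is 0 as well, by ln 0 = 0 on the
  domain and the support of the kernel outside it.\<close>

lemma zero_avg_tent_conv:
  assumes n: "0 < n" and sub: "subexp (\<lambda>k. \<xi> k \<omega>)" and R: "R \<in> radii \<alpha>" "R0 + 2 * r < R" and r: "0 < r"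
    and \<phi>: "continuous_on UNIV \<phi>" "\<And>z. norm z > R0 \<Longrightarrow> \<phi> z = 0"
  shows "zero_avg n \<omega> R (tent_conv \<phi> r) = (\<integral>z. ln (norm (HH n \<omega> z)) * tent_laplacian \<phi> r z \<partial>lborel) / real n"
proof (cases "\<forall>z\<in>H_domain \<alpha>. HH n \<omega> z = 0")
  case True
  have "ln (norm (HH n \<omega> z)) * tent_laplacian \<phi> r z = 0" for z
  proof (cases "norm z \<le> R")
    case le: True
    then have "z \<in> H_domain \<alpha>" using radii_pos_D(2)[OF R(1)] by auto
    then show ?thesis using True by simp
  next
    case False
    then have "tent_laplacian \<phi> r z = 0" using R(2) by (intro tent_laplacian_eq_0[OF \<phi>(2) r]) auto
    then show ?thesis by simp
  qed
  then have "(\<lambda>z. ln (norm (HH n \<omega> z)) * tent_laplacian \<phi> r z) = (\<lambda>_. 0)" by blast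
  then show ?thesis using True by (simp add: zero_avg_def)
next
  case False
  then have nz: "\<exists>z\<in>H_domain \<alpha>. HH n \<omega> z \<noteq> 0" by blast
  show ?thesis unfolding zero_avg_def if_not_P[OF False]
    using integral_ln_norm_tent_laplacian[OF \<phi> r R(2) radii_pos_D(2)[OF R(1)] HH_facts[OF n sub] nz measurable_HH2]
    by simp
qed

text \<open>The comparison function \<open>h\<close> is the constant 1 where \<omega> is fixed, and
  a tent convolution where the number of zeros must be controlled in probability.\<close>

lemma zero_avg_diff_le:
  assumes f: "\<And>a. norm a \<le> R \<Longrightarrow> \<bar>f a - g a\<bar> \<le> e * h a"
  shows "\<bar>zero_avg n \<omega> R f - zero_avg n \<omega> R g\<bar> \<le> e * zero_avg n \<omega> R h"
proof (cases "\<forall>z\<in>H_domain \<alpha>. HH n \<omega> z = 0")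
  case True
  then show ?thesis by (simp add: zero_avg_def)
next
  case False
  let ?Z = "{z\<in>cball 0 R. HH n \<omega> z = 0}" and ?m = "\<lambda>a. real (nat (zorder (HH n \<omega>) a))"
  have "\<bar>(\<Sum>a\<in>?Z. ?m a * f a) - (\<Sum>a\<in>?Z. ?m a * g a)\<bar> = \<bar>\<Sum>a\<in>?Z. ?m a * (f a - g a)\<bar>"
    by (simp add: sum_subtractf algebra_simps)
  also have "\<dots> \<le> (\<Sum>a\<in>?Z. \<bar>?m a * (f a - g a)\<bar>)" by (rule sum_abs)
  also have "\<dots> \<le> (\<Sum>a\<in>?Z. e * (?m a * h a))"
  proof (rule sum_mono)
    fix a assume "a \<in> ?Z"
    then have "?m a * \<bar>f a - g a\<bar> \<le> ?m a * (e * h a)" using f[of a] by (intro mult_left_mono) auto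
    then show "\<bar>?m a * (f a - g a)\<bar> \<le> e * (?m a * h a)" by (simp add: abs_mult mult_ac)
  qed
  also have "\<dots> = e * (\<Sum>a\<in>?Z. ?m a * h a)" by (simp add: sum_distrib_left)
  finally show ?thesis
    unfolding zero_avg_def if_not_P[OF False] diff_divide_distrib[symmetric] abs_divide
    by (simp add: divide_right_mono)
qed

lemma measurable_log_potential:
  assumes [measurable]: "\<Psi> \<in> borel_measurable borel"
  shows "(\<lambda>\<omega>. (\<integral>z. ln (norm (HH n \<omega> z)) * \<Psi> z \<partial>lborel) / real n) \<in> borel_measurable M"
proof -
  note measurable_HH [measurable]
  have "(\<lambda>(\<omega>, z). ln (norm (HH n \<omega> z)) * \<Psi> z) \<in> borel_measurable (M \<Otimes>\<^sub>M lborel)"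
  proof -
    have "(\<lambda>p. HH n (fst p) (snd p)) \<in> borel_measurable (M \<Otimes>\<^sub>M lborel)"
      unfolding H_eq by measurable
    then show ?thesis unfolding case_prod_beta by measurable
  qed
  then have "(\<lambda>\<omega>. \<integral>z. ln (norm (HH n \<omega> z)) * \<Psi> z \<partial>lborel) \<in> borel_measurable M"
    by (rule lborel.borel_measurable_lebesgue_integral)
  then show ?thesis by simp
qed

text \<open>Zeros are never selected measurably. Almost surely the integral is the limit of
  logarithmic potentials against tent kernels with shrinking radius, and these are measurable as
  integrals with a parameter.\<close>

lemma measurable_zero_integral:
  fixes \<phi> :: "complex \<Rightarrow> real"
  assumes R: "R0 < R" "R \<in> radii \<alpha>"
    and \<phi>: "continuous_on UNIV \<phi>" "\<And>z. norm z > R0 \<Longrightarrow> \<phi> z = 0"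
  shows "(\<lambda>\<omega>. \<integral>z. \<phi> z \<partial>scale_measure (ennreal (1 / real n)) (zero_measure (H_domain \<alpha>) (HH n \<omega>)))
    \<in> borel_measurable (completion M)"
proof (cases "n = 0")
  \<comment> \<open>By the convention 1/0 = 0 the scaled measure is null.\<close>
  case True
  have "(\<integral>z. \<phi> z \<partial>scale_measure (ennreal (1 / real n)) N) = 0" for N
  proof -
    have "AE z in scale_measure (ennreal (1 / real n)) N. \<phi> z = 0"
      using True by (intro AE_I[of _ _ "space N"]) auto
    then show ?thesis by (rule integral_eq_zero_AE)
  qed
  then show ?thesis by simp
next
  case False
  then have n: "0 < n" by simp
  have "(\<lambda>i::nat. (R - R0) / 4 * (1 / real (Suc i))) \<longlonglongrightarrow> (R - R0) / 4 * 0"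
    by (intro tendsto_intros) (rule LIMSEQ_Suc[OF lim_1_over_n, unfolded o_def])
  then have r0: "(\<lambda>i::nat. (R - R0) / 4 * (1 / real (Suc i))) \<longlonglongrightarrow> 0" by simp
  define r where "r i = (R - R0) / 4 * (1 / real (Suc i))" for i :: nat
  have r: "0 < r i" "R0 + 2 * r i < R" for i
  proof -
    show "0 < r i" using R by (simp add: r_def)
    have "r i \<le> (R - R0) / 4 * 1" unfolding r_def using R by (intro mult_left_mono) auto
    then have "4 * r i \<le> R - R0" by simp
    then show "R0 + 2 * r i < R" using R(1) by linarith
  qed
  define V where "V i \<omega> = (\<integral>z. ln (norm (HH n \<omega> z)) * tent_laplacian \<phi> (r i) z \<partial>lborel) / real n" for i \<omega>
  have [measurable]: "V i \<in> borel_measurable M" for i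
    unfolding V_def[abs_def]
    by (intro measurable_log_potential borel_measurable_continuous_onI continuous_on_tent_laplacian[OF \<phi> r(1)])
  show ?thesis
  proof (rule measurable_completion_of_AE_eq)
    show "(\<lambda>\<omega>. lim (\<lambda>i. V i \<omega>)) \<in> borel_measurable M" by measurable
    show "AE \<omega> in M. (\<integral>z. \<phi> z \<partial>scale_measure (ennreal (1 / real n)) (zero_measure (H_domain \<alpha>) (HH n \<omega>))) = lim (\<lambda>i. V i \<omega>)"
      using AE_coefficients_subexp
    proof eventually_elim
      case (elim \<omega>)
      have V: "V i \<omega> = zero_avg n \<omega> R (tent_conv \<phi> (r i))" for i
        unfolding V_def by (rule zero_avg_tent_conv[OF n elim R(2) r(2) r(1) \<phi>, symmetric])
      have "(\<lambda>i. V i \<omega>) \<longlonglongrightarrow> zero_avg n \<omega> R \<phi>"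
      proof (rule LIMSEQ_I)
        fix e :: real assume e: "0 < e"
        \<comment> \<open>The normalised number of zeros in the disc; for this fixed \<omega> it is
          a finite number that only scales the uniform error.\<close>
        define c where "c = zero_avg n \<omega> R (\<lambda>_. 1)"
        have c: "0 \<le> c" unfolding c_def zero_avg_def by (auto intro!: divide_nonneg_nonneg sum_nonneg)
        have e': "0 < e / (2 * (c + 1))" using e c by simp
        obtain s where s: "0 < s" "\<And>r a. 0 < r \<Longrightarrow> r \<le> s \<Longrightarrow> \<bar>tent_conv \<phi> r a - \<phi> a\<bar> \<le> e / (2 * (c + 1))"
          by (rule uniform_tent_conv_approx[OF \<phi> e']) (assumption, (rule that; assumption))
        have "\<forall>\<^sub>F i in sequentially. r i < s" using r0 s(1) unfolding r_def by (rule order_tendstoD)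
        then obtain N where N: "\<And>i. N \<le> i \<Longrightarrow> r i < s" by (auto simp: eventually_sequentially)
        have "\<bar>V i \<omega> - zero_avg n \<omega> R \<phi>\<bar> < e" if "N \<le> i" for i
        proof -
          have "\<bar>V i \<omega> - zero_avg n \<omega> R \<phi>\<bar> \<le> e / (2 * (c + 1)) * c"
            unfolding V c_def[symmetric] using zero_avg_diff_le[of R "tent_conv \<phi> (r i)" \<phi> "e / (2 * (c + 1))" "\<lambda>_. 1" n \<omega>]
              s(2)[OF r(1) less_imp_le[OF N[OF that]]] by (simp add: c_def)
          also have "\<dots> \<le> e / 2" using c e by (simp add: field_simps)
          also have "\<dots> < e" using e by simp
          finally show ?thesis .
        qed
        then show "\<exists>N. \<forall>i\<ge>N. norm (V i \<omega> - zero_avg n \<omega> R \<phi>) < e" by auto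
      qed
      moreover have "\<phi> z = 0" if "norm z > R" for z using \<phi>(2) R(1) that by auto
      ultimately show ?case
        using integral_zero_measure_HH[OF n elim R(2) \<phi>(1)] by (simp add: limI)
    qed
  qed
qed

lemma zero_avg_tent_conv_tendsto:
  assumes \<phi>: "continuous_on UNIV \<phi>" "\<And>z. norm z > R0 \<Longrightarrow> \<phi> z = 0" and r: "0 < r"
    and R: "0 < R" "R \<in> radii \<alpha>" "R0 + 2 * r < R" and e: "0 < e" and \<tau>: "0 < \<tau>"
  shows "\<forall>\<^sub>F n in sequentially. \<exists>A\<in>events. prob A \<le> \<tau> \<and> (\<forall>\<omega>\<in>space M - A. subexp (\<lambda>k. \<xi> k \<omega>) \<longrightarrow>
    \<bar>zero_avg n \<omega> R (tent_conv \<phi> r) - (\<integral>a. tent_conv \<phi> r a * limit_density \<alpha> a \<partial>lborel)\<bar> \<le> e)"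
proof -
  have "\<forall>\<^sub>F n in sequentially. \<exists>A\<in>events. prob A \<le> \<tau> \<and> (\<forall>\<omega>\<in>space M - A. subexp (\<lambda>k. \<xi> k \<omega>) \<longrightarrow>
    \<bar>(\<integral>z. ln (norm (HH n \<omega> z)) * tent_laplacian \<phi> r z \<partial>lborel) / real n - (\<integral>a. tent_conv \<phi> r a * limit_density \<alpha> a \<partial>lborel)\<bar> \<le> e)"
    by (rule log_potential_tendsto[OF \<phi> r R e \<tau>])
  then show ?thesis
    using eventually_gt_at_top[of 0]
  proof eventually_elim
    case (elim n)
    then show ?case using zero_avg_tent_conv[OF elim(2) _ R(2,3) r \<phi>] by simp
  qed
qed

lemma integral_limit_density_diff:
  assumes R: "0 < R" "R \<in> radii \<alpha>"
    and f: "f \<in> borel_measurable borel" "\<And>z. \<bar>f z\<bar> \<le> B" "\<And>z. R \<le> norm z \<Longrightarrow> f z = 0"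
    and g: "g \<in> borel_measurable borel" "\<And>z. R \<le> norm z \<Longrightarrow> g z = 0"
    and fg: "\<And>z. \<bar>f z - g z\<bar> \<le> e"
  shows "\<bar>(\<integral>z. f z * limit_density \<alpha> z \<partial>lborel) - (\<integral>z. g z * limit_density \<alpha> z \<partial>lborel)\<bar>
    \<le> e * (\<integral>z. indicator (ball 0 R) z * limit_density \<alpha> z \<partial>lborel)"
proof -
  have gb: "\<bar>g z\<bar> \<le> B + e" for z using f(2)[of z] fg[of z] by linarith
  have fi: "integrable lborel (\<lambda>z. f z * limit_density \<alpha> z)" by (rule integrable_limit_density[OF \<alpha> R f])
  have gi: "integrable lborel (\<lambda>z. g z * limit_density \<alpha> z)" by (rule integrable_limit_density[OF \<alpha> R g(1) gb g(2)])
  have ii: "integrable lborel (\<lambda>z. indicator (ball 0 R) z * limit_density \<alpha> z)"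
    by (rule integrable_limit_density[OF \<alpha> R, of _ 1]) (auto simp: indicator_def)
  have "(\<integral>z. f z * limit_density \<alpha> z \<partial>lborel) - (\<integral>z. g z * limit_density \<alpha> z \<partial>lborel)
     = (\<integral>z. f z * limit_density \<alpha> z - g z * limit_density \<alpha> z \<partial>lborel)"
    using fi gi by simp
  also have "\<bar>\<dots>\<bar> \<le> (\<integral>z. e * (indicator (ball 0 R) z * limit_density \<alpha> z) \<partial>lborel)"
  proof (rule order.trans[OF integral_abs_bound integral_mono])
    fix z
    have "0 \<le> limit_density \<alpha> z" using \<alpha> by (intro limit_density_nonneg) auto
    then have "\<bar>f z - g z\<bar> * limit_density \<alpha> z \<le> e * limit_density \<alpha> z" using fg by (intro mult_right_mono)
    then show "\<bar>f z * limit_density \<alpha> z - g z * limit_density \<alpha> z\<bar> \<le> e * (indicator (ball 0 R) z * limit_density \<alpha> z)"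
      using f(3)[of z] g(2)[of z] \<open>0 \<le> limit_density \<alpha> z\<close>
      by (cases "norm z < R") (auto simp: left_diff_distrib[symmetric] abs_mult)
  qed (use fi gi ii in \<open>auto intro: integrable_mult_right\<close>)
  finally show ?thesis by simp
qed

lemma borel_measurable_tent_conv:
  assumes [measurable]: "\<phi> \<in> borel_measurable borel"
  shows "tent_conv \<phi> r \<in> borel_measurable borel"
  unfolding tent_conv_def[abs_def] by measurable

text \<open>Three errors of size e/3: from the test function to its tent convolution under the
  zeros, the convergence for the convolution, and back under the limit density. The first requires a
  bound on the number of zeros, obtained from the convergence for a smoothed cutoff that is at least
  1/2 on the disc.\<close>

lemma zero_avg_tendsto:
  assumes \<phi>: "continuous_on UNIV \<phi>" "\<And>z. norm z > R0 \<Longrightarrow> \<phi> z = 0"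
    and R0: "0 < R0" "R0 \<in> radii \<alpha>"
    and e: "0 < e" and \<tau>: "0 < \<tau>"
  shows "\<forall>\<^sub>F n in sequentially. \<exists>A\<in>events. prob A \<le> \<tau> \<and> (\<forall>\<omega>\<in>space M - A. subexp (\<lambda>k. \<xi> k \<omega>) \<longrightarrow>
    \<bar>(\<integral>z. \<phi> z \<partial>scale_measure (ennreal (1 / real n)) (zero_measure (H_domain \<alpha>) (HH n \<omega>)))
      - (\<integral>a. \<phi> a * limit_density \<alpha> a \<partial>lborel)\<bar> \<le> e)"
proof -
  have step: "\<exists>S. R < S \<and> S \<in> radii \<alpha>" if R: "0 < R" "R \<in> radii \<alpha>" for R
  proof -
    obtain \<epsilon> where "0 < \<epsilon>" "exp (2 * \<epsilon>) * R \<in> radii \<alpha>" using radii_scale[OF R(2)] by blast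
    then show ?thesis using R(1) by (intro exI[of _ "exp (2 * \<epsilon>) * R"]) auto
  qed
  obtain R where R: "R0 < R" "R \<in> radii \<alpha>" using step[OF R0] by blast
  have Rpos: "0 < R" using R R0 by simp
  obtain S where S: "R < S" "S \<in> radii \<alpha>" using step[OF Rpos R(2)] by blast
  have Spos: "0 < S" using S Rpos by simp
  \<comment> \<open>The cutoff is 1 up to R' and 0 beyond R''; the gap up to \<open>S\<close> leaves
    room for its tents.\<close>
  define R' where "R' = (R + S) / 2"
  define R'' where "R'' = (R' + S) / 2"
  have RS: "R < R'" "R' < R''" "R'' < S" using S by (auto simp: R'_def R''_def)
  define \<gamma> :: "complex \<Rightarrow> real" where "\<gamma> z = max 0 (min 1 ((R'' - norm z) / (R'' - R')))" for z
  have \<gamma>c: "continuous_on UNIV \<gamma>" unfolding \<gamma>_def using RS by (intro continuous_intros) auto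
  have \<gamma>1: "\<gamma> z = 1" if "norm z \<le> R'" for z
  proof -
    have "1 \<le> (R'' - norm z) / (R'' - R')" using that RS by (simp add: pos_le_divide_eq)
    then show ?thesis by (simp add: \<gamma>_def)
  qed
  have \<gamma>0: "\<gamma> z = 0" if "R'' < norm z" for z
  proof -
    have "(R'' - norm z) / (R'' - R') \<le> 0" using that RS by (intro divide_nonpos_pos) auto
    then show ?thesis by (simp add: \<gamma>_def)
  qed
  have half: "0 < (1/2::real)" by simp
  obtain s0 where s0: "0 < s0" "\<And>r a. 0 < r \<Longrightarrow> r \<le> s0 \<Longrightarrow> \<bar>tent_conv \<gamma> r a - \<gamma> a\<bar> \<le> 1/2"
    by (rule uniform_tent_conv_approx[OF \<gamma>c \<gamma>0 half]) (assumption, (rule that; assumption))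
  define s where "s = min s0 ((S - R'') / 4)"
  have "s \<le> (S - R'') / 4" unfolding s_def by (rule min.cobounded2)
  then have s: "0 < s" "s \<le> s0" "R'' + 2 * s < S" using s0(1) RS(3) by (auto simp: s_def)
  have \<gamma>s: "1/2 \<le> tent_conv \<gamma> s a" if "norm a \<le> R" for a
  proof -
    have "\<gamma> a = 1" using that RS by (intro \<gamma>1) auto
    then show ?thesis using s0(2)[OF s(1,2), of a] by linarith
  qed
  have \<gamma>s0: "0 \<le> tent_conv \<gamma> s a" for a
    unfolding tent_conv_def using tent_mass_pos[OF s(1)] tent_nonneg[OF s(1)]
    by (intro divide_nonneg_nonneg Bochner_Integration.integral_nonneg) (auto simp: \<gamma>_def)
  define I\<gamma> where "I\<gamma> = (\<integral>a. tent_conv \<gamma> s a * limit_density \<alpha> a \<partial>lborel)"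
  define m where "m = (\<integral>z. indicator (ball 0 R) z * limit_density \<alpha> z \<partial>lborel)"
  have m0: "0 \<le> m" unfolding m_def using \<alpha> by (intro Bochner_Integration.integral_nonneg) (auto intro!: limit_density_nonneg mult_nonneg_nonneg)
  have I\<gamma>0: "0 \<le> I\<gamma>" unfolding I\<gamma>_def using \<alpha> \<gamma>s0 by (intro Bochner_Integration.integral_nonneg) (auto intro!: limit_density_nonneg mult_nonneg_nonneg)
  \<comment> \<open>One constant for both smoothing errors: 2 * (I\<gamma> + 1) bounds the
    normalised number of zeros with high probability, and \<open>m\<close> is the limit mass of the
    disc.\<close>
  define \<Lambda> where "\<Lambda> = 2 * (I\<gamma> + 1) + m"
  have \<Lambda>: "0 < \<Lambda>" "2 * (I\<gamma> + 1) \<le> \<Lambda>" "m \<le> \<Lambda>" using m0 I\<gamma>0 by (auto simp: \<Lambda>_def)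
  define \<delta> where "\<delta> = e / 3 / \<Lambda>"
  have \<delta>: "0 < \<delta>" "\<delta> * \<Lambda> = e / 3" using e \<Lambda> by (auto simp: \<delta>_def)
  obtain r0 where r0: "0 < r0" "\<And>r a. 0 < r \<Longrightarrow> r \<le> r0 \<Longrightarrow> \<bar>tent_conv \<phi> r a - \<phi> a\<bar> \<le> \<delta>"
    by (rule uniform_tent_conv_approx[OF \<phi> \<delta>(1)]) (assumption, (rule that; assumption))
  define r where "r = min r0 ((R - R0) / 4)"
  have "r \<le> (R - R0) / 4" unfolding r_def by (rule min.cobounded2)
  then have r: "0 < r" "r \<le> r0" "R0 + 2 * r < R" using r0(1) R(1) by (auto simp: r_def)
  note approx = r0(2)[OF r(1,2)]
  have [measurable]: "\<phi> \<in> borel_measurable borel" using \<phi>(1) by (rule borel_measurable_continuous_onI)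
  obtain B where B: "\<And>z. \<bar>\<phi> z\<bar> \<le> B" using bounded_compact_support[OF \<phi>] by blast
  have lim: "\<bar>(\<integral>a. \<phi> a * limit_density \<alpha> a \<partial>lborel) - (\<integral>a. tent_conv \<phi> r a * limit_density \<alpha> a \<partial>lborel)\<bar> \<le> e / 3"
  proof -
    have "\<bar>(\<integral>a. \<phi> a * limit_density \<alpha> a \<partial>lborel) - (\<integral>a. tent_conv \<phi> r a * limit_density \<alpha> a \<partial>lborel)\<bar> \<le> \<delta> * m"
      unfolding m_def
    proof (rule integral_limit_density_diff[OF Rpos R(2) _ B])
      show "tent_conv \<phi> r \<in> borel_measurable borel" by (rule borel_measurable_tent_conv) measurable
      show "\<phi> z = 0" if "R \<le> norm z" for z using \<phi>(2) that R by auto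
      show "tent_conv \<phi> r z = 0" if "R \<le> norm z" for z
        by (rule tent_conv_eq_0[OF \<phi>(2) r(1)]) (use r that in auto)
      show "\<bar>\<phi> z - tent_conv \<phi> r z\<bar> \<le> \<delta>" for z using approx[of z] by (simp add: abs_minus_commute)
    qed measurable
    also have "\<dots> \<le> \<delta> * \<Lambda>" using \<delta>(1) \<Lambda>(3) by (intro mult_left_mono) auto
    finally show ?thesis using \<delta>(2) by simp
  qed
  have \<tau>2: "0 < \<tau> / 2" and e3: "0 < e / 3" and one: "0 < (1::real)" using \<tau> e by auto
  have "\<forall>\<^sub>F n in sequentially. \<exists>A\<in>events. prob A \<le> \<tau> / 2 \<and> (\<forall>\<omega>\<in>space M - A. subexp (\<lambda>k. \<xi> k \<omega>) \<longrightarrow>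
    \<bar>zero_avg n \<omega> R (tent_conv \<phi> r) - (\<integral>a. tent_conv \<phi> r a * limit_density \<alpha> a \<partial>lborel)\<bar> \<le> e / 3)"
    by (rule zero_avg_tent_conv_tendsto[OF \<phi> r(1) Rpos R(2) r(3) e3 \<tau>2])
  moreover have "\<forall>\<^sub>F n in sequentially. \<exists>A\<in>events. prob A \<le> \<tau> / 2 \<and> (\<forall>\<omega>\<in>space M - A. subexp (\<lambda>k. \<xi> k \<omega>) \<longrightarrow>
    \<bar>zero_avg n \<omega> S (tent_conv \<gamma> s) - (\<integral>a. tent_conv \<gamma> s a * limit_density \<alpha> a \<partial>lborel)\<bar> \<le> 1)"
    by (rule zero_avg_tent_conv_tendsto[OF \<gamma>c \<gamma>0 s(1) Spos S(2) s(3) one \<tau>2])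
  ultimately show ?thesis
    using eventually_gt_at_top[of 0]
  proof eventually_elim
    case (elim n)
    obtain A1 where A1: "A1 \<in> events" "prob A1 \<le> \<tau> / 2" "\<forall>\<omega>\<in>space M - A1. subexp (\<lambda>k. \<xi> k \<omega>) \<longrightarrow>
        \<bar>zero_avg n \<omega> R (tent_conv \<phi> r) - (\<integral>a. tent_conv \<phi> r a * limit_density \<alpha> a \<partial>lborel)\<bar> \<le> e / 3"
      using elim(1) by blast
    obtain A2 where A2: "A2 \<in> events" "prob A2 \<le> \<tau> / 2" "\<forall>\<omega>\<in>space M - A2. subexp (\<lambda>k. \<xi> k \<omega>) \<longrightarrow>
        \<bar>zero_avg n \<omega> S (tent_conv \<gamma> s) - I\<gamma>\<bar> \<le> 1"
      using elim(2) unfolding I\<gamma>_def by blast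
    show ?case
    proof (intro bexI[of _ "A1 \<union> A2"] conjI ballI impI)
      show "A1 \<union> A2 \<in> events" using A1 A2 by auto
      show "prob (A1 \<union> A2) \<le> \<tau>" using measure_Un_le[OF A1(1) A2(1)] A1(2) A2(2) by linarith
      fix \<omega> assume \<omega>: "\<omega> \<in> space M - (A1 \<union> A2)" and sub: "subexp (\<lambda>k. \<xi> k \<omega>)"
      have eq: "(\<integral>z. \<phi> z \<partial>scale_measure (ennreal (1 / real n)) (zero_measure (H_domain \<alpha>) (HH n \<omega>))) = zero_avg n \<omega> S \<phi>"
        by (rule integral_zero_measure_HH[OF elim(3) sub S(2) \<phi>(1)]) (use \<phi>(2) R S in auto)
      \<comment> \<open>Both radii exceed the support of the convolution, so both averages equal the
        same logarithmic potential.\<close>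
      have \<phi>R: "zero_avg n \<omega> S (tent_conv \<phi> r) = zero_avg n \<omega> R (tent_conv \<phi> r)"
        using zero_avg_tent_conv[where ?R0.0 = R0, OF elim(3) sub S(2) _ r(1) \<phi>] zero_avg_tent_conv[OF elim(3) sub R(2) r(3) r(1) \<phi>] r(3) S(1)
        by simp
      have "\<bar>zero_avg n \<omega> S \<phi> - zero_avg n \<omega> S (tent_conv \<phi> r)\<bar> \<le> (2 * \<delta>) * zero_avg n \<omega> S (tent_conv \<gamma> s)"
      proof (rule zero_avg_diff_le)
        fix a
        show "\<bar>\<phi> a - tent_conv \<phi> r a\<bar> \<le> 2 * \<delta> * tent_conv \<gamma> s a"
        proof (cases "norm a \<le> R")
          case True
          have "\<bar>\<phi> a - tent_conv \<phi> r a\<bar> \<le> 2 * \<delta> * (1/2)" using approx[of a] by (simp add: abs_minus_commute)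
          also have "\<dots> \<le> 2 * \<delta> * tent_conv \<gamma> s a" using \<gamma>s[OF True] \<delta>(1) by (intro mult_left_mono) auto
          finally show ?thesis .
        next
          case False
          then have "\<phi> a = 0" "tent_conv \<phi> r a = 0"
            using \<phi>(2) R r by (auto intro: tent_conv_eq_0[OF \<phi>(2) r(1)])
          then show ?thesis using \<gamma>s0[of a] \<delta>(1) by simp
        qed
      qed
      also have "\<dots> \<le> (2 * \<delta>) * (I\<gamma> + 1)"
      proof (rule mult_left_mono)
        have "\<bar>zero_avg n \<omega> S (tent_conv \<gamma> s) - I\<gamma>\<bar> \<le> 1" using A2(3) \<omega> sub by auto
        then show "zero_avg n \<omega> S (tent_conv \<gamma> s) \<le> I\<gamma> + 1" by linarith
      qed (use \<delta>(1) in simp)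
      also have "\<dots> = \<delta> * (2 * (I\<gamma> + 1))" by simp
      also have "\<dots> \<le> \<delta> * \<Lambda>" using \<Lambda>(2) \<delta>(1) by (intro mult_left_mono) auto
      finally have 1: "\<bar>zero_avg n \<omega> S \<phi> - zero_avg n \<omega> R (tent_conv \<phi> r)\<bar> \<le> e / 3" using \<delta>(2) \<phi>R by simp
      have 2: "\<bar>zero_avg n \<omega> R (tent_conv \<phi> r) - (\<integral>a. tent_conv \<phi> r a * limit_density \<alpha> a \<partial>lborel)\<bar> \<le> e / 3"
        using A1(3) \<omega> sub by auto
      show "\<bar>(\<integral>z. \<phi> z \<partial>scale_measure (ennreal (1 / real n)) (zero_measure (H_domain \<alpha>) (HH n \<omega>)))
        - (\<integral>a. \<phi> a * limit_density \<alpha> a \<partial>lborel)\<bar> \<le> e"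
        unfolding eq using 1 2 lim by linarith
    qed
  qed
qed

lemma zero_measure_space: "space (scale_measure k (zero_measure (H_domain \<alpha>) G)) = H_domain \<alpha>"
  by (auto simp: zero_measure_def space_restrict_space space_scale_measure)

theorem zeros_tendsto:
  "random_measures_tendsto_in_probability M (H_domain \<alpha>)
     (\<lambda>n \<omega>. scale_measure (ennreal (1 / real n)) (zero_measure (H_domain \<alpha>) (HH n \<omega>)))
     (\<lambda>_. limit_measure \<alpha>)"
  unfolding random_measures_tendsto_in_probability_def
proof (intro allI impI)
  fix \<phi>0 :: "complex \<Rightarrow> real" assume "compactly_supported_on (H_domain \<alpha>) \<phi>0"
  then obtain \<phi> R0 where \<phi>: "continuous_on UNIV \<phi>" "\<And>z. norm z > R0 \<Longrightarrow> \<phi> z = 0"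
    and R0: "0 < R0" "R0 \<in> radii \<alpha>" and eq: "\<And>z. z \<in> H_domain \<alpha> \<Longrightarrow> \<phi> z = \<phi>0 z"
    by (rule compactly_supported_extension) (rule that; assumption)
  have [measurable]: "\<phi> \<in> borel_measurable borel" using \<phi>(1) by (rule borel_measurable_continuous_onI)
  obtain \<epsilon> where \<epsilon>: "0 < \<epsilon>" "exp (2 * \<epsilon>) * R0 \<in> radii \<alpha>" using radii_scale[OF R0(2)] by blast
  have R: "R0 < exp (2 * \<epsilon>) * R0" using \<epsilon>(1) R0(1) by simp
  define X where "X n \<omega> = (\<integral>z. \<phi> z \<partial>scale_measure (ennreal (1 / real n)) (zero_measure (H_domain \<alpha>) (HH n \<omega>)))" for n \<omega>
  define L where "L = (\<integral>a. \<phi> a * limit_density \<alpha> a \<partial>lborel)"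
  have X: "(\<integral>z. \<phi>0 z \<partial>scale_measure (ennreal (1 / real n)) (zero_measure (H_domain \<alpha>) (HH n \<omega>))) = X n \<omega>" for n \<omega>
    unfolding X_def by (rule Bochner_Integration.integral_cong) (auto simp: zero_measure_space eq)
  have "(\<integral>z. \<phi>0 z \<partial>limit_measure \<alpha>) = (\<integral>z. \<phi> z \<partial>limit_measure \<alpha>)"
    by (rule Bochner_Integration.integral_cong) (auto simp: limit_measure_def space_restrict_space eq)
  also have "\<dots> = L"
  proof -
    have "\<phi> z = 0" if "z \<notin> H_domain \<alpha>" for z
      using that \<phi>(2) radii_pos_D(2)[OF R0(2)] by (cases "norm z \<le> R0") auto
    then show ?thesis unfolding L_def using \<alpha> by (intro integral_limit_measure) auto
  qed
  finally have L: "(\<integral>z. \<phi>0 z \<partial>limit_measure \<alpha>) = L" .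
  have Xm [measurable]: "X n \<in> borel_measurable (completion M)" for n
    unfolding X_def[abs_def] by (rule measurable_zero_integral[OF R \<epsilon>(2) \<phi>])
  have "(\<lambda>n. measure (completion M) {\<omega>\<in>space M. \<bar>X n \<omega> - L\<bar> > e}) \<longlonglongrightarrow> 0" if e: "0 < e" for e
  proof (rule LIMSEQ_I)
    fix \<tau> :: real assume \<tau>: "0 < \<tau>"
    then have \<tau>2: "0 < \<tau> / 2" by simp
    have "\<forall>\<^sub>F n in sequentially. \<exists>A\<in>events. prob A \<le> \<tau> / 2 \<and> (\<forall>\<omega>\<in>space M - A. subexp (\<lambda>k. \<xi> k \<omega>) \<longrightarrow>
      \<bar>X n \<omega> - L\<bar> \<le> e)"
      unfolding X_def L_def by (rule zero_avg_tendsto[OF \<phi> R0 e \<tau>2])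
    then have "\<forall>\<^sub>F n in sequentially. measure (completion M) {\<omega>\<in>space M. \<bar>X n \<omega> - L\<bar> > e} < \<tau>"
    proof eventually_elim
      case (elim n)
      then obtain A where A: "A \<in> events" "prob A \<le> \<tau> / 2"
        "\<forall>\<omega>\<in>space M - A. subexp (\<lambda>k. \<xi> k \<omega>) \<longrightarrow> \<bar>X n \<omega> - L\<bar> \<le> e"
        by blast
      interpret C: prob_space "completion M"
        by standard (simp add: emeasure_space_1)
      \<comment> \<open>A bad outcome outside \<open>A\<close> would violate \<open>subexp\<close>,
        which has probability 0.\<close>
      have "AE \<omega> in completion M. \<omega> \<in> {\<omega>\<in>space M. \<bar>X n \<omega> - L\<bar> > e} \<longrightarrow> \<omega> \<in> A"
        using AE_completion[OF AE_coefficients_subexp] by eventually_elim (use A(3) in force)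
      then have "measure (completion M) {\<omega>\<in>space M. \<bar>X n \<omega> - L\<bar> > e} \<le> measure (completion M) A"
        by (rule C.finite_measure_mono_AE) (use A(1) in auto)
      also have "\<dots> \<le> \<tau> / 2" using A(1,2) by simp
      finally show ?case using \<tau> by simp
    qed
    then show "\<exists>N. \<forall>n\<ge>N. norm (measure (completion M) {\<omega>\<in>space M. \<bar>X n \<omega> - L\<bar> > e} - 0) < \<tau>"
      by (simp add: eventually_sequentially)
  qed
  then show "tendsto_in_probability M
      (\<lambda>n \<omega>. \<integral>z. \<phi>0 z \<partial>scale_measure (ennreal (1 / real n)) (zero_measure (H_domain \<alpha>) (HH n \<omega>)))
      (\<lambda>\<omega>. \<integral>z. \<phi>0 z \<partial>limit_measure \<alpha>)"
    unfolding tendsto_in_probability_def X L using Xm by auto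
qed

end

theorem theorem2p7:
  fixes M :: "'w measure" and \<xi> :: "nat \<Rightarrow> 'w \<Rightarrow> complex" and \<alpha> :: real
  assumes "prob_space M"
    and "\<alpha> \<in> {0<..<1} \<union> {1<..}"
    and "prob_space.indep_vars M (\<lambda>_. borel) \<xi> UNIV"
    and "\<And>k. distr M borel (\<xi> k) = distr M borel (\<xi> 0)"
    and "\<not> (\<exists>c. AE \<omega> in M. \<xi> 0 \<omega> = c)"
    and "integrable M (\<lambda>\<omega>. ln (1 + norm (\<xi> 0 \<omega>)))"
  shows "random_measures_tendsto_in_probability M (H_domain \<alpha>)
           (\<lambda>n \<omega>. scale_measure (ennreal (1 / real n))
                     (zero_measure (H_domain \<alpha>) (H \<alpha> (\<lambda>k. \<xi> k \<omega>) n)))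
           (\<lambda>_. limit_measure \<alpha>)"
proof -
  interpret prob_space M by fact
  interpret iid_coefficients M \<xi> \<alpha>
    by unfold_locales (use assms in auto)
  show ?thesis by (rule zeros_tendsto)
qed

end
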